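(* Let $p$ be a prime, let $R$ be a $p$-Kummerian ring (with distinguished subgroup $\mu_p\subseteq R^*$) such that $\operatorname{Pic}(R)[p]=0$, and let $S$ be a (commutative) separable $R$-algebra on which a cyclic group $G$ of order $p$ acts via $R$-algebra automorphisms, with $S^G=R$. Fix a nontrivial character $\chi:G\to\mu_p\subseteq R^*$. Then the following are equivalent: (1) $(S,G)$ is a $G$-Galois extension of $R$. (2) $S$ has a $(G,\chi)$-primitive element. If this is the case, then: (3) $S^\chi$ is free of rank $1$ over $R$. Any generator $\alpha$ of $S^\chi$ is $(G,\chi)$-primitive. (4) $S$ is $G$-equivariantly isomorphic (as an $R$-algebra) to the $(G,\chi)$-Kummer extension $R[T]/(T^p-u)$ with $u=\alpha^p$, for any $(G,\chi)$-primitive element $\alpha$. (5) The quotient of two $(G,\chi)$-primitive elements lies in $R^*$. (6) If $\alpha$ is $(G,\chi)$-primitive then, for $b\in(\mathbb{Z}/(p))^*$, the $(G,\chi^b)$-primitive elements are those of the form $u\alpha^b$ where $u\in R^*$. (7) Given nontrivial characters $\chi_1,\chi_2$ of $G$ (with values in $\mu_p$) with $\chi_1=\chi_2^b$ for some $b\in(\mathbb{Z}/(p))^*$, any $(G,\chi_i)$-primitive elements $\alpha_i$ ($i=1,2$) satisfy $\alpha_1/\alpha_2^b\in R^*$.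
   Context: A commutative ring $R$ is $p$-Kummerian if $p$ is prime to $\operatorname{char}(R)$ and its unit group $R^*$ contains a distinguished cyclic subgroup $\mu_p$ of order $p$. $\operatorname{Pic}(R)[p]$ is the $p$-torsion subgroup of the Picard group. A commutative $R$-algebra $S$ is separable if it is projective as an $S\otimes_R S$-module. "$S^G=R$" means that $R\to S$ is injective with image the ring of invariants $S^G$. Galois extension: a commutative ring extension $S$ of $R$ with an action of a finite group $G$ is a $G$-Galois extension of $R$ if $G$ acts faithfully on $S$ by $R$-algebra automorphisms, $S^G=R$, $S$ is a separable $R$-algebra, and for all $g\neq h$ in $G$ and every nonzero idempotent $e\in S$ there is $s\in S$ with $g(s)e\neq h(s)e$. $S^\chi=\{\alpha\in S: g(\alpha)=\chi(g)\alpha\ \forall g\in G\}$. For a nontrivial character $\chi:G\to\mu_p$, an element $\alpha\in S$ is $(G,\chi)$-primitive if $\alpha\in S^\chi$ and $1,\alpha,\dots,\alpha^{p-1}$ is an $R$-module basis of $S$. For $u\in R^*$, the $(G,\chi)$-Kummer extension attached to $u$ is $R[T]/(T^p-u)$ with $G$ acting by $R$-algebra automorphisms via $g(T)=\chi(g)T$. In expressions $\alpha^b$ with $b\in(\mathbb{Z}/(p))^*$, any integer representative of $b$ may be used.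
   Formalization: "p-Kummerian" is taken to mean that p is a unit of R (instead of merely prime to char(R)) and that the elements of μ_p sum to 0, i.e. its generator is a root of 1+T+…+T^{p-1}; without this (1)⇒(2) fails, e.g. for R=F_7×F_7, p=3, μ_3=⟨(1,2)⟩, S=R^3. *)

theory Defs
  imports
    "HOL-Computational_Algebra.Primes"
    "HOL-Algebra.Module"
    "HOL-Algebra.UnivPoly"
    "HOL-Algebra.QuotRing"
    "HOL-Algebra.Group_Action"
    "HOL-Algebra.Elementary_Groups"
begin

section \<open>Modules over a commutative ring\<close>

definition mod_hom ::
    "('a, 'c) ring_scheme \<Rightarrow> ('a, 'm, 'd) module_scheme \<Rightarrow> ('a, 'n, 'e) module_scheme \<Rightarrow> ('m \<Rightarrow> 'n) set"
  where "mod_hom R M N =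
    {f. f \<in> carrier M \<rightarrow> carrier N \<and>
        (\<forall>x\<in>carrier M. \<forall>y\<in>carrier M. f (x \<oplus>\<^bsub>M\<^esub> y) = f x \<oplus>\<^bsub>N\<^esub> f y) \<and>
        (\<forall>r\<in>carrier R. \<forall>x\<in>carrier M. f (r \<odot>\<^bsub>M\<^esub> x) = r \<odot>\<^bsub>N\<^esub> f x)}"

definition mod_iso ::
    "('a, 'c) ring_scheme \<Rightarrow> ('a, 'm, 'd) module_scheme \<Rightarrow> ('a, 'n, 'e) module_scheme \<Rightarrow> ('m \<Rightarrow> 'n) set"
  where "mod_iso R M N = {f \<in> mod_hom R M N. bij_betw f (carrier M) (carrier N)}"

definition is_basis ::
    "('a, 'c) ring_scheme \<Rightarrow> ('a, 'm, 'd) module_scheme \<Rightarrow> 'i set \<Rightarrow> ('i \<Rightarrow> 'm) \<Rightarrow> bool"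
  where "is_basis R M I b \<longleftrightarrow>
    b \<in> I \<rightarrow> carrier M \<and>
    (\<forall>x\<in>carrier M. \<exists>!c. c \<in> I \<rightarrow>\<^sub>E carrier R \<and> x = (\<Oplus>\<^bsub>M\<^esub>i\<in>I. c i \<odot>\<^bsub>M\<^esub> b i))"

definition free_of_rank ::
    "('a, 'c) ring_scheme \<Rightarrow> ('a, 'm, 'd) module_scheme \<Rightarrow> nat \<Rightarrow> bool"
  where "free_of_rank R M n \<longleftrightarrow> module R M \<and> (\<exists>b. is_basis R M {..<n} b)"

text \<open>The fields \<open>mult\<close> and \<open>one\<close> of a module record play no role in the locale
  \<^locale>\<open>module\<close>, in \<^const>\<open>mod_hom\<close>, or in \<^const>\<open>is_basis\<close>.\<close>

definition free_module :: "('a, 'c) ring_scheme \<Rightarrow> 'x set \<Rightarrow> ('a, 'x \<Rightarrow> 'a) module"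
  where "free_module R X =
    \<lparr>carrier = {f. (\<forall>x. f x \<in> carrier R) \<and> finite {x. f x \<noteq> \<zero>\<^bsub>R\<^esub>} \<and> {x. f x \<noteq> \<zero>\<^bsub>R\<^esub>} \<subseteq> X},
     monoid.mult = undefined, one = undefined,
     zero = (\<lambda>x. \<zero>\<^bsub>R\<^esub>), add = (\<lambda>f g x. f x \<oplus>\<^bsub>R\<^esub> g x),
     smult = (\<lambda>r f x. r \<otimes>\<^bsub>R\<^esub> f x)\<rparr>"

text \<open>Projective means: a direct summand (retract) of a free module. A projective module is a
  retract of the free module on its own carrier, so index sets inside the type of the
  elements suffice.\<close>

definition projective_module :: "('a, 'c) ring_scheme \<Rightarrow> ('a, 'm, 'd) module_scheme \<Rightarrow> bool"
  where "projective_module R M \<longleftrightarrow>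
    module R M \<and>
    (\<exists>(X :: 'm set) i q. i \<in> mod_hom R M (free_module R X) \<and>
       q \<in> mod_hom R (free_module R X) M \<and> (\<forall>x\<in>carrier M. q (i x) = x))"

text \<open>Quotient by a submodule \<open>I\<close>. If \<open>M\<close> is an algebra and \<open>I\<close> an ideal, this is the
  quotient algebra; its ring part is \<^const>\<open>FactRing\<close>.\<close>

definition quot_module :: "('a, 'm, 'd) module_scheme \<Rightarrow> 'm set \<Rightarrow> ('a, 'm set) module"
  where "quot_module M I =
    \<lparr>carrier = a_rcosets\<^bsub>M\<^esub> I, monoid.mult = rcoset_mult M I,
     one = (I +>\<^bsub>M\<^esub> \<one>\<^bsub>M\<^esub>), zero = I, add = set_add M,
     smult = (\<lambda>r A. \<Union>a\<in>A. I +>\<^bsub>M\<^esub> (r \<odot>\<^bsub>M\<^esub> a))\<rparr>"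

definition submodule_gen ::
    "('a, 'c) ring_scheme \<Rightarrow> ('a, 'm, 'd) module_scheme \<Rightarrow> 'm set \<Rightarrow> 'm set"
  where "submodule_gen R M K = \<Inter>{H. submodule H R M \<and> K \<subseteq> H}"


section \<open>Tensor products\<close>

text \<open>The monoid algebra \<open>R[X]\<close>: the free module on \<open>X\<close> with the convolution product.\<close>

definition delta :: "('a, 'c) ring_scheme \<Rightarrow> 'x \<Rightarrow> 'x \<Rightarrow> 'a"
  where "delta R x = (\<lambda>y. if y = x then \<one>\<^bsub>R\<^esub> else \<zero>\<^bsub>R\<^esub>)"

definition monoid_algebra ::
    "('a, 'c) ring_scheme \<Rightarrow> ('x, 'd) monoid_scheme \<Rightarrow> ('a, 'x \<Rightarrow> 'a) module"
  where "monoid_algebra R X =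
    (free_module R (carrier X))
      \<lparr>monoid.mult := (\<lambda>f g z. \<Oplus>\<^bsub>R\<^esub>w \<in> {(x, y). f x \<noteq> \<zero>\<^bsub>R\<^esub> \<and> g y \<noteq> \<zero>\<^bsub>R\<^esub> \<and> x \<otimes>\<^bsub>X\<^esub> y = z}.
                   f (fst w) \<otimes>\<^bsub>R\<^esub> g (snd w)),
       one := delta R \<one>\<^bsub>X\<^esub>\<rparr>"

text \<open>\<open>M \<otimes>\<^sub>R N\<close> is the free module on \<open>M \<times> N\<close> modulo the bilinearity relations. For
  \<open>R\<close>-algebras \<open>M\<close>, \<open>N\<close> the free module carries the product of the monoid algebra of the
  multiplicative monoid \<open>M \<times> N\<close>, the relations form an ideal, and the induced product is
  \<open>(a \<otimes> b)(c \<otimes> d) = ac \<otimes> bd\<close>. For mere modules the fields \<open>mult\<close> and \<open>one\<close> of the result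
  are meaningless and never used.\<close>

definition tensor_relations ::
    "('a, 'c) ring_scheme \<Rightarrow> ('a, 'm, 'd) module_scheme \<Rightarrow> ('a, 'n, 'e) module_scheme
      \<Rightarrow> ('m \<times> 'n \<Rightarrow> 'a) set"
  where "tensor_relations R M N =
    (let F = monoid_algebra R (M \<times>\<times> N); d = (\<lambda>m n. delta R (m, n)) in
      {d (m \<oplus>\<^bsub>M\<^esub> m') n \<ominus>\<^bsub>F\<^esub> (d m n \<oplus>\<^bsub>F\<^esub> d m' n) | m m' n.
         m \<in> carrier M \<and> m' \<in> carrier M \<and> n \<in> carrier N} \<union>
      {d m (n \<oplus>\<^bsub>N\<^esub> n') \<ominus>\<^bsub>F\<^esub> (d m n \<oplus>\<^bsub>F\<^esub> d m n') | m n n'.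
         m \<in> carrier M \<and> n \<in> carrier N \<and> n' \<in> carrier N} \<union>
      {d (r \<odot>\<^bsub>M\<^esub> m) n \<ominus>\<^bsub>F\<^esub> r \<odot>\<^bsub>F\<^esub> d m n | r m n.
         r \<in> carrier R \<and> m \<in> carrier M \<and> n \<in> carrier N} \<union>
      {d m (r \<odot>\<^bsub>N\<^esub> n) \<ominus>\<^bsub>F\<^esub> r \<odot>\<^bsub>F\<^esub> d m n | r m n.
         r \<in> carrier R \<and> m \<in> carrier M \<and> n \<in> carrier N})"

definition tensor ::
    "('a, 'c) ring_scheme \<Rightarrow> ('a, 'm, 'd) module_scheme \<Rightarrow> ('a, 'n, 'e) module_scheme
      \<Rightarrow> ('a, ('m \<times> 'n \<Rightarrow> 'a) set) module"
  where "tensor R M N =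
    (let F = monoid_algebra R (M \<times>\<times> N) in
      quot_module F (submodule_gen R F (tensor_relations R M N)))"


section \<open>The Picard group\<close>

definition regular_module :: "('a, 'c) ring_scheme \<Rightarrow> ('a, 'a) module"
  where "regular_module R =
    \<lparr>carrier = carrier R, monoid.mult = monoid.mult R, one = \<one>\<^bsub>R\<^esub>, zero = \<zero>\<^bsub>R\<^esub>, add = add R,
     smult = monoid.mult R\<rparr>"

text \<open>An invertible module is a direct summand of some \<open>R\<^sup>n\<close>, so it has an isomorphic copy
  whose elements have type \<^typ>\<open>nat \<Rightarrow> 'a\<close> (tuples padded by zero). Hence the modules on this
  type represent all elements of \<open>Pic(R)\<close>, and also the tensor inverse of any invertible
  module.\<close>

type_synonym 'a pic_module = "('a, nat \<Rightarrow> 'a) module"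

definition invertible_module :: "('a, 'c) ring_scheme \<Rightarrow> 'a pic_module \<Rightarrow> bool"
  where "invertible_module R M \<longleftrightarrow>
    module R M \<and>
    (\<exists>N :: 'a pic_module. module R N \<and> mod_iso R (tensor R M N) (regular_module R) \<noteq> {})"

definition iso_class ::
    "('a, 'c) ring_scheme \<Rightarrow> ('a, 'm, 'd) module_scheme \<Rightarrow> 'a pic_module set"
  where "iso_class R M = {P. module R P \<and> mod_iso R P M \<noteq> {}}"

definition Pic :: "('a, 'c) ring_scheme \<Rightarrow> 'a pic_module set monoid"
  where "Pic R =
    \<lparr>carrier = {iso_class R M | M. invertible_module R M},
     monoid.mult = (\<lambda>A B. \<Union>M\<in>A. \<Union>N\<in>B. iso_class R (tensor R M N)),
     one = iso_class R (regular_module R)\<rparr>"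

definition torsion_subgroup :: "('g, 'c) monoid_scheme \<Rightarrow> nat \<Rightarrow> 'g set"
  where "torsion_subgroup G n = {x \<in> carrier G. x [^]\<^bsub>G\<^esub> n = \<one>\<^bsub>G\<^esub>}"


section \<open>Kummerian rings and characters\<close>

text \<open>Both arithmetic conditions are meant at every point of \<open>Spec R\<close>: \<open>p\<close> is prime to all
  residue characteristics, that is, a unit of \<open>R\<close>; and \<open>\<mu>\<close> is generated by a primitive \<open>p\<close>-th
  root of unity \<open>\<zeta>\<close> in the sense \<open>\<Phi>\<^sub>p(\<zeta>) = 1 + \<zeta> + \<dots> + \<zeta>\<^bsup>p-1\<^esup> = 0\<close>, which is the sum over
  \<open>\<mu>\<close>. If \<open>R\<close> has no idempotents other than 0 and 1, the last condition follows from the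
  others; for \<open>\<mu> = \<langle>(1, \<omega>)\<rangle>\<close> in \<open>\<complex> \<times> \<complex>\<close> it fails, and so does Kummer theory.\<close>

definition p_kummerian :: "nat \<Rightarrow> ('a, 'c) ring_scheme \<Rightarrow> 'a set \<Rightarrow> bool"
  where "p_kummerian p R \<mu> \<longleftrightarrow>
    cring R \<and> [p] \<cdot>\<^bsub>R\<^esub> \<one>\<^bsub>R\<^esub> \<in> Units R \<and>
    subgroup \<mu> (units_of R) \<and> cyclic_group ((units_of R)\<lparr>carrier := \<mu>\<rparr>) \<and> card \<mu> = p \<and>
    (\<Oplus>\<^bsub>R\<^esub>\<zeta>\<in>\<mu>. \<zeta>) = \<zero>\<^bsub>R\<^esub>"

definition nontrivial_character ::
    "('g, 'd) monoid_scheme \<Rightarrow> ('a, 'c) ring_scheme \<Rightarrow> 'a set \<Rightarrow> ('g \<Rightarrow> 'a) \<Rightarrow> bool"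
  where "nontrivial_character G R \<mu> \<chi> \<longleftrightarrow>
    \<chi> \<in> hom G ((units_of R)\<lparr>carrier := \<mu>\<rparr>) \<and> (\<exists>g\<in>carrier G. \<chi> g \<noteq> \<one>\<^bsub>R\<^esub>)"

definition char_pow :: "('a, 'c) ring_scheme \<Rightarrow> ('g \<Rightarrow> 'a) \<Rightarrow> int \<Rightarrow> 'g \<Rightarrow> 'a"
  where "char_pow R \<chi> b = (\<lambda>g. \<chi> g [^]\<^bsub>units_of R\<^esub> b)"


section \<open>Algebras with group action\<close>

definition algebra_iso ::
    "('a, 'c) ring_scheme \<Rightarrow> ('a, 'm, 'd) module_scheme \<Rightarrow> ('a, 'n, 'e) module_scheme \<Rightarrow> ('m \<Rightarrow> 'n) set"
  where "algebra_iso R A B = ring_iso A B \<inter> mod_hom R A B"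

definition structure_map :: "('a, 's, 'd) module_scheme \<Rightarrow> 'a \<Rightarrow> 's"
  where "structure_map S r = r \<odot>\<^bsub>S\<^esub> \<one>\<^bsub>S\<^esub>"

definition algebra_action ::
    "('a, 'c) ring_scheme \<Rightarrow> ('a, 's, 'd) module_scheme \<Rightarrow> ('g, 'e) monoid_scheme
      \<Rightarrow> ('g \<Rightarrow> 's \<Rightarrow> 's) \<Rightarrow> bool"
  where "algebra_action R S G \<phi> \<longleftrightarrow>
    group_action G (carrier S) \<phi> \<and> (\<forall>g\<in>carrier G. \<phi> g \<in> algebra_iso R S S)"

definition invariants_eq_base ::
    "('a, 'c) ring_scheme \<Rightarrow> ('a, 's, 'd) module_scheme \<Rightarrow> ('g, 'e) monoid_scheme
      \<Rightarrow> ('g \<Rightarrow> 's \<Rightarrow> 's) \<Rightarrow> bool"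
  where "invariants_eq_base R S G \<phi> \<longleftrightarrow>
    inj_on (structure_map S) (carrier R) \<and>
    structure_map S ` carrier R = {s \<in> carrier S. \<forall>g\<in>carrier G. \<phi> g s = s}"

text \<open>\<open>S\<close> as a module over \<open>S \<otimes>\<^sub>R S\<close>, via \<open>(a \<otimes> b) \<cdot> s = abs\<close>. Elements of \<open>S \<otimes>\<^sub>R S\<close> are
  cosets, on which \<^term>\<open>mult_hom R S\<close> is constant.\<close>

definition mult_hom ::
    "('a, 'c) ring_scheme \<Rightarrow> ('a, 's, 'd) module_scheme \<Rightarrow> ('s \<times> 's \<Rightarrow> 'a) \<Rightarrow> 's"
  where "mult_hom R S f =
    (\<Oplus>\<^bsub>S\<^esub>z\<in>{z. f z \<noteq> \<zero>\<^bsub>R\<^esub>}. f z \<odot>\<^bsub>S\<^esub> (fst z \<otimes>\<^bsub>S\<^esub> snd z))"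

definition enveloping_module ::
    "('a, 'c) ring_scheme \<Rightarrow> ('a, 's, 'd) module_scheme \<Rightarrow> (('s \<times> 's \<Rightarrow> 'a) set, 's) module"
  where "enveloping_module R S =
    \<lparr>carrier = carrier S, monoid.mult = monoid.mult S, one = \<one>\<^bsub>S\<^esub>, zero = \<zero>\<^bsub>S\<^esub>, add = add S,
     smult = (\<lambda>t s. the_elem (mult_hom R S ` t) \<otimes>\<^bsub>S\<^esub> s)\<rparr>"

definition separable_algebra :: "('a, 'c) ring_scheme \<Rightarrow> ('a, 's, 'd) module_scheme \<Rightarrow> bool"
  where "separable_algebra R S \<longleftrightarrow>
    algebra R S \<and> projective_module (tensor R S S) (enveloping_module R S)"

definition galois_extension ::
    "('a, 'c) ring_scheme \<Rightarrow> ('a, 's, 'd) module_scheme \<Rightarrow> ('g, 'e) monoid_scheme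
      \<Rightarrow> ('g \<Rightarrow> 's \<Rightarrow> 's) \<Rightarrow> bool"
  where "galois_extension R S G \<phi> \<longleftrightarrow>
    finite (carrier G) \<and>
    faithful_action G (carrier S) \<phi> \<and> algebra_action R S G \<phi> \<and>
    invariants_eq_base R S G \<phi> \<and> separable_algebra R S \<and>
    (\<forall>g\<in>carrier G. \<forall>h\<in>carrier G. g \<noteq> h \<longrightarrow>
       (\<forall>e\<in>carrier S. e \<otimes>\<^bsub>S\<^esub> e = e \<and> e \<noteq> \<zero>\<^bsub>S\<^esub> \<longrightarrow>
          (\<exists>s\<in>carrier S. \<phi> g s \<otimes>\<^bsub>S\<^esub> e \<noteq> \<phi> h s \<otimes>\<^bsub>S\<^esub> e)))"

definition char_space ::
    "('a, 's, 'd) module_scheme \<Rightarrow> ('g, 'e) monoid_scheme \<Rightarrow> ('g \<Rightarrow> 's \<Rightarrow> 's) \<Rightarrow> ('g \<Rightarrow> 'a) \<Rightarrow> 's set"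
  where "char_space S G \<phi> \<chi> = {x \<in> carrier S. \<forall>g\<in>carrier G. \<phi> g x = \<chi> g \<odot>\<^bsub>S\<^esub> x}"

definition primitive_elt ::
    "nat \<Rightarrow> ('a, 'c) ring_scheme \<Rightarrow> ('a, 's, 'd) module_scheme \<Rightarrow> ('g, 'e) monoid_scheme
      \<Rightarrow> ('g \<Rightarrow> 's \<Rightarrow> 's) \<Rightarrow> ('g \<Rightarrow> 'a) \<Rightarrow> 's \<Rightarrow> bool"
  where "primitive_elt p R S G \<phi> \<chi> \<alpha> \<longleftrightarrow>
    \<alpha> \<in> char_space S G \<phi> \<chi> \<and> is_basis R S {..<p} (\<lambda>i. \<alpha> [^]\<^bsub>S\<^esub> i)"


section \<open>Kummer extensions\<close>

definition kummer_ideal :: "nat \<Rightarrow> ('a, 'c) ring_scheme \<Rightarrow> 'a \<Rightarrow> (nat \<Rightarrow> 'a) set"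
  where "kummer_ideal p R u =
    Idl\<^bsub>UP R\<^esub> {monom (UP R) \<one>\<^bsub>R\<^esub> p \<ominus>\<^bsub>UP R\<^esub> monom (UP R) u 0}"

definition kummer_extension :: "nat \<Rightarrow> ('a, 'c) ring_scheme \<Rightarrow> 'a \<Rightarrow> ('a, (nat \<Rightarrow> 'a) set) module"
  where "kummer_extension p R u = quot_module (UP R) (kummer_ideal p R u)"

text \<open>\<open>g\<close> acts on classes of polynomials by the substitution \<open>T \<mapsto> \<chi>(g) T\<close>.\<close>

definition kummer_action ::
    "nat \<Rightarrow> ('a, 'c) ring_scheme \<Rightarrow> 'a \<Rightarrow> ('g \<Rightarrow> 'a) \<Rightarrow> 'g \<Rightarrow> (nat \<Rightarrow> 'a) set \<Rightarrow> (nat \<Rightarrow> 'a) set"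
  where "kummer_action p R u \<chi> g A =
    (\<Union>f\<in>A. kummer_ideal p R u +>\<^bsub>UP R\<^esub>
       eval R (UP R) (\<lambda>a. monom (UP R) a 0) (monom (UP R) (\<chi> g) 1) f)"

end

theory Submission
  imports "HOL-Algebra.Multiplicative_Group" Defs
begin

text \<open>
  Write \<open>S\<^sub>k = {s. g(s) = \<chi>(g)\<^sup>k s}\<close>. As \<open>p\<close> and all \<open>1 - \<zeta>\<close> with \<open>1 \<noteq> \<zeta> \<in> \<mu>\<^sub>p\<close> are units of \<open>R\<close>,
  the operators \<open>\<Sum>\<^sub>g \<chi>(g)\<^sup>-\<^sup>k g\<close> decompose \<open>S\<close> into the direct sum of the \<open>S\<^sub>k\<close> with
  \<open>0 \<le> k < p\<close>, and \<open>S\<^sub>0 = R\<close>. If \<open>\<alpha> \<in> S\<^sub>1\<close> is a unit, then \<open>S\<^sub>k = R \<alpha>\<^sup>k\<close>, hence \<open>\<alpha>\<close> is primitive.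
  Conversely, separability of \<open>S\<close> forces a primitive element to be a unit. So the primitive
  elements are the units in \<open>S\<^sub>1\<close>, which gives (5), (6) and (7) at once.

  If \<open>S\<close> is Galois, the separability idempotent \<open>\<Sum>\<^sub>i x\<^sub>i \<otimes> y\<^sub>i\<close> satisfies
  \<open>\<Sum>\<^sub>i x\<^sub>i g(y\<^sub>i) = \<delta>\<^sub>g\<^sub>,\<^sub>1\<close>, because for \<open>g \<noteq> 1\<close> the left side is an idempotent \<open>e\<close> with
  \<open>g(s)e = se\<close> for all \<open>s\<close>. Projecting to eigenspaces yields \<open>1 \<in> S\<^sub>j S\<^sub>p\<^sub>-\<^sub>j\<close>, so that
  \<open>S\<^sub>k \<otimes> S\<^sub>j \<cong> S\<^sub>k\<^sub>+\<^sub>j\<close>. Thus the class of \<open>S\<^sub>1\<close> in the Picard group is killed by \<open>p\<close>, hence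
  trivial, and a generator of \<open>S\<^sub>1\<close> is a unit.
\<close>

section \<open>Module homomorphisms and free modules\<close>

text \<open>Three obstacles shape the proof. The tensor product is a bare quotient of a monoid
  algebra, so it is approached through representatives only: bilinear maps are evaluated on them,
  and an isomorphism is found by inverting a map into the tensor product. \<open>Pic\<close> is made
  of modules on functions from the naturals to the type of \<open>R\<close>, whereas the eigenspaces
  consist of elements of \<open>S\<close>; they have to be copied, and the finite dual basis of a
  Galois extension supplies the injection. Moreover \<open>R\<close> may have zero divisors and
  idempotents, so orthogonality of characters cannot rest on cancelling a nonzero factor: that
  \<open>1 - \<zeta>\<close> is a unit is deduced from
  \<open>1 + \<zeta> + ... + \<zeta>^(p-1) = 0\<close> and the invertibility of \<open>p\<close>.
  Group laws of \<open>Pic R\<close> are not established; computing the powers of one class is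
  enough. The separability idempotent enters in the form of one finite family of pairs, once to make
  primitive elements invertible and once to produce the dual basis.\<close>

lemma mod_homD:
  assumes "f \<in> mod_hom R M N"
  shows "\<And>x. x \<in> carrier M \<Longrightarrow> f x \<in> carrier N"
    and "\<And>x y. \<lbrakk>x \<in> carrier M; y \<in> carrier M\<rbrakk> \<Longrightarrow> f (x \<oplus>\<^bsub>M\<^esub> y) = f x \<oplus>\<^bsub>N\<^esub> f y"
    and "\<And>r x. \<lbrakk>r \<in> carrier R; x \<in> carrier M\<rbrakk> \<Longrightarrow> f (r \<odot>\<^bsub>M\<^esub> x) = r \<odot>\<^bsub>N\<^esub> f x"
  using assms by (auto simp: mod_hom_def)

lemma mod_hom_zero:
  assumes "module R M" "module R N" "f \<in> mod_hom R M N"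
  shows "f \<zero>\<^bsub>M\<^esub> = \<zero>\<^bsub>N\<^esub>"
proof -
  interpret M: module R M by fact
  interpret N: module R N by fact
  have "f (\<zero>\<^bsub>R\<^esub> \<odot>\<^bsub>M\<^esub> \<zero>\<^bsub>M\<^esub>) = \<zero>\<^bsub>R\<^esub> \<odot>\<^bsub>N\<^esub> f \<zero>\<^bsub>M\<^esub>"
    by (rule mod_homD(3)[OF assms(3)]) auto
  then show ?thesis
    using mod_homD(1)[OF assms(3)] by simp
qed

lemma mod_hom_uminus:
  assumes "module R M" "module R N" "f \<in> mod_hom R M N" "x \<in> carrier M"
  shows "f (\<ominus>\<^bsub>M\<^esub> x) = \<ominus>\<^bsub>N\<^esub> f x"
proof -
  interpret M: module R M by fact
  interpret N: module R N by fact
  have "f (\<ominus>\<^bsub>R\<^esub> \<one>\<^bsub>R\<^esub> \<odot>\<^bsub>M\<^esub> x) = \<ominus>\<^bsub>R\<^esub> \<one>\<^bsub>R\<^esub> \<odot>\<^bsub>N\<^esub> f x"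
    by (rule mod_homD(3)[OF assms(3)]) (use assms in auto)
  then show ?thesis
    using mod_homD[OF assms(3)] assms by (simp add: M.smult_l_minus N.smult_l_minus)
qed

lemma mod_hom_minus:
  assumes "module R M" "module R N" "f \<in> mod_hom R M N" "x \<in> carrier M" "y \<in> carrier M"
  shows "f (x \<ominus>\<^bsub>M\<^esub> y) = f x \<ominus>\<^bsub>N\<^esub> f y"
proof -
  interpret M: module R M by fact
  show ?thesis
    using mod_homD[OF assms(3)] mod_hom_uminus[OF assms(1-3)] assms by (simp add: a_minus_def)
qed

lemma (in abelian_group) minus_eq_zero_iff:
  "\<lbrakk>x \<in> carrier G; y \<in> carrier G\<rbrakk> \<Longrightarrow> x \<ominus> y = \<zero> \<longleftrightarrow> x = y"
  using add.inv_solve_right'[of \<zero> x y] by (auto simp: a_minus_def r_neg)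

text \<open>An infinite index set makes both sums zero by convention, so that case is preservation
  of zero; the finite case is an induction.\<close>

lemma mod_hom_finsum:
  assumes "module R M" "module R N" "f \<in> mod_hom R M N" "x \<in> A \<rightarrow> carrier M"
  shows "f (\<Oplus>\<^bsub>M\<^esub>i\<in>A. x i) = (\<Oplus>\<^bsub>N\<^esub>i\<in>A. f (x i))"
proof -
  interpret M: module R M by fact
  interpret N: module R N by fact
  show ?thesis
    using assms(4)
  proof (induction A rule: infinite_finite_induct)
    case (insert a A)
    then have "f (\<Oplus>\<^bsub>M\<^esub>i\<in>A. x i) = (\<Oplus>\<^bsub>N\<^esub>i\<in>A. f (x i))" "x \<in> A \<rightarrow> carrier M" "x a \<in> carrier M"
      by auto
    moreover have "(\<lambda>i. f (x i)) \<in> A \<rightarrow> carrier N" "f (x a) \<in> carrier N"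
      using calculation mod_homD(1)[OF assms(3)] by auto
    ultimately show ?case
      using insert.hyps by (simp add: mod_homD(2)[OF assms(3)])
  qed (simp_all add: mod_hom_zero[OF assms(1-3)])
qed

lemma mod_hom_comp:
  assumes "f \<in> mod_hom R M N" "h \<in> mod_hom R N Q"
  shows "(\<lambda>x. h (f x)) \<in> mod_hom R M Q"
  using assms by (auto simp: mod_hom_def Pi_def)

lemma mod_iso_comp:
  assumes "f \<in> mod_iso R M N" "h \<in> mod_iso R N Q"
  shows "(\<lambda>x. h (f x)) \<in> mod_iso R M Q"
  using assms mod_hom_comp[of f R M N h Q] bij_betw_trans[of f "carrier M" "carrier N" h "carrier Q"]
  by (auto simp: mod_iso_def comp_def)

lemma is_basis_unique:
  assumes "is_basis R M I b" "x \<in> carrier M"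
    and "c \<in> I \<rightarrow>\<^sub>E carrier R \<and> x = (\<Oplus>\<^bsub>M\<^esub>i\<in>I. c i \<odot>\<^bsub>M\<^esub> b i)"
    and "d \<in> I \<rightarrow>\<^sub>E carrier R \<and> x = (\<Oplus>\<^bsub>M\<^esub>i\<in>I. d i \<odot>\<^bsub>M\<^esub> b i)"
  shows "c = d"
  using assms unfolding is_basis_def by blast

lemma mod_iso_inv_into:
  assumes "module R M" and f: "f \<in> mod_iso R M N"
  shows "inv_into (carrier M) f \<in> mod_iso R N M"
proof -
  interpret module R M by fact
  let ?g = "inv_into (carrier M) f"
  have bij: "bij_betw f (carrier M) (carrier N)" and hom: "f \<in> mod_hom R M N"
    using f by (auto simp: mod_iso_def)
  have g: "?g y \<in> carrier M" "f (?g y) = y" if "y \<in> carrier N" for y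
    using that bij by (metis bij_betw_def inv_into_into, metis bij_betw_inv_into_right)
  have gf: "?g (f x) = x" if "x \<in> carrier M" for x
    using that bij by (meson bij_betw_inv_into_left)
  have "?g (x \<oplus>\<^bsub>N\<^esub> y) = ?g x \<oplus>\<^bsub>M\<^esub> ?g y" if "x \<in> carrier N" "y \<in> carrier N" for x y
    using gf[OF M.a_closed[OF g(1) g(1)], OF that] g[OF that(1)] g[OF that(2)] mod_homD(2)[OF hom] by simp
  moreover have "?g (r \<odot>\<^bsub>N\<^esub> x) = r \<odot>\<^bsub>M\<^esub> ?g x" if "r \<in> carrier R" "x \<in> carrier N" for r x
    using gf[OF smult_closed[OF that(1) g(1)[OF that(2)]]] g[OF that(2)] that mod_homD(3)[OF hom] by simp
  ultimately show ?thesis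
    using g bij_betw_inv_into[OF bij] by (auto simp: mod_iso_def mod_hom_def)
qed

text \<open>The module laws speak of the additive group and the scalar action.
  \<open>monoid_algebra\<close> shares both with \<open>free_module\<close> and inherits its module
  structure in this way.\<close>

lemma module_cong_add_monoid:
  assumes "module R M" "add_monoid M = add_monoid N" "smult M = smult N"
  shows "module R N"
proof -
  interpret module R M by fact
  have "carrier M = carrier N" "add M = add N"
    using assms(2) by (auto simp: monoid.defs partial_object.defs)
  then show ?thesis
    using assms M.a_comm_group smult_l_distr smult_r_distr smult_assoc1 smult_one smult_closed
      R.is_cring
    by (auto intro!: moduleI abelian_group.intro
        simp: abelian_monoid_def comm_group_def abelian_group_axioms_def)
qed

section \<open>Free modules and linear extension from a basis\<close>

lemma (in cring) free_module_module: "module R (free_module R X)"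
proof (rule moduleI)
  let ?F = "free_module R X"
  have supp: "finite {x. f x \<oplus> g x \<noteq> \<zero>}" "{x. f x \<oplus> g x \<noteq> \<zero>} \<subseteq> X"
    if "f \<in> carrier ?F" "g \<in> carrier ?F" for f g
  proof -
    have "{x. f x \<oplus> g x \<noteq> \<zero>} \<subseteq> {x. f x \<noteq> \<zero>} \<union> {x. g x \<noteq> \<zero>}"
      by auto
    then show "finite {x. f x \<oplus> g x \<noteq> \<zero>}" "{x. f x \<oplus> g x \<noteq> \<zero>} \<subseteq> X"
      using that by (auto simp: free_module_def intro: finite_subset)
  qed
  show "abelian_group ?F"
  proof (rule abelian_groupI)
    fix f g assume "f \<in> carrier ?F" "g \<in> carrier ?F"
    then show "f \<oplus>\<^bsub>?F\<^esub> g \<in> carrier ?F"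
      using supp[of f g] by (auto simp: free_module_def)
  next
    fix f assume f: "f \<in> carrier ?F"
    let ?g = "\<lambda>x. \<ominus> f x"
    have "{x. \<ominus> f x \<noteq> \<zero>} \<subseteq> {x. f x \<noteq> \<zero>}"
      by auto
    then have "?g \<in> carrier ?F" "?g \<oplus>\<^bsub>?F\<^esub> f = \<zero>\<^bsub>?F\<^esub>"
      using f by (auto simp: free_module_def l_neg intro: finite_subset)
    then show "\<exists>g\<in>carrier ?F. g \<oplus>\<^bsub>?F\<^esub> f = \<zero>\<^bsub>?F\<^esub>"
      by blast
  qed (auto simp: free_module_def a_ac)
qed (use is_cring in \<open>auto simp: free_module_def l_distr r_distr m_assoc intro: rev_finite_subset\<close>)

lemma (in cring) free_module_finsum_apply:
  assumes "g \<in> A \<rightarrow> carrier (free_module R X)"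
  shows "(\<Oplus>\<^bsub>free_module R X\<^esub>i\<in>A. g i) x = (\<Oplus>i\<in>A. g i x)"
proof -
  interpret F: module R "free_module R X" by (rule free_module_module)
  have [simp]: "(f \<oplus>\<^bsub>free_module R X\<^esub> h) x = f x \<oplus> h x" "\<zero>\<^bsub>free_module R X\<^esub> x = \<zero>" for f h
    by (simp_all add: free_module_def)
  show ?thesis
    using assms
  proof (induction A rule: infinite_finite_induct)
    case (insert a A)
    moreover have "(\<lambda>i. g i x) \<in> A \<rightarrow> carrier R" "g a x \<in> carrier R"
      using insert.prems by (auto simp: free_module_def)
    ultimately show ?case
      by (simp del: Pi_split_insert_domain add: Pi_def)
  qed simp_all
qed

lemma (in cring) delta_closed: "x \<in> X \<Longrightarrow> delta R x \<in> carrier (free_module R X)"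
  by (auto simp: free_module_def delta_def)

lemma (in cring) free_module_expand:
  assumes f: "f \<in> carrier (free_module R X)"
  shows "f = (\<Oplus>\<^bsub>free_module R X\<^esub>z\<in>{z. f z \<noteq> \<zero>}. f z \<odot>\<^bsub>free_module R X\<^esub> delta R z)"
proof
  fix x
  interpret F: module R "free_module R X" by (rule free_module_module)
  have *: "finite {z. f z \<noteq> \<zero>}" "\<And>z. f z \<in> carrier R" "{z. f z \<noteq> \<zero>} \<subseteq> X"
    using f by (auto simp: free_module_def)
  then have "(\<Oplus>\<^bsub>free_module R X\<^esub>z\<in>{z. f z \<noteq> \<zero>}. f z \<odot>\<^bsub>free_module R X\<^esub> delta R z) x =
      (\<Oplus>z\<in>{z. f z \<noteq> \<zero>}. (f z \<odot>\<^bsub>free_module R X\<^esub> delta R z) x)"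
    by (intro free_module_finsum_apply) (auto simp: delta_closed)
  also have "\<dots> = (\<Oplus>z\<in>{z. f z \<noteq> \<zero>}. if x = z then f z else \<zero>)"
    using * by (intro finsum_cong') (auto simp: free_module_def delta_def)
  also have "\<dots> = f x"
  proof (cases "f x = \<zero>")
    case True
    then have "(\<Oplus>z\<in>{z. f z \<noteq> \<zero>}. if x = z then f z else \<zero>) = (\<Oplus>z\<in>{z. f z \<noteq> \<zero>}. \<zero>)"
      by (intro finsum_cong') auto
    then show ?thesis
      using True by simp
  next
    case False
    then show ?thesis
      using * by (intro finsum_singleton) auto
  qed
  finally show "f x = (\<Oplus>\<^bsub>free_module R X\<^esub>z\<in>{z. f z \<noteq> \<zero>}. f z \<odot>\<^bsub>free_module R X\<^esub> delta R z) x"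
    by simp
qed

text \<open>The linear map on the free module that sends each basis vector \<open>delta R x\<close>
  to \<open>w x\<close>. Taking products for \<open>w\<close> gives \<open>mult_hom\<close>.\<close>

definition lin_ext ::
    "('a, 'c) ring_scheme \<Rightarrow> ('a, 'n, 'd) module_scheme \<Rightarrow> ('x \<Rightarrow> 'n) \<Rightarrow> ('x \<Rightarrow> 'a) \<Rightarrow> 'n"
  where "lin_ext R N w f = (\<Oplus>\<^bsub>N\<^esub>z\<in>{z. f z \<noteq> \<zero>\<^bsub>R\<^esub>}. f z \<odot>\<^bsub>N\<^esub> w z)"

lemma mult_hom_eq_lin_ext: "mult_hom R S = lin_ext R S (\<lambda>z. fst z \<otimes>\<^bsub>S\<^esub> snd z)"
  by (simp add: fun_eq_iff mult_hom_def lin_ext_def)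

context module
begin

text \<open>Supports change under addition and scaling, so two values of \<open>lin_ext\<close> can
  be compared only after both sums are taken over a common finite index set.\<close>

lemma lin_ext_superset:
  assumes "finite A" "{z. f z \<noteq> \<zero>} \<subseteq> A" "\<And>z. f z \<in> carrier R" "w \<in> A \<rightarrow> carrier M"
  shows "lin_ext R M w f = (\<Oplus>\<^bsub>M\<^esub>z\<in>A. f z \<odot>\<^bsub>M\<^esub> w z)"
  unfolding lin_ext_def
  using assms by (intro M.add.finprod_mono_neutral_cong_left) (auto simp: Pi_iff)

lemma lin_ext_mod_hom:
  assumes w: "w \<in> X \<rightarrow> carrier M"
  shows "lin_ext R M w \<in> mod_hom R (free_module R X) M"
proof -
  let ?F = "free_module R X"
  have closed: "lin_ext R M w f \<in> carrier M" if "f \<in> carrier ?F" for f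
    unfolding lin_ext_def using that w by (intro M.finsum_closed) (auto simp: free_module_def)
  have add: "lin_ext R M w (f \<oplus>\<^bsub>?F\<^esub> g) = lin_ext R M w f \<oplus>\<^bsub>M\<^esub> lin_ext R M w g"
    if fg: "f \<in> carrier ?F" "g \<in> carrier ?F" for f g
  proof -
    let ?A = "{z. f z \<noteq> \<zero>} \<union> {z. g z \<noteq> \<zero>}"
    have A: "finite ?A" "w \<in> ?A \<rightarrow> carrier M" "\<And>z. f z \<in> carrier R" "\<And>z. g z \<in> carrier R"
      using fg w by (auto simp: free_module_def)
    have "lin_ext R M w (\<lambda>z. f z \<oplus> g z) = (\<Oplus>\<^bsub>M\<^esub>z\<in>?A. (f z \<oplus> g z) \<odot>\<^bsub>M\<^esub> w z)"
      using A by (intro lin_ext_superset) auto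
    also have "\<dots> = (\<Oplus>\<^bsub>M\<^esub>z\<in>?A. f z \<odot>\<^bsub>M\<^esub> w z \<oplus>\<^bsub>M\<^esub> g z \<odot>\<^bsub>M\<^esub> w z)"
      using A by (intro M.finsum_cong') (auto simp: smult_l_distr Pi_iff)
    also have "\<dots> = (\<Oplus>\<^bsub>M\<^esub>z\<in>?A. f z \<odot>\<^bsub>M\<^esub> w z) \<oplus>\<^bsub>M\<^esub> (\<Oplus>\<^bsub>M\<^esub>z\<in>?A. g z \<odot>\<^bsub>M\<^esub> w z)"
      using A by (intro M.finsum_addf) (auto simp: Pi_iff)
    also have "(\<Oplus>\<^bsub>M\<^esub>z\<in>?A. f z \<odot>\<^bsub>M\<^esub> w z) = lin_ext R M w f"
      using A by (intro lin_ext_superset[symmetric]) auto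
    also have "(\<Oplus>\<^bsub>M\<^esub>z\<in>?A. g z \<odot>\<^bsub>M\<^esub> w z) = lin_ext R M w g"
      using A by (intro lin_ext_superset[symmetric]) auto
    finally show ?thesis
      by (simp add: free_module_def)
  qed
  have smult: "lin_ext R M w (r \<odot>\<^bsub>?F\<^esub> f) = r \<odot>\<^bsub>M\<^esub> lin_ext R M w f"
    if rf: "r \<in> carrier R" "f \<in> carrier ?F" for r f
  proof -
    let ?A = "{z. f z \<noteq> \<zero>}"
    have A: "finite ?A" "w \<in> ?A \<rightarrow> carrier M" "\<And>z. f z \<in> carrier R"
      using rf w by (auto simp: free_module_def)
    have "lin_ext R M w (\<lambda>z. r \<otimes> f z) = (\<Oplus>\<^bsub>M\<^esub>z\<in>?A. (r \<otimes> f z) \<odot>\<^bsub>M\<^esub> w z)"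
      using A rf by (intro lin_ext_superset) auto
    also have "\<dots> = (\<Oplus>\<^bsub>M\<^esub>z\<in>?A. r \<odot>\<^bsub>M\<^esub> (f z \<odot>\<^bsub>M\<^esub> w z))"
      using A rf by (intro M.finsum_cong') (auto simp: smult_assoc1 Pi_iff)
    also have "\<dots> = r \<odot>\<^bsub>M\<^esub> lin_ext R M w f"
      unfolding lin_ext_def using A rf by (intro finsum_smult_ldistr[symmetric]) auto
    finally show ?thesis
      by (simp add: free_module_def)
  qed
  show ?thesis
    using closed add smult by (auto simp: mod_hom_def)
qed

lemma lin_ext_delta:
  assumes "w x \<in> carrier M"
  shows "lin_ext R M w (delta R x) = w x"
proof -
  have "lin_ext R M w (delta R x) = (\<Oplus>\<^bsub>M\<^esub>z\<in>{x}. delta R x z \<odot>\<^bsub>M\<^esub> w z)"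
    using assms by (intro lin_ext_superset) (auto simp: delta_def)
  then show ?thesis
    using assms by (simp add: delta_def)
qed

text \<open>Uniqueness in the universal property of the free module: expand \<open>f\<close> in
  basis vectors and apply linearity.\<close>

lemma mod_hom_free_module:
  assumes h: "h \<in> mod_hom R (free_module R X) M" and f: "f \<in> carrier (free_module R X)"
  shows "h f = lin_ext R M (\<lambda>x. h (delta R x)) f"
proof -
  let ?F = "free_module R X"
  interpret F: module R ?F by (rule R.free_module_module)
  have *: "{z. f z \<noteq> \<zero>} \<subseteq> X" "\<And>z. f z \<in> carrier R"
    using f by (auto simp: free_module_def)
  have "h f = h (\<Oplus>\<^bsub>?F\<^esub>z\<in>{z. f z \<noteq> \<zero>}. f z \<odot>\<^bsub>?F\<^esub> delta R z)"
    using R.free_module_expand[OF f] by simp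
  also have "\<dots> = (\<Oplus>\<^bsub>M\<^esub>z\<in>{z. f z \<noteq> \<zero>}. h (f z \<odot>\<^bsub>?F\<^esub> delta R z))"
    using * by (intro mod_hom_finsum[OF F.module_axioms module_axioms h])
      (auto simp: R.delta_closed)
  also have "\<dots> = lin_ext R M (\<lambda>x. h (delta R x)) f"
    unfolding lin_ext_def using * mod_homD[OF h]
    by (intro M.finsum_cong') (auto simp: R.delta_closed subset_iff)
  finally show ?thesis .
qed

end

text \<open>Copies a module along an injection into another element type. It brings the eigenspaces,
  which live inside \<open>S\<close>, to the type over which \<open>Pic\<close> is defined.\<close>

definition transport_module ::
    "('n \<Rightarrow> 'm) \<Rightarrow> ('a, 'n, 'd) module_scheme \<Rightarrow> ('a, 'm) module"
  where "transport_module f N =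
    \<lparr>carrier = f ` carrier N, monoid.mult = undefined, one = undefined, zero = f \<zero>\<^bsub>N\<^esub>,
     add = (\<lambda>x y. f (inv_into (carrier N) f x \<oplus>\<^bsub>N\<^esub> inv_into (carrier N) f y)),
     smult = (\<lambda>r x. f (r \<odot>\<^bsub>N\<^esub> inv_into (carrier N) f x))\<rparr>"

lemma transport_module:
  assumes "module R N" and f: "inj_on f (carrier N)"
  shows "module R (transport_module f N)" "f \<in> mod_iso R N (transport_module f N)"
proof -
  interpret module R N by fact
  let ?T = "transport_module f N"
  have [simp]: "inv_into (carrier N) f (f x) = x" if "x \<in> carrier N" for x
    using that f by simp
  have add: "f x \<oplus>\<^bsub>?T\<^esub> f y = f (x \<oplus>\<^bsub>N\<^esub> y)" if "x \<in> carrier N" "y \<in> carrier N" for x y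
    using that by (simp add: transport_module_def)
  have smult: "r \<odot>\<^bsub>?T\<^esub> f x = f (r \<odot>\<^bsub>N\<^esub> x)" if "x \<in> carrier N" for r x
    using that by (simp add: transport_module_def)
  have carrier: "carrier ?T = f ` carrier N" and zero: "\<zero>\<^bsub>?T\<^esub> = f \<zero>\<^bsub>N\<^esub>"
    by (simp_all add: transport_module_def)
  show "module R ?T"
  proof (rule moduleI)
    show "abelian_group ?T"
    proof (rule abelian_groupI)
      fix x assume "x \<in> carrier ?T"
      then obtain y where y: "y \<in> carrier N" "x = f y"
        by (auto simp: carrier)
      then have "f (\<ominus>\<^bsub>N\<^esub> y) \<oplus>\<^bsub>?T\<^esub> x = \<zero>\<^bsub>?T\<^esub>" "f (\<ominus>\<^bsub>N\<^esub> y) \<in> carrier ?T"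
        by (simp_all add: add zero carrier M.l_neg)
      then show "\<exists>z\<in>carrier ?T. z \<oplus>\<^bsub>?T\<^esub> x = \<zero>\<^bsub>?T\<^esub>"
        by blast
    qed (auto simp: carrier zero add M.a_ac)
  qed (use R.is_cring in \<open>auto simp: carrier add smult smult_l_distr smult_r_distr smult_assoc1\<close>)
  show "f \<in> mod_iso R N ?T"
    using f by (auto simp: mod_iso_def mod_hom_def carrier add smult bij_betw_def)
qed

lemma (in cring) regular_module: "module R (regular_module R)"
proof (rule moduleI)
  show "abelian_group (regular_module R)"
    by (rule abelian_groupI) (auto simp: regular_module_def a_ac intro!: bexI[of _ "\<ominus> x" for x] l_neg)
qed (auto simp: regular_module_def is_cring l_distr r_distr m_assoc)

text \<open>Restricting the carrier yields a different record and hence formally a different sum.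
  The inclusion is linear and therefore carries one sum to the other.\<close>

lemma (in module) finsum_submodule:
  assumes H: "submodule H R M" and f: "f \<in> A \<rightarrow> H"
  shows "(\<Oplus>\<^bsub>M\<lparr>carrier := H\<rparr>\<^esub>i\<in>A. f i) = (\<Oplus>\<^bsub>M\<^esub>i\<in>A. f i)"
proof -
  have "H \<subseteq> carrier M"
    using submoduleE(1)[OF H] .
  then have "(\<lambda>x. x) \<in> mod_hom R (M\<lparr>carrier := H\<rparr>) M"
    by (auto simp: mod_hom_def)
  from mod_hom_finsum[OF submodule.submodule_is_module[OF H module_axioms] module_axioms this]
  show ?thesis
    using f by simp
qed

lemma iso_class_cong:
  assumes "module R M" "module R N" "mod_iso R M N \<noteq> {}"
  shows "iso_class R M = iso_class R N"
proof -
  obtain f where f: "f \<in> mod_iso R M N"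
    using assms(3) by blast
  note g = mod_iso_inv_into[OF assms(1) f]
  have "mod_iso R P N \<noteq> {}" if "mod_iso R P M \<noteq> {}" for P :: "'a pic_module"
    using that mod_iso_comp[OF _ f] by blast
  moreover have "mod_iso R P M \<noteq> {}" if "mod_iso R P N \<noteq> {}" for P :: "'a pic_module"
    using that mod_iso_comp[OF _ g] by blast
  ultimately show ?thesis
    by (auto simp: iso_class_def)
qed

section \<open>Tensor products\<close>

definition bilinear_map ::
    "('a, 'c) ring_scheme \<Rightarrow> ('a, 'm, 'd) module_scheme \<Rightarrow> ('a, 'n, 'e) module_scheme
      \<Rightarrow> ('a, 'q, 'f) module_scheme \<Rightarrow> ('m \<Rightarrow> 'n \<Rightarrow> 'q) \<Rightarrow> bool"
  where "bilinear_map R M N Q \<beta> \<longleftrightarrow>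
    (\<forall>n\<in>carrier N. (\<lambda>m. \<beta> m n) \<in> mod_hom R M Q) \<and> (\<forall>m\<in>carrier M. \<beta> m \<in> mod_hom R N Q)"

lemma bilinear_mapD:
  assumes "bilinear_map R M N Q \<beta>"
  shows "\<And>m n. \<lbrakk>m \<in> carrier M; n \<in> carrier N\<rbrakk> \<Longrightarrow> \<beta> m n \<in> carrier Q"
    and "\<And>m m' n. \<lbrakk>m \<in> carrier M; m' \<in> carrier M; n \<in> carrier N\<rbrakk> \<Longrightarrow>
      \<beta> (m \<oplus>\<^bsub>M\<^esub> m') n = \<beta> m n \<oplus>\<^bsub>Q\<^esub> \<beta> m' n"
    and "\<And>m n n'. \<lbrakk>m \<in> carrier M; n \<in> carrier N; n' \<in> carrier N\<rbrakk> \<Longrightarrow>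
      \<beta> m (n \<oplus>\<^bsub>N\<^esub> n') = \<beta> m n \<oplus>\<^bsub>Q\<^esub> \<beta> m n'"
    and "\<And>r m n. \<lbrakk>r \<in> carrier R; m \<in> carrier M; n \<in> carrier N\<rbrakk> \<Longrightarrow>
      \<beta> (r \<odot>\<^bsub>M\<^esub> m) n = r \<odot>\<^bsub>Q\<^esub> \<beta> m n"
    and "\<And>r m n. \<lbrakk>r \<in> carrier R; m \<in> carrier M; n \<in> carrier N\<rbrakk> \<Longrightarrow>
      \<beta> m (r \<odot>\<^bsub>N\<^esub> n) = r \<odot>\<^bsub>Q\<^esub> \<beta> m n"
  using assms by (auto simp: bilinear_map_def mod_hom_def)

lemma mod_hom_monoid_algebra:
  "mod_hom R (monoid_algebra R X) N = mod_hom R (free_module R (carrier X)) N"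
  by (simp add: mod_hom_def monoid_algebra_def)

lemma (in cring) monoid_algebra_module: "module R (monoid_algebra R X)"
  by (rule module_cong_add_monoid[OF free_module_module[of "carrier X"]])
    (simp_all add: monoid_algebra_def)

lemma (in module) submodule_gen:
  assumes "K \<subseteq> carrier M"
  shows "submodule (submodule_gen R M K) R M" "K \<subseteq> submodule_gen R M K"
proof -
  let ?S = "{H. submodule H R M \<and> K \<subseteq> H}"
  have ne: "carrier M \<in> ?S"
    using assms carrier_is_submodule by simp
  show "submodule (submodule_gen R M K) R M"
    unfolding submodule_gen_def
  proof (rule submoduleI)
    show "\<Inter> ?S \<subseteq> carrier M"
      using ne by blast
    show "\<zero>\<^bsub>M\<^esub> \<in> \<Inter> ?S"
      by (auto dest!: submodule.axioms(1) subgroup.one_closed)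
  qed (auto dest: submoduleE submodule.smult_closed)
  show "K \<subseteq> submodule_gen R M K"
    by (auto simp: submodule_gen_def)
qed

lemma submodule_gen_least:
  "\<lbrakk>submodule H R M; K \<subseteq> H\<rbrakk> \<Longrightarrow> submodule_gen R M K \<subseteq> H"
  by (auto simp: submodule_gen_def)

locale module_pair = M: module R M + N: module R N
  for R (structure) and M :: "('a, 'm, 'd) module_scheme" and N :: "('a, 'n, 'e) module_scheme"
begin

abbreviation F where "F \<equiv> monoid_algebra R (M \<times>\<times> N)"

abbreviation I where "I \<equiv> submodule_gen R F (tensor_relations R M N)"

definition cls :: "('m \<times> 'n \<Rightarrow> 'a) \<Rightarrow> ('m \<times> 'n \<Rightarrow> 'a) set" where "cls f = I +>\<^bsub>F\<^esub> f"

sublocale F: module R F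
  by (rule M.R.monoid_algebra_module)

lemma delta_closed_F: "m \<in> carrier M \<Longrightarrow> n \<in> carrier N \<Longrightarrow> delta R (m, n) \<in> carrier F"
  using M.R.delta_closed[of "(m, n)" "carrier (M \<times>\<times> N)"] by (simp add: monoid_algebra_def)

lemma tensor_relations_subset: "tensor_relations R M N \<subseteq> carrier F"
  by (auto simp: tensor_relations_def Let_def delta_closed_F)

lemmas submodule_I = F.submodule_gen(1)[OF tensor_relations_subset]

lemmas tensor_relations_subset_I = F.submodule_gen(2)[OF tensor_relations_subset]

sublocale I: abelian_subgroup I F
  using submodule.axioms(1)[OF submodule_I] F.abelian_group_axioms
  by (intro abelian_subgroupI3 additive_subgroupI)

lemma tensor_carrier: "carrier (tensor R M N) = cls ` carrier F"
  by (auto simp: tensor_def Let_def quot_module_def A_RCOSETS_def' cls_def)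

lemma cls_closed: "f \<in> carrier F \<Longrightarrow> cls f \<in> carrier (tensor R M N)"
  by (simp add: tensor_carrier)

lemma mem_cls: "f \<in> carrier F \<Longrightarrow> f \<in> cls f"
  by (simp add: cls_def I.a_rcos_self)

lemma mem_clsD: "f \<in> carrier F \<Longrightarrow> g \<in> cls f \<Longrightarrow> g \<in> carrier F \<and> g \<ominus>\<^bsub>F\<^esub> f \<in> I"
  using I.a_elemrcos_carrier[of f g] I.a_rcos_module_imp[of f g] by (simp add: cls_def a_minus_def)

lemma cls_eq_iff:
  assumes "f \<in> carrier F" "g \<in> carrier F"
  shows "cls f = cls g \<longleftrightarrow> f \<ominus>\<^bsub>F\<^esub> g \<in> I"
  using assms I.a_rcos_module[of g f] I.a_repr_independence'[of f g] mem_cls[of f]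
  by (auto simp: cls_def a_minus_def)

lemma tensor_add:
  "\<lbrakk>f \<in> carrier F; g \<in> carrier F\<rbrakk> \<Longrightarrow> cls f \<oplus>\<^bsub>tensor R M N\<^esub> cls g = cls (f \<oplus>\<^bsub>F\<^esub> g)"
  by (simp add: tensor_def Let_def quot_module_def cls_def I.a_rcos_sum)

text \<open>In \<open>quot_module\<close> a scalar sends a coset to the union of the cosets of all
  scaled representatives. These cosets coincide because \<open>I\<close> is closed under scalars, so
  the union is a single coset.\<close>

lemma tensor_smult:
  assumes "r \<in> carrier R" "f \<in> carrier F"
  shows "r \<odot>\<^bsub>tensor R M N\<^esub> cls f = cls (r \<odot>\<^bsub>F\<^esub> f)"
proof -
  have "cls (r \<odot>\<^bsub>F\<^esub> g) = cls (r \<odot>\<^bsub>F\<^esub> f)" if "g \<in> cls f" for g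
  proof -
    have g: "g \<in> carrier F" "g \<ominus>\<^bsub>F\<^esub> f \<in> I"
      using mem_clsD[OF assms(2) that] by auto
    then have "r \<odot>\<^bsub>F\<^esub> (g \<ominus>\<^bsub>F\<^esub> f) \<in> I"
      using submodule.smult_closed[OF submodule_I assms(1)] by blast
    then show ?thesis
      using g assms by (simp add: cls_eq_iff F.smult_r_distr F.smult_r_minus a_minus_def)
  qed
  then have "(\<Union>g\<in>cls f. cls (r \<odot>\<^bsub>F\<^esub> g)) = cls (r \<odot>\<^bsub>F\<^esub> f)"
    using mem_cls[OF assms(2)] by blast
  then show ?thesis
    by (simp add: tensor_def Let_def quot_module_def cls_def)
qed

lemma lin_ext_mod_hom_F:
  assumes "module R Q" "bilinear_map R M N Q \<beta>"
  shows "lin_ext R Q (\<lambda>z. \<beta> (fst z) (snd z)) \<in> mod_hom R F Q"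
proof -
  interpret Q: module R Q by fact
  show ?thesis
    unfolding mod_hom_monoid_algebra
    using bilinear_mapD(1)[OF assms(2)] by (intro Q.lin_ext_mod_hom) auto
qed

text \<open>The kernel of the linear extension is a submodule, and bilinearity of
  \<open>\<beta>\<close> says exactly that it contains the relations; hence it contains the
  submodule they generate.\<close>

lemma lin_ext_kernel:
  assumes Q: "module R Q" and \<beta>: "bilinear_map R M N Q \<beta>" and f: "f \<in> I"
  shows "lin_ext R Q (\<lambda>z. \<beta> (fst z) (snd z)) f = \<zero>\<^bsub>Q\<^esub>"
proof -
  interpret Q: module R Q by fact
  define h where "h = lin_ext R Q (\<lambda>z. \<beta> (fst z) (snd z))"
  have h: "h \<in> mod_hom R F Q"
    unfolding h_def by (rule lin_ext_mod_hom_F[OF Q \<beta>])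
  note hD = mod_homD[OF h] mod_hom_minus[OF F.module_axioms Q h]
  note \<beta>D = bilinear_mapD[OF \<beta>]
  have d: "h (delta R (m, n)) = \<beta> m n" if "m \<in> carrier M" "n \<in> carrier N" for m n
    unfolding h_def using that \<beta>D(1) by (subst Q.lin_ext_delta) auto
  let ?K = "{f \<in> carrier F. h f = \<zero>\<^bsub>Q\<^esub>}"
  have "submodule ?K R F"
    by (rule F.submoduleI)
      (auto simp: hD mod_hom_zero[OF F.module_axioms Q h] mod_hom_uminus[OF F.module_axioms Q h])
  moreover have "tensor_relations R M N \<subseteq> ?K"
    by (auto simp: tensor_relations_def Let_def delta_closed_F hD d \<beta>D a_minus_def[of Q] Q.M.r_neg
        tensor_relations_subset)
  ultimately show ?thesis
    using submodule_gen_least[of ?K R F "tensor_relations R M N"] f h_def by blast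
qed

text \<open>Independence of the representative. Bilinear maps are evaluated on elements of
  \<open>F\<close>, and this is what allows passing between representatives of one class.\<close>

lemma lin_ext_cls_cong:
  assumes "module R Q" "bilinear_map R M N Q \<beta>" "f \<in> carrier F" "g \<in> carrier F" "cls f = cls g"
  shows "lin_ext R Q (\<lambda>z. \<beta> (fst z) (snd z)) f = lin_ext R Q (\<lambda>z. \<beta> (fst z) (snd z)) g"
proof -
  interpret Q: module R Q by fact
  note h = lin_ext_mod_hom_F[OF assms(1,2)]
  show ?thesis
    using lin_ext_kernel[OF assms(1,2), of "f \<ominus>\<^bsub>F\<^esub> g"] assms cls_eq_iff[of f g]
      mod_hom_minus[OF F.module_axioms assms(1) h] mod_homD(1)[OF h] Q.M.minus_eq_zero_iff
    by simp
qed

lemma cls_eq_of_relation: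
  assumes "f \<ominus>\<^bsub>F\<^esub> g \<in> tensor_relations R M N" "f \<in> carrier F" "g \<in> carrier F"
  shows "cls f = cls g"
  using assms cls_eq_iff tensor_relations_subset_I by blast

lemma delta_add_left:
  assumes "m \<in> carrier M" "m' \<in> carrier M" "n \<in> carrier N"
  shows "cls (delta R (m \<oplus>\<^bsub>M\<^esub> m', n)) = cls (delta R (m, n) \<oplus>\<^bsub>F\<^esub> delta R (m', n))"
  by (rule cls_eq_of_relation, unfold tensor_relations_def Let_def, use assms in blast)
    (use assms in \<open>simp_all add: delta_closed_F\<close>)

lemma delta_smult_left:
  assumes "r \<in> carrier R" "m \<in> carrier M" "n \<in> carrier N"
  shows "cls (delta R (r \<odot>\<^bsub>M\<^esub> m, n)) = cls (r \<odot>\<^bsub>F\<^esub> delta R (m, n))"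
  by (rule cls_eq_of_relation, unfold tensor_relations_def Let_def, use assms in blast)
    (use assms in \<open>simp_all add: delta_closed_F\<close>)

lemma delta_add_right:
  assumes "m \<in> carrier M" "n \<in> carrier N" "n' \<in> carrier N"
  shows "cls (delta R (m, n \<oplus>\<^bsub>N\<^esub> n')) = cls (delta R (m, n) \<oplus>\<^bsub>F\<^esub> delta R (m, n'))"
  by (rule cls_eq_of_relation, unfold tensor_relations_def Let_def, use assms in blast)
    (use assms in \<open>simp_all add: delta_closed_F\<close>)

lemma delta_smult_right:
  assumes "r \<in> carrier R" "m \<in> carrier M" "n \<in> carrier N"
  shows "cls (delta R (m, r \<odot>\<^bsub>N\<^esub> n)) = cls (r \<odot>\<^bsub>F\<^esub> delta R (m, n))"
  by (rule cls_eq_of_relation, unfold tensor_relations_def Let_def, use assms in blast)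
    (use assms in \<open>simp_all add: delta_closed_F\<close>)

lemma quot_module_FI: "tensor R M N = quot_module F I"
  by (simp add: tensor_def Let_def)

lemma tensor_module: "module R (tensor R M N)"
proof (rule moduleI)
  let ?T = "tensor R M N"
  have zero: "\<zero>\<^bsub>?T\<^esub> = cls \<zero>\<^bsub>F\<^esub>"
    using I.a_rcos_const[OF I.zero_closed] by (simp add: quot_module_FI quot_module_def cls_def)
  show "abelian_group ?T"
  proof (rule abelian_groupI)
    fix x assume "x \<in> carrier ?T"
    then obtain f where f: "f \<in> carrier F" "x = cls f"
      by (auto simp: tensor_carrier)
    then have "cls (\<ominus>\<^bsub>F\<^esub> f) \<oplus>\<^bsub>?T\<^esub> x = \<zero>\<^bsub>?T\<^esub>"
      by (simp add: tensor_add zero F.M.l_neg)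
    then show "\<exists>y\<in>carrier ?T. y \<oplus>\<^bsub>?T\<^esub> x = \<zero>\<^bsub>?T\<^esub>"
      using f by (intro bexI[of _ "cls (\<ominus>\<^bsub>F\<^esub> f)"] cls_closed) auto
  qed (auto simp: tensor_carrier tensor_add zero F.M.a_ac)
qed (use M.R.is_cring in \<open>auto simp: tensor_carrier tensor_add tensor_smult F.smult_l_distr
    F.smult_r_distr F.smult_assoc1\<close>)

lemma cls_mod_hom: "cls \<in> mod_hom R F (tensor R M N)"
  by (auto simp: mod_hom_def cls_closed tensor_add tensor_smult)

lemma pure_tensor_bilinear: "bilinear_map R M N (tensor R M N) (\<lambda>m n. cls (delta R (m, n)))"
  by (auto simp: bilinear_map_def mod_hom_def cls_closed delta_closed_F delta_add_left
      delta_add_right delta_smult_left delta_smult_right tensor_add tensor_smult)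

text \<open>Pure tensors generate: \<open>cls\<close> is linear on a free module and so is
  determined by its values on the basis vectors.\<close>

lemma cls_eq_lin_ext:
  assumes "f \<in> carrier F"
  shows "cls f = lin_ext R (tensor R M N) (\<lambda>z. cls (delta R z)) f"
proof -
  interpret T: module R "tensor R M N" by (rule tensor_module)
  show ?thesis
    using T.mod_hom_free_module[of cls "carrier (M \<times>\<times> N)" f] cls_mod_hom assms
    by (simp add: mod_hom_monoid_algebra) (simp add: monoid_algebra_def)
qed

text \<open>A bilinear map is an isomorphism on the tensor product as soon as it has a right inverse
  of the form \<open>q \<mapsto> \<Sum>\<^sub>i c\<^sub>i(q) \<otimes> a\<^sub>i\<close> in which \<open>\<Sum>\<^sub>i c\<^sub>i(\<beta>(m, n)) \<otimes> a\<^sub>i\<close> is visibly \<open>m \<otimes> n\<close>.\<close>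

lemma tensor_iso:
  assumes Q: "module R Q" and \<beta>: "bilinear_map R M N Q \<beta>"
    and a: "\<And>i. i \<in> J \<Longrightarrow> a i \<in> carrier N"
    and c: "\<And>i. i \<in> J \<Longrightarrow> c i \<in> mod_hom R Q M"
    and r: "\<And>i n. i \<in> J \<Longrightarrow> n \<in> carrier N \<Longrightarrow> r i n \<in> carrier R"
    and c\<beta>: "\<And>i m n. i \<in> J \<Longrightarrow> m \<in> carrier M \<Longrightarrow> n \<in> carrier N \<Longrightarrow>
      c i (\<beta> m n) = r i n \<odot>\<^bsub>M\<^esub> m"
    and ra: "\<And>n. n \<in> carrier N \<Longrightarrow> (\<Oplus>\<^bsub>N\<^esub>i\<in>J. r i n \<odot>\<^bsub>N\<^esub> a i) = n"
    and \<beta>c: "\<And>q. q \<in> carrier Q \<Longrightarrow> (\<Oplus>\<^bsub>Q\<^esub>i\<in>J. \<beta> (c i q) (a i)) = q"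
  shows "mod_iso R (tensor R M N) Q \<noteq> {}"
proof -
  let ?T = "tensor R M N"
  interpret Q: module R Q by fact
  interpret T: module R ?T by (rule tensor_module)
  define h where "h = lin_ext R Q (\<lambda>z. \<beta> (fst z) (snd z))"
  define pt where "pt = (\<lambda>m n. cls (delta R (m, n)))"
  have pt: "bilinear_map R M N ?T pt"
    unfolding pt_def by (rule pure_tensor_bilinear)
  have h: "h \<in> mod_hom R F Q"
    unfolding h_def by (rule lin_ext_mod_hom_F[OF Q \<beta>])
  \<comment> \<open>Bijectivity is proved for this map from \<open>Q\<close> into the tensor
    product, since a map in this direction needs no choice of representatives. It is inverted only
    at the end.\<close>
  define k where "k = (\<lambda>q. \<Oplus>\<^bsub>?T\<^esub>i\<in>J. pt (c i q) (a i))"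
  have ci: "(\<lambda>q. pt (c i q) (a i)) \<in> mod_hom R Q ?T" if "i \<in> J" for i
    using mod_hom_comp[OF c[OF that], of "\<lambda>m. pt m (a i)"] pt a[OF that]
    by (auto simp: bilinear_map_def)
  note ciD = mod_homD[OF ci]
  have k: "k \<in> mod_hom R Q ?T"
  proof -
    have fin: "k (x \<oplus>\<^bsub>Q\<^esub> y) = k x \<oplus>\<^bsub>?T\<^esub> k y" if "x \<in> carrier Q" "y \<in> carrier Q" for x y
    proof -
      have "k (x \<oplus>\<^bsub>Q\<^esub> y) = (\<Oplus>\<^bsub>?T\<^esub>i\<in>J. pt (c i x) (a i) \<oplus>\<^bsub>?T\<^esub> pt (c i y) (a i))"
        unfolding k_def using that by (intro T.M.finsum_cong') (simp_all add: ciD Pi_iff)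
      then show ?thesis
        unfolding k_def using that by (simp add: ciD Pi_iff)
    qed
    have sm: "k (s \<odot>\<^bsub>Q\<^esub> x) = s \<odot>\<^bsub>?T\<^esub> k x" if "x \<in> carrier Q" "s \<in> carrier R" for x s
    proof (cases "finite J")
      case True
      then have "s \<odot>\<^bsub>?T\<^esub> k x = (\<Oplus>\<^bsub>?T\<^esub>i\<in>J. s \<odot>\<^bsub>?T\<^esub> pt (c i x) (a i))"
        unfolding k_def using that by (intro T.finsum_smult_ldistr) (simp_all add: ciD Pi_iff)
      moreover have "k (s \<odot>\<^bsub>Q\<^esub> x) = (\<Oplus>\<^bsub>?T\<^esub>i\<in>J. s \<odot>\<^bsub>?T\<^esub> pt (c i x) (a i))"
        unfolding k_def using that by (intro T.M.finsum_cong') (simp_all add: ciD Pi_iff)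
      ultimately show ?thesis
        by simp
    qed (use that in \<open>simp add: k_def\<close>)
    have "k x \<in> carrier ?T" if "x \<in> carrier Q" for x
      unfolding k_def using that ciD by (auto intro!: T.M.finsum_closed)
    then show ?thesis
      using fin sm by (auto simp: mod_hom_def)
  qed
  have pt_simp: "(\<lambda>n. pt m n) \<in> mod_hom R N ?T" if "m \<in> carrier M" for m
    using pt that by (auto simp: bilinear_map_def)
  have ptD: "pt m n \<in> carrier ?T" if "m \<in> carrier M" "n \<in> carrier N" for m n
    using bilinear_mapD(1)[OF pt that] .
  \<comment> \<open>The scalars \<open>r i n\<close> move across the tensor sign: the sum of
    \<open>r i n m\<close> tensor \<open>a i\<close> is \<open>m\<close> tensor the sum of
    \<open>r i n a i\<close>, which is \<open>m\<close> tensor \<open>n\<close>.\<close>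
  have k\<beta>: "k (\<beta> m n) = pt m n" if "m \<in> carrier M" "n \<in> carrier N" for m n
  proof -
    have "k (\<beta> m n) = (\<Oplus>\<^bsub>?T\<^esub>i\<in>J. pt m (r i n \<odot>\<^bsub>N\<^esub> a i))"
      unfolding k_def using that a r
      by (intro T.M.finsum_cong') (auto simp: c\<beta> bilinear_mapD(4,5)[OF pt] ptD)
    also have "\<dots> = pt m (\<Oplus>\<^bsub>N\<^esub>i\<in>J. r i n \<odot>\<^bsub>N\<^esub> a i)"
      using that a r
      by (intro mod_hom_finsum[OF N.module_axioms tensor_module pt_simp, symmetric]) auto
    finally show ?thesis
      using that ra by simp
  qed
  have kh: "k (h f) = cls f" if f: "f \<in> carrier F" for f
  proof -
    have kh: "(\<lambda>x. k (h x)) \<in> mod_hom R (free_module R (carrier (M \<times>\<times> N))) ?T"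
      using mod_hom_comp[OF h k] by (simp add: mod_hom_monoid_algebra)
    have fF: "f \<in> carrier (free_module R (carrier (M \<times>\<times> N)))"
      using f by (simp add: monoid_algebra_def)
    have "k (h f) = lin_ext R ?T (\<lambda>z. k (h (delta R z))) f"
      using T.mod_hom_free_module[OF kh fF] .
    also have "\<dots> = lin_ext R ?T (\<lambda>z. cls (delta R z)) f"
      unfolding lin_ext_def
    proof (intro T.M.finsum_cong')
      fix z assume "z \<in> {z. f z \<noteq> \<zero>}"
      then have "fst z \<in> carrier M" "snd z \<in> carrier N"
        using fF by (auto simp: free_module_def)
      then show "f z \<odot>\<^bsub>?T\<^esub> k (h (delta R z)) = f z \<odot>\<^bsub>?T\<^esub> cls (delta R z)"
        using k\<beta>[of "fst z" "snd z"] bilinear_mapD(1)[OF \<beta>, of "fst z" "snd z"]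
        by (simp add: h_def Q.lin_ext_delta pt_def)
    next
      show "(\<lambda>z. f z \<odot>\<^bsub>?T\<^esub> cls (delta R z)) \<in> {z. f z \<noteq> \<zero>} \<rightarrow> carrier ?T"
        using fF by (auto simp: free_module_def subset_iff intro!: T.smult_closed cls_closed delta_closed_F)
    qed simp
    also have "\<dots> = cls f"
      using cls_eq_lin_ext[OF f] by simp
    finally show ?thesis .
  qed
  \<comment> \<open>Every \<open>q\<close> gets an explicit representative \<open>f\<close> of
    \<open>k q\<close> with \<open>h f = q\<close>. As \<open>h\<close> depends only on the class,
    \<open>k q\<close> determines \<open>q\<close>, which is the injectivity of
    \<open>k\<close>.\<close>
  have hk: "\<exists>f\<in>carrier F. q = h f \<and> k q = cls f" if q: "q \<in> carrier Q" for q
  proof -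
    let ?f = "\<Oplus>\<^bsub>F\<^esub>i\<in>J. delta R (c i q, a i)"
    have cq: "c i q \<in> carrier M" if "i \<in> J" for i
      using mod_homD(1)[OF c[OF that] q] .
    have fF: "?f \<in> carrier F"
      using cq a by (auto intro!: F.M.finsum_closed delta_closed_F)
    have "h ?f = (\<Oplus>\<^bsub>Q\<^esub>i\<in>J. h (delta R (c i q, a i)))"
      using cq a by (intro mod_hom_finsum[OF F.module_axioms Q h]) (auto simp: delta_closed_F)
    also have "\<dots> = (\<Oplus>\<^bsub>Q\<^esub>i\<in>J. \<beta> (c i q) (a i))"
      using cq a bilinear_mapD(1)[OF \<beta>]
      by (intro Q.M.finsum_cong') (auto simp: h_def Q.lin_ext_delta)
    finally have "h ?f = q"
      using \<beta>c q by simp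
    then show ?thesis
      using fF kh[OF fF] by (intro bexI[of _ ?f]) simp_all
  qed
  have "bij_betw k (carrier Q) (carrier ?T)"
    unfolding bij_betw_def
  proof
    show "inj_on k (carrier Q)"
    proof (rule inj_onI)
      fix x y assume xy: "x \<in> carrier Q" "y \<in> carrier Q" "k x = k y"
      then obtain f g where "f \<in> carrier F" "g \<in> carrier F" "x = h f" "y = h g" "cls f = cls g"
        using hk by metis
      then show "x = y"
        unfolding h_def using lin_ext_cls_cong[OF Q \<beta>] by blast
    qed
    show "k ` carrier Q = carrier ?T"
    proof
      show "k ` carrier Q \<subseteq> carrier ?T"
        using mod_homD(1)[OF k] by auto
      show "carrier ?T \<subseteq> k ` carrier Q"
        unfolding tensor_carrier
      proof (rule image_subsetI)
        fix f assume "f \<in> carrier F"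
        then show "cls f \<in> k ` carrier Q"
          using kh[of f] mod_homD(1)[OF h, of f] by (metis imageI)
      qed
    qed
  qed
  then have "k \<in> mod_iso R Q ?T"
    using k by (simp add: mod_iso_def)
  then show ?thesis
    using mod_iso_inv_into[OF Q] by blast
qed

end

section \<open>Separability\<close>

text \<open>Multiplying by one basis vector translates the basis. This covers the products with
  \<open>s\<close> tensor 1 and 1 tensor \<open>s\<close>, which are the ones to be evaluated in the
  tensor algebra.\<close>

lemma (in cring) delta_mult_monoid_algebra:
  assumes f: "f \<in> carrier (monoid_algebra R X)" and a: "a \<in> carrier X"
    and closed: "\<And>y. y \<in> carrier X \<Longrightarrow> a \<otimes>\<^bsub>X\<^esub> y \<in> carrier X"
  shows "delta R a \<otimes>\<^bsub>monoid_algebra R X\<^esub> f =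
    lin_ext R (monoid_algebra R X) (\<lambda>y. delta R (a \<otimes>\<^bsub>X\<^esub> y)) f"
proof
  fix z
  let ?F = "free_module R (carrier X)"
  have fF: "f \<in> carrier ?F"
    using f by (simp add: monoid_algebra_def)
  let ?A = "{y. f y \<noteq> \<zero>}"
  have A: "finite ?A" "?A \<subseteq> carrier X" "\<And>y. f y \<in> carrier R"
    using fF by (auto simp: free_module_def)
  interpret F: module R ?F by (rule free_module_module)
  have "lin_ext R (monoid_algebra R X) (\<lambda>y. delta R (a \<otimes>\<^bsub>X\<^esub> y)) f z =
      (\<Oplus>\<^bsub>?F\<^esub>y\<in>?A. f y \<odot>\<^bsub>?F\<^esub> delta R (a \<otimes>\<^bsub>X\<^esub> y)) z"
    by (simp add: lin_ext_def monoid_algebra_def finsum_def)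
  also have "\<dots> = (\<Oplus>y\<in>?A. (f y \<odot>\<^bsub>?F\<^esub> delta R (a \<otimes>\<^bsub>X\<^esub> y)) z)"
    using A closed by (intro free_module_finsum_apply) (auto intro!: delta_closed)
  also have "\<dots> = (\<Oplus>y\<in>{y \<in> ?A. a \<otimes>\<^bsub>X\<^esub> y = z}. f y)"
    using A by (intro add.finprod_mono_neutral_cong_right) (auto simp: free_module_def delta_def)
  also have "\<dots> = (\<Oplus>w\<in>Pair a ` {y \<in> ?A. a \<otimes>\<^bsub>X\<^esub> y = z}. f (snd w))"
    using A by (subst finsum_reindex) (auto simp: inj_on_def)
  also have "Pair a ` {y \<in> ?A. a \<otimes>\<^bsub>X\<^esub> y = z} =
      {(x, y). delta R a x \<noteq> \<zero> \<and> f y \<noteq> \<zero> \<and> x \<otimes>\<^bsub>X\<^esub> y = z}" (is "_ = ?B")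
  proof -
    \<comment> \<open>A nonzero value of \<open>f\<close> excludes the zero ring, so
      \<open>delta R a\<close> does not vanish at \<open>a\<close>. Over the zero ring both index
      sets are empty.\<close>
    have "\<one> \<noteq> \<zero>" if "f y \<noteq> \<zero>" for y
      using that A(3)[of y] l_one[of "f y"] l_null[of "f y"] by metis
    then show ?thesis
      by (auto simp: delta_def split: if_splits)
  qed
  also have "(\<Oplus>w\<in>?B. f (snd w)) = (\<Oplus>w\<in>?B. delta R a (fst w) \<otimes> f (snd w))"
    using A by (intro finsum_cong') (auto simp: delta_def split: if_splits)
  also have "\<dots> = (delta R a \<otimes>\<^bsub>monoid_algebra R X\<^esub> f) z"
    by (simp add: monoid_algebra_def)
  finally show "(delta R a \<otimes>\<^bsub>monoid_algebra R X\<^esub> f) z =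
      lin_ext R (monoid_algebra R X) (\<lambda>y. delta R (a \<otimes>\<^bsub>X\<^esub> y)) f z" ..
qed

lemma (in module) finsum_smult_rdistr:
  assumes "x \<in> carrier M" "f \<in> A \<rightarrow> carrier R"
  shows "(\<Oplus>i\<in>A. f i) \<odot>\<^bsub>M\<^esub> x = (\<Oplus>\<^bsub>M\<^esub>i\<in>A. f i \<odot>\<^bsub>M\<^esub> x)"
  using assms(2)
proof (induction A rule: infinite_finite_induct)
  case (insert a A)
  then show ?case
    using assms(1) by (simp add: Pi_iff smult_l_distr)
qed (use assms(1) in simp_all)

lemma (in algebra) mult_bilinear: "bilinear_map R M M M (\<lambda>x y. x \<otimes>\<^bsub>M\<^esub> y)"
proof -
  have "x \<otimes>\<^bsub>M\<^esub> (r \<odot>\<^bsub>M\<^esub> y) = r \<odot>\<^bsub>M\<^esub> (x \<otimes>\<^bsub>M\<^esub> y)"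
    if "r \<in> carrier R" "x \<in> carrier M" "y \<in> carrier M" for r x y
    using that smult_assoc2[of r y x] m_comm[of x] by simp
  then show ?thesis
    by (auto simp: bilinear_map_def mod_hom_def smult_assoc2 l_distr r_distr)
qed

text \<open>The elements \<open>\<Sum>\<^sub>z x\<^sub>z \<otimes> y\<^sub>z\<close> found here form a separability idempotent: its image under
  \<open>S \<otimes> S \<rightarrow> S\<close> is 1, and it is annihilated by all \<open>s \<otimes> 1 - 1 \<otimes> s\<close>. If the section \<open>i\<close> into a
  free module sends 1 to \<open>\<Sum>\<^sub>x t\<^sub>x e\<^sub>x\<close> and the retraction sends \<open>e\<^sub>x\<close> to \<open>q\<^sub>x\<close>, it is
  \<open>\<Sum>\<^sub>x t\<^sub>x(1 \<otimes> q\<^sub>x)\<close>.\<close>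

lemma separable_algebra_elements:
  fixes R :: "('a, 'c) ring_scheme" and S :: "('a, 's, 'd) module_scheme"
  assumes sep: "separable_algebra R S"
  obtains Z :: "('s \<times> 's) set" and x y
  where "finite Z" "x \<in> Z \<rightarrow> carrier S" "y \<in> Z \<rightarrow> carrier S"
    "(\<Oplus>\<^bsub>S\<^esub>z\<in>Z. x z \<otimes>\<^bsub>S\<^esub> y z) = \<one>\<^bsub>S\<^esub>"
    "\<And>\<beta> s. \<lbrakk>bilinear_map R S S S \<beta>; s \<in> carrier S\<rbrakk> \<Longrightarrow>
      (\<Oplus>\<^bsub>S\<^esub>z\<in>Z. \<beta> (s \<otimes>\<^bsub>S\<^esub> x z) (y z)) = (\<Oplus>\<^bsub>S\<^esub>z\<in>Z. \<beta> (x z) (s \<otimes>\<^bsub>S\<^esub> y z))"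
proof -
  let ?T = "tensor R S S" and ?E = "enveloping_module R S"
  interpret S: algebra R S
    using sep by (simp add: separable_algebra_def)
  interpret P: module_pair R S S
    by unfold_locales
  let ?F = "monoid_algebra R (S \<times>\<times> S)"
  obtain X :: "'s set" and i q where i: "i \<in> mod_hom ?T ?E (free_module ?T X)"
    and q: "q \<in> mod_hom ?T (free_module ?T X) ?E" and qi: "\<And>x. x \<in> carrier ?E \<Longrightarrow> q (i x) = x"
    and TE: "module ?T ?E"
    using sep unfolding separable_algebra_def projective_module_def by blast
  \<comment> \<open>A module comes with a commutative ring of scalars, so the ring laws of the
    tensor algebra are part of the projectivity hypothesis.\<close>
  interpret E: module ?T ?E by fact
  \<comment> \<open>A product of cosets is a union of cosets. By closure it is one coset
    \<open>P.cls h\<close>, and as it contains the product of the representatives it must be their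
    class; no ideal property of the relations has to be checked.\<close>
  have cls_mult: "P.cls f \<otimes>\<^bsub>?T\<^esub> P.cls g = P.cls (f \<otimes>\<^bsub>?F\<^esub> g)"
    if fg: "f \<in> carrier ?F" "g \<in> carrier ?F" "f \<otimes>\<^bsub>?F\<^esub> g \<in> carrier ?F" for f g
  proof -
    have "P.cls f \<otimes>\<^bsub>?T\<^esub> P.cls g \<in> carrier ?T"
      using fg by (intro E.R.m_closed P.cls_closed)
    then obtain h where h: "h \<in> carrier ?F" "P.cls f \<otimes>\<^bsub>?T\<^esub> P.cls g = P.cls h"
      by (auto simp: P.tensor_carrier)
    have "P.cls (f \<otimes>\<^bsub>?F\<^esub> g) \<subseteq> P.cls f \<otimes>\<^bsub>?T\<^esub> P.cls g"
      unfolding P.quot_module_FI quot_module_def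
      using P.mem_cls[OF fg(1)] P.mem_cls[OF fg(2)] by (auto simp: rcoset_mult_def P.cls_def)
    then have "f \<otimes>\<^bsub>?F\<^esub> g \<in> P.cls h"
      using P.mem_cls[OF fg(3)] h by blast
    then show ?thesis
      using P.mem_clsD[OF h(1)] P.cls_eq_iff[of "f \<otimes>\<^bsub>?F\<^esub> g" h] h fg by simp
  qed
  \<comment> \<open>\<open>mult_hom\<close> is constant on a coset, so \<open>the_elem\<close> is
    applied to a singleton.\<close>
  have E_smult: "P.cls f \<odot>\<^bsub>?E\<^esub> s = mult_hom R S f \<otimes>\<^bsub>S\<^esub> s" if "f \<in> carrier ?F" for f s
  proof -
    have "mult_hom R S g = mult_hom R S f" if g: "g \<in> P.cls f" for g
      unfolding mult_hom_eq_lin_ext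
      using P.mem_clsD[OF \<open>f \<in> carrier ?F\<close> g] P.cls_eq_iff[of g f] that \<open>f \<in> carrier ?F\<close>
      by (intro P.lin_ext_cls_cong[OF S.module S.mult_bilinear]) auto
    then have "mult_hom R S ` P.cls f = (\<lambda>_. mult_hom R S f) ` P.cls f"
      by (rule image_cong[OF refl])
    also have "\<dots> = {mult_hom R S f}"
      by (rule image_constant[OF P.mem_cls[OF that]])
    finally have "mult_hom R S ` P.cls f = {mult_hom R S f}" .
    then show ?thesis
      by (simp add: enveloping_module_def)
  qed
  have mult_delta: "mult_hom R S (delta R (a, b)) = a \<otimes>\<^bsub>S\<^esub> b"
    if "a \<in> carrier S" "b \<in> carrier S" for a b
    unfolding mult_hom_eq_lin_ext using that by (subst S.lin_ext_delta) auto
  have carrier_E: "carrier ?E = carrier S"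
    by (simp add: enveloping_module_def)
  define l where "l = (\<lambda>a b. P.cls (delta R (a, b)))"
  have l: "l a b \<in> carrier ?T" "l a b \<odot>\<^bsub>?E\<^esub> s = a \<otimes>\<^bsub>S\<^esub> b \<otimes>\<^bsub>S\<^esub> s"
    if "a \<in> carrier S" "b \<in> carrier S" "s \<in> carrier S" for a b s
    unfolding l_def using that by (auto simp: P.cls_closed P.delta_closed_F E_smult mult_delta)
  define t where "t = i \<one>\<^bsub>S\<^esub>"
  have t: "t \<in> carrier (free_module ?T X)"
    unfolding t_def using mod_homD(1)[OF i] by (simp add: carrier_E)
  then have tD: "finite {x. t x \<noteq> \<zero>\<^bsub>?T\<^esub>}" "\<And>x. t x \<in> carrier ?T" "{x. t x \<noteq> \<zero>\<^bsub>?T\<^esub>} \<subseteq> X"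
    by (auto simp: free_module_def)
  have i_smult: "i (u \<odot>\<^bsub>?E\<^esub> \<one>\<^bsub>S\<^esub>) x = u \<otimes>\<^bsub>?T\<^esub> t x" if "u \<in> carrier ?T" for u x
    using mod_homD(3)[OF i, of u "\<one>\<^bsub>S\<^esub>"] that by (simp add: t_def carrier_E free_module_def)
  \<comment> \<open>\<open>s\<close> tensor 1 and 1 tensor \<open>s\<close> both act on 1 as
    \<open>s\<close>, so the linear section \<open>i\<close> takes the same value on both results;
    this is read off coordinate by coordinate.\<close>
  have comm: "l s \<one>\<^bsub>S\<^esub> \<otimes>\<^bsub>?T\<^esub> t x = l \<one>\<^bsub>S\<^esub> s \<otimes>\<^bsub>?T\<^esub> t x" if "s \<in> carrier S" for s x
    using i_smult[of "l s \<one>\<^bsub>S\<^esub>" x] i_smult[of "l \<one>\<^bsub>S\<^esub> s" x] l that by simp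
  let ?A = "{x. t x \<noteq> \<zero>\<^bsub>?T\<^esub>}"
  define qq where "qq = (\<lambda>x. q (delta ?T x))"
  have qq: "qq x \<in> carrier S" if "x \<in> ?A" for x
    using that tD(3) mod_homD(1)[OF q E.R.delta_closed, of x] carrier_E by (auto simp: qq_def)
  define e where "e = (\<Oplus>\<^bsub>?T\<^esub>x\<in>?A. t x \<otimes>\<^bsub>?T\<^esub> l \<one>\<^bsub>S\<^esub> (qq x))"
  have te: "t x \<otimes>\<^bsub>?T\<^esub> l \<one>\<^bsub>S\<^esub> (qq x) \<in> carrier ?T" if "x \<in> ?A" for x
    using E.R.m_closed[OF tD(2) l(1)[OF S.one_closed qq[OF that] S.one_closed]] .
  have e: "e \<in> carrier ?T"
    unfolding e_def by (intro E.R.finsum_closed funcsetI te)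
  \<comment> \<open>Acting on 1, each term of \<open>e\<close> gives \<open>t x\<close> applied to
    \<open>qq x\<close>; the sum is \<open>q t\<close>, and
    \<open>q t = q (i 1) = 1\<close>.\<close>
  have e1: "e \<odot>\<^bsub>?E\<^esub> \<one>\<^bsub>S\<^esub> = \<one>\<^bsub>S\<^esub>"
  proof -
    have "e \<odot>\<^bsub>?E\<^esub> \<one>\<^bsub>S\<^esub> = (\<Oplus>\<^bsub>?E\<^esub>x\<in>?A. (t x \<otimes>\<^bsub>?T\<^esub> l \<one>\<^bsub>S\<^esub> (qq x)) \<odot>\<^bsub>?E\<^esub> \<one>\<^bsub>S\<^esub>)"
      unfolding e_def by (intro E.finsum_smult_rdistr funcsetI te) (simp add: carrier_E)
    also have "\<dots> = lin_ext ?T ?E qq t"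
      unfolding lin_ext_def
    proof (intro E.M.finsum_cong' refl funcsetI)
      fix x assume x: "x \<in> ?A"
      show "(t x \<otimes>\<^bsub>?T\<^esub> l \<one>\<^bsub>S\<^esub> (qq x)) \<odot>\<^bsub>?E\<^esub> \<one>\<^bsub>S\<^esub> = t x \<odot>\<^bsub>?E\<^esub> qq x"
        using E.smult_assoc1[OF tD(2) l(1)[OF S.one_closed qq[OF x] S.one_closed], of "\<one>\<^bsub>S\<^esub>" x]
          l(2)[OF S.one_closed qq[OF x] S.one_closed] qq[OF x] by (simp add: carrier_E)
      show "t x \<odot>\<^bsub>?E\<^esub> qq x \<in> carrier ?E"
        using E.smult_closed[OF tD(2), of "qq x" x] qq[OF x] by (simp add: carrier_E)
    qed
    also have "\<dots> = q t"
      unfolding qq_def using E.mod_hom_free_module[OF q t] by simp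
    finally show ?thesis
      using qi[of "\<one>\<^bsub>S\<^esub>"] by (simp add: t_def carrier_E)
  qed
  have e_comm: "l s \<one>\<^bsub>S\<^esub> \<otimes>\<^bsub>?T\<^esub> e = l \<one>\<^bsub>S\<^esub> s \<otimes>\<^bsub>?T\<^esub> e" if s: "s \<in> carrier S" for s
  proof -
    have *: "u \<otimes>\<^bsub>?T\<^esub> e = (\<Oplus>\<^bsub>?T\<^esub>x\<in>?A. u \<otimes>\<^bsub>?T\<^esub> t x \<otimes>\<^bsub>?T\<^esub> l \<one>\<^bsub>S\<^esub> (qq x))" if "u \<in> carrier ?T" for u
    proof -
      have "u \<otimes>\<^bsub>?T\<^esub> e = (\<Oplus>\<^bsub>?T\<^esub>x\<in>?A. u \<otimes>\<^bsub>?T\<^esub> (t x \<otimes>\<^bsub>?T\<^esub> l \<one>\<^bsub>S\<^esub> (qq x)))"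
        unfolding e_def by (intro E.R.finsum_rdistr tD(1) that funcsetI te)
      also have "\<dots> = (\<Oplus>\<^bsub>?T\<^esub>x\<in>?A. u \<otimes>\<^bsub>?T\<^esub> t x \<otimes>\<^bsub>?T\<^esub> l \<one>\<^bsub>S\<^esub> (qq x))"
        by (intro E.R.finsum_cong' refl funcsetI E.R.m_assoc[symmetric] E.R.m_closed that tD(2)
            l(1)[OF _ _ S.one_closed] qq S.one_closed)
      finally show ?thesis .
    qed
    show ?thesis
      unfolding *[OF l(1)[OF s S.one_closed S.one_closed]]
        *[OF l(1)[OF S.one_closed s S.one_closed]] comm[OF s] ..
  qed
  obtain f where f: "f \<in> carrier ?F" "e = P.cls f"
    using e by (auto simp: P.tensor_carrier)
  let ?Z = "{z. f z \<noteq> \<zero>\<^bsub>R\<^esub>}"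
  have fD: "finite ?Z" "\<And>z. f z \<in> carrier R" "?Z \<subseteq> carrier S \<times> carrier S"
    using f by (auto simp: monoid_algebra_def free_module_def)
  have delta_mult: "delta R (a, b) \<otimes>\<^bsub>?F\<^esub> f = lin_ext R ?F (\<lambda>z. delta R (a \<otimes>\<^bsub>S\<^esub> fst z, b \<otimes>\<^bsub>S\<^esub> snd z)) f"
    "delta R (a, b) \<otimes>\<^bsub>?F\<^esub> f \<in> carrier ?F"
    if ab: "a \<in> carrier S" "b \<in> carrier S" for a b
  proof -
    show *: "delta R (a, b) \<otimes>\<^bsub>?F\<^esub> f = lin_ext R ?F (\<lambda>z. delta R (a \<otimes>\<^bsub>S\<^esub> fst z, b \<otimes>\<^bsub>S\<^esub> snd z)) f"
      using S.R.delta_mult_monoid_algebra[OF f(1), of "(a, b)"] ab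
      by (auto simp: split_beta mult_DirProd')
    show "delta R (a, b) \<otimes>\<^bsub>?F\<^esub> f \<in> carrier ?F"
      unfolding * lin_ext_def using fD ab
      by (intro P.F.M.finsum_closed) (auto intro!: P.F.smult_closed P.delta_closed_F)
  qed
  have lin_delta: "lin_ext R S (\<lambda>z. \<beta> (fst z) (snd z)) (delta R (a, b) \<otimes>\<^bsub>?F\<^esub> f) =
      (\<Oplus>\<^bsub>S\<^esub>z\<in>?Z. f z \<odot>\<^bsub>S\<^esub> \<beta> (a \<otimes>\<^bsub>S\<^esub> fst z) (b \<otimes>\<^bsub>S\<^esub> snd z))"
    if ab: "a \<in> carrier S" "b \<in> carrier S" and \<beta>: "bilinear_map R S S S \<beta>" for a b \<beta>
  proof -
    let ?h = "lin_ext R S (\<lambda>z. \<beta> (fst z) (snd z))"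
    have h: "?h \<in> mod_hom R ?F S"
      by (rule P.lin_ext_mod_hom_F[OF S.module \<beta>])
    have "?h (delta R (a, b) \<otimes>\<^bsub>?F\<^esub> f) =
        (\<Oplus>\<^bsub>S\<^esub>z\<in>?Z. ?h (f z \<odot>\<^bsub>?F\<^esub> delta R (a \<otimes>\<^bsub>S\<^esub> fst z, b \<otimes>\<^bsub>S\<^esub> snd z)))"
      unfolding delta_mult(1)[OF ab] lin_ext_def[of R ?F] using fD ab
      by (intro mod_hom_finsum[OF P.F.module_axioms S.module h])
        (auto intro!: P.F.smult_closed P.delta_closed_F)
    also have "\<dots> = (\<Oplus>\<^bsub>S\<^esub>z\<in>?Z. f z \<odot>\<^bsub>S\<^esub> \<beta> (a \<otimes>\<^bsub>S\<^esub> fst z) (b \<otimes>\<^bsub>S\<^esub> snd z))"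
    proof (intro S.M.finsum_cong' refl)
      fix z assume "z \<in> ?Z"
      then have "fst z \<in> carrier S" "snd z \<in> carrier S"
        using fD by auto
      then show "?h (f z \<odot>\<^bsub>?F\<^esub> delta R (a \<otimes>\<^bsub>S\<^esub> fst z, b \<otimes>\<^bsub>S\<^esub> snd z)) =
          f z \<odot>\<^bsub>S\<^esub> \<beta> (a \<otimes>\<^bsub>S\<^esub> fst z) (b \<otimes>\<^bsub>S\<^esub> snd z)"
        using ab fD bilinear_mapD(1)[OF \<beta>]
        by (simp add: mod_homD(3)[OF h] P.delta_closed_F S.lin_ext_delta)
    qed (use fD ab bilinear_mapD(1)[OF \<beta>] in \<open>auto intro!: S.smult_closed\<close>)
    finally show ?thesis .
  qed
  show ?thesis
  proof
    show "finite ?Z"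
      by (rule fD)
    \<comment> \<open>The coefficient \<open>f z\<close> of the representative is absorbed into the
      first tensor factor.\<close>
    show x: "(\<lambda>z. f z \<odot>\<^bsub>S\<^esub> fst z) \<in> ?Z \<rightarrow> carrier S" and y: "snd \<in> ?Z \<rightarrow> carrier S"
      using fD by auto
    have "mult_hom R S f = \<one>\<^bsub>S\<^esub>"
    proof -
      have "mult_hom R S f \<in> carrier S"
        unfolding mult_hom_eq_lin_ext
        using mod_homD(1)[OF P.lin_ext_mod_hom_F[OF S.module S.mult_bilinear] f(1)] .
      then show ?thesis
        using e1 E_smult[OF f(1), of "\<one>\<^bsub>S\<^esub>"] f(2) by simp
    qed
    then show "(\<Oplus>\<^bsub>S\<^esub>z\<in>?Z. f z \<odot>\<^bsub>S\<^esub> fst z \<otimes>\<^bsub>S\<^esub> snd z) = \<one>\<^bsub>S\<^esub>"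
      unfolding mult_hom_def using fD
      by (subst (asm) S.M.finsum_cong'[OF refl, where g = "\<lambda>z. f z \<odot>\<^bsub>S\<^esub> fst z \<otimes>\<^bsub>S\<^esub> snd z"])
        (auto simp: S.smult_assoc2)
    fix \<beta> s assume \<beta>: "bilinear_map R S S S \<beta>" and s: "s \<in> carrier S"
    have "P.cls (delta R (s, \<one>\<^bsub>S\<^esub>) \<otimes>\<^bsub>?F\<^esub> f) = P.cls (delta R (\<one>\<^bsub>S\<^esub>, s) \<otimes>\<^bsub>?F\<^esub> f)"
      using e_comm[OF s] unfolding f(2) l_def
      by (simp add: cls_mult delta_mult(2) P.delta_closed_F s f(1))
    then have "lin_ext R S (\<lambda>z. \<beta> (fst z) (snd z)) (delta R (s, \<one>\<^bsub>S\<^esub>) \<otimes>\<^bsub>?F\<^esub> f) =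
        lin_ext R S (\<lambda>z. \<beta> (fst z) (snd z)) (delta R (\<one>\<^bsub>S\<^esub>, s) \<otimes>\<^bsub>?F\<^esub> f)"
      using s by (intro P.lin_ext_cls_cong[OF S.module \<beta>]) (auto simp: delta_mult(2))
    then have eq: "(\<Oplus>\<^bsub>S\<^esub>z\<in>?Z. f z \<odot>\<^bsub>S\<^esub> \<beta> (s \<otimes>\<^bsub>S\<^esub> fst z) (\<one>\<^bsub>S\<^esub> \<otimes>\<^bsub>S\<^esub> snd z)) =
        (\<Oplus>\<^bsub>S\<^esub>z\<in>?Z. f z \<odot>\<^bsub>S\<^esub> \<beta> (\<one>\<^bsub>S\<^esub> \<otimes>\<^bsub>S\<^esub> fst z) (s \<otimes>\<^bsub>S\<^esub> snd z))"
      using lin_delta[OF _ _ \<beta>] s by simp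
    have smult_right: "s \<otimes>\<^bsub>S\<^esub> (r \<odot>\<^bsub>S\<^esub> u) = r \<odot>\<^bsub>S\<^esub> (s \<otimes>\<^bsub>S\<^esub> u)"
      if "r \<in> carrier R" "u \<in> carrier S" for r u
      using bilinear_mapD(5)[OF S.mult_bilinear] that s by simp
    have "(\<Oplus>\<^bsub>S\<^esub>z\<in>?Z. \<beta> (s \<otimes>\<^bsub>S\<^esub> (f z \<odot>\<^bsub>S\<^esub> fst z)) (snd z)) =
        (\<Oplus>\<^bsub>S\<^esub>z\<in>?Z. f z \<odot>\<^bsub>S\<^esub> \<beta> (s \<otimes>\<^bsub>S\<^esub> fst z) (\<one>\<^bsub>S\<^esub> \<otimes>\<^bsub>S\<^esub> snd z))"
      using fD s bilinear_mapD(1)[OF \<beta>]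
      by (intro S.M.finsum_cong') (auto simp: smult_right bilinear_mapD(4)[OF \<beta>])
    moreover have "(\<Oplus>\<^bsub>S\<^esub>z\<in>?Z. \<beta> (f z \<odot>\<^bsub>S\<^esub> fst z) (s \<otimes>\<^bsub>S\<^esub> snd z)) =
        (\<Oplus>\<^bsub>S\<^esub>z\<in>?Z. f z \<odot>\<^bsub>S\<^esub> \<beta> (\<one>\<^bsub>S\<^esub> \<otimes>\<^bsub>S\<^esub> fst z) (s \<otimes>\<^bsub>S\<^esub> snd z))"
      using fD s bilinear_mapD(1)[OF \<beta>]
      by (intro S.M.finsum_cong') (auto simp: bilinear_mapD(4)[OF \<beta>])
    ultimately show "(\<Oplus>\<^bsub>S\<^esub>z\<in>?Z. \<beta> (s \<otimes>\<^bsub>S\<^esub> (f z \<odot>\<^bsub>S\<^esub> fst z)) (snd z)) =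
        (\<Oplus>\<^bsub>S\<^esub>z\<in>?Z. \<beta> (f z \<odot>\<^bsub>S\<^esub> fst z) (s \<otimes>\<^bsub>S\<^esub> snd z))"
      using eq by simp
  qed
qed

section \<open>Eigenspaces of the group action\<close>

lemma (in abelian_monoid) finsum_swap:
  assumes "finite A" "finite B" "\<And>i j. \<lbrakk>i \<in> A; j \<in> B\<rbrakk> \<Longrightarrow> f i j \<in> carrier G"
  shows "(\<Oplus>i\<in>A. \<Oplus>j\<in>B. f i j) = (\<Oplus>j\<in>B. \<Oplus>i\<in>A. f i j)"
  using assms(1,3)
proof (induction A rule: finite_induct)
  case (insert a A)
  have "(\<Oplus>i\<in>insert a A. \<Oplus>j\<in>B. f i j) = (\<Oplus>j\<in>B. f a j) \<oplus> (\<Oplus>j\<in>B. \<Oplus>i\<in>A. f i j)"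
    using insert by (subst finsum_insert) (auto intro!: finsum_closed)
  also have "\<dots> = (\<Oplus>j\<in>B. f a j \<oplus> (\<Oplus>i\<in>A. f i j))"
    using insert.prems by (intro finsum_addf[symmetric]) (auto intro!: finsum_closed)
  also have "\<dots> = (\<Oplus>j\<in>B. \<Oplus>i\<in>insert a A. f i j)"
    using insert by (intro finsum_cong') (auto intro!: finsum_closed)
  finally show ?case .
qed simp

lemma (in comm_monoid) Units_of_mult_Units:
  assumes "x \<otimes> y \<in> Units G" "x \<in> carrier G" "y \<in> carrier G"
  shows "x \<in> Units G"
proof -
  have y: "y \<otimes> inv (x \<otimes> y) \<in> carrier G"
    using assms by simp
  have "x \<otimes> (y \<otimes> inv (x \<otimes> y)) = \<one>"
    using assms by (simp add: m_assoc[symmetric])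
  then show ?thesis
    using assms(2) y m_comm[OF y assms(2)] unfolding Units_def by auto
qed

text \<open>Modulo \<open>1 - z\<close> every power of \<open>z\<close> equals 1, so the sum of the
  first \<open>n\<close> powers is congruent to \<open>n\<close>. If that sum is zero,
  \<open>1 - z\<close> divides the unit \<open>n\<close>.\<close>

lemma (in cring) Units_one_minus_root:
  fixes n :: nat
  assumes z: "z \<in> carrier R" and sum: "(\<Oplus>k\<in>{..<n}. z [^] k) = \<zero>"
    and n: "[n] \<cdot> \<one> \<in> Units R"
  shows "\<one> \<ominus> z \<in> Units R"
proof -
  have pow: "\<exists>c\<in>carrier R. \<one> = z [^] k \<oplus> (\<one> \<ominus> z) \<otimes> c" for k :: nat
  proof (induction k)
    case 0
    then show ?case by (intro bexI[of _ \<zero>]) (use z in auto)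
  next
    case (Suc k)
    then obtain c where c: "c \<in> carrier R" "\<one> = z [^] k \<oplus> (\<one> \<ominus> z) \<otimes> c" by blast
    \<comment> \<open>With \<open>w = z^k\<close> this is
      \<open>z^k = z^(k+1) + (1 - z) z^k\<close>: passing from \<open>k\<close> to
      \<open>k + 1\<close> adds \<open>z^k\<close> to the cofactor.\<close>
    have "w \<otimes> z \<oplus> (\<one> \<ominus> z) \<otimes> (c \<oplus> w) = w \<oplus> (\<one> \<ominus> z) \<otimes> c" if "w \<in> carrier R" for w
      using that z c(1) by algebra
    then have "z [^] Suc k \<oplus> (\<one> \<ominus> z) \<otimes> (c \<oplus> z [^] k) = z [^] k \<oplus> (\<one> \<ominus> z) \<otimes> c"
      using z by simp
    then show ?case
      using c z by (intro bexI[of _ "c \<oplus> z [^] k"]) auto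
  qed
  have sums: "\<exists>c\<in>carrier R. [m] \<cdot> \<one> = (\<Oplus>k\<in>{..<m}. z [^] k) \<oplus> (\<one> \<ominus> z) \<otimes> c" for m :: nat
  proof (induction m)
    case 0
    then show ?case by (intro bexI[of _ \<zero>]) (use z in auto)
  next
    case (Suc m)
    then obtain c where c: "c \<in> carrier R"
      "[m] \<cdot> \<one> = (\<Oplus>k\<in>{..<m}. z [^] k) \<oplus> (\<one> \<ominus> z) \<otimes> c" by blast
    obtain d where d: "d \<in> carrier R" "\<one> = z [^] m \<oplus> (\<one> \<ominus> z) \<otimes> d"
      using pow by blast
    define s where "s = (\<Oplus>k\<in>{..<m}. z [^] k)"
    have s: "s \<in> carrier R"
      unfolding s_def using z by (intro finsum_closed) auto
    have "[Suc m] \<cdot> \<one> = (s \<oplus> (\<one> \<ominus> z) \<otimes> c) \<oplus> (z [^] m \<oplus> (\<one> \<ominus> z) \<otimes> d)"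
      using c(2) d(2) s_def by (metis add.nat_pow_Suc)
    also have "\<dots> = (z [^] m \<oplus> s) \<oplus> (\<one> \<ominus> z) \<otimes> (c \<oplus> d)"
      using z c(1) d(1) s by (simp add: a_minus_def r_distr a_ac)
    also have "z [^] m \<oplus> s = (\<Oplus>k\<in>{..<Suc m}. z [^] k)"
      unfolding s_def lessThan_Suc using z by (subst finsum_insert) auto
    finally show ?case
      using c d by (intro bexI[of _ "c \<oplus> d"]) auto
  qed
  from sums[of n] obtain c where c: "c \<in> carrier R"
    "[n] \<cdot> \<one> = (\<Oplus>k\<in>{..<n}. z [^] k) \<oplus> (\<one> \<ominus> z) \<otimes> c"
    by blast
  have eq: "[n] \<cdot> \<one> = (\<one> \<ominus> z) \<otimes> c"
    unfolding c(2) sum using z c(1) by (intro l_zero) auto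
  have "(\<one> \<ominus> z) \<otimes> c \<in> Units R"
    using n unfolding eq .
  then show ?thesis
    by (rule Units_of_mult_Units) (use z c(1) in auto)
qed

text \<open>The character stays outside: the statements about powers of a character and about two
  characters interpret the extended locale several times over the same action.\<close>

locale kummer_setting =
  fixes p :: nat and R :: "('a, 'c) ring_scheme" (structure) and \<mu> :: "'a set"
    and S :: "('a, 's, 'd) module_scheme" and G :: "('g, 'e) monoid_scheme" and \<phi> :: "'g \<Rightarrow> 's \<Rightarrow> 's"
  assumes prime_p: "prime p"
    and kummerian: "p_kummerian p R \<mu>"
    and separable: "separable_algebra R S"
    and group_G: "group G" and order_G: "order G = p"
    and action: "algebra_action R S G \<phi>"
    and invariants: "invariants_eq_base R S G \<phi>"
begin

sublocale S: algebra R S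
  using separable by (simp add: separable_algebra_def)

sublocale G: group G
  by (rule group_G)

sublocale act: group_action G "carrier S" \<phi>
  using action by (simp add: algebra_action_def)

abbreviation (input) \<iota> where "\<iota> \<equiv> structure_map S"

abbreviation pR where "pR \<equiv> [p] \<cdot> \<one>"

section \<open>Arithmetic of \<open>p\<close> and of the roots of unity in
  \<open>\<mu>\<close>\<close>

lemma pR_unit: "pR \<in> Units R"
  using kummerian by (simp add: p_kummerian_def)

lemma p_gt_1: "p > 1"
  using prime_p by (rule prime_gt_1_nat)

lemma finite_G: "finite (carrier G)"
  using order_G p_gt_1 by (simp add: order_def card_ge_0_finite)

lemma \<mu>_subgroup: "subgroup \<mu> (units_of R)"
  using kummerian by (simp add: p_kummerian_def)

lemma \<mu>_units: "\<mu> \<subseteq> Units R"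
  using subgroup.subset[OF \<mu>_subgroup] by (simp add: units_of_carrier)

lemma \<mu>_carrier: "z \<in> \<mu> \<Longrightarrow> z \<in> carrier R"
  using \<mu>_units S.R.Units_closed by blast

lemma one_mem_\<mu>: "\<one> \<in> \<mu>"
  using subgroup.one_closed[OF \<mu>_subgroup] by (simp add: units_of_one)

lemma nontrivial_R: "\<one> \<noteq> \<zero>"
proof
  assume "\<one> = \<zero>"
  then have "carrier R = {\<zero>}"
    using S.R.one_zeroD by blast
  then have "\<mu> \<subseteq> {\<zero>}"
    using \<mu>_carrier by blast
  then have "card \<mu> \<le> 1"
    using card_mono[of "{\<zero>}" \<mu>] by simp
  then show False
    using kummerian p_gt_1 by (simp add: p_kummerian_def)
qed

lemma power_mem_\<mu>: "z \<in> \<mu> \<Longrightarrow> z [^] (n::nat) \<in> \<mu>"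
  by (induction n) (use one_mem_\<mu> subgroup.m_closed[OF \<mu>_subgroup] in \<open>auto simp: units_of_mult\<close>)

text \<open>A group of prime order is generated by each of its elements other than 1.\<close>

lemma \<mu>_powers:
  assumes z: "z \<in> \<mu>" "z \<noteq> \<one>"
  shows "z [^] p = \<one>" "inj_on (\<lambda>k. z [^] k) {..<p}" "(\<lambda>k. z [^] k) ` {..<p} = \<mu>"
proof -
  let ?H = "(units_of R)\<lparr>carrier := \<mu>\<rparr>"
  interpret H: group ?H
    using \<mu>_subgroup subgroup.subgroup_is_group[OF _ S.R.units_group] by blast
  have pow: "x [^]\<^bsub>?H\<^esub> k = x [^] k" for x and k :: nat
    by (simp add: nat_pow_def units_of_def)
  have card: "card \<mu> = p" and order: "order ?H = p"
    using kummerian by (simp_all add: p_kummerian_def order_def)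
  then have fin: "finite \<mu>"
    using p_gt_1 by (simp add: card_ge_0_finite)
  have zH: "z \<in> carrier ?H"
    using z by simp
  have "H.ord z dvd p"
    using H.ord_dvd_group_order[OF zH] order by simp
  moreover have "H.ord z \<noteq> 1"
    using H.ord_eq_1[OF zH] z by (simp add: units_of_one)
  ultimately have ord: "H.ord z = p"
    using prime_p by (metis prime_nat_iff)
  show "z [^] p = \<one>"
    using H.pow_ord_eq_1[OF zH] ord pow by (simp add: units_of_one)
  have eq: "{0..p - 1} = {..<p}"
    using p_gt_1 by auto
  show inj: "inj_on (\<lambda>k. z [^] k) {..<p}"
    using H.ord_inj[OF zH] unfolding ord pow eq .
  show "(\<lambda>k. z [^] k) ` {..<p} = \<mu>"
    using power_mem_\<mu>[OF z(1)] card card_image[OF inj] by (intro card_subset_eq fin) auto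
qed

lemma sum_powers_\<mu>:
  assumes "z \<in> \<mu>" "z \<noteq> \<one>"
  shows "(\<Oplus>k\<in>{..<p}. z [^] k) = \<zero>"
proof -
  have "(\<Oplus>k\<in>{..<p}. z [^] k) = (\<Oplus>y\<in>(\<lambda>k. z [^] k) ` {..<p}. y)"
    using \<mu>_powers(2)[OF assms] \<mu>_carrier[OF assms(1)] by (subst S.R.finsum_reindex) auto
  also have "\<dots> = \<zero>"
    using kummerian unfolding \<mu>_powers(3)[OF assms] by (simp add: p_kummerian_def)
  finally show ?thesis .
qed

lemma Units_one_minus:
  assumes "z \<in> \<mu>" "z \<noteq> \<one>"
  shows "\<one> \<ominus> z \<in> Units R"
  using S.R.Units_one_minus_root[OF _ sum_powers_\<mu>[OF assms] pR_unit] \<mu>_carrier[OF assms(1)] .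

section \<open>The embedding of \<open>R\<close> into \<open>S\<close> and the automorphisms
  \<open>\<phi> g\<close>\<close>

lemma \<iota>_hom: "\<iota> \<in> ring_hom R S"
  by (rule ring_hom_memI)
    (simp_all add: structure_map_def S.smult_l_distr S.smult_assoc1 S.smult_assoc2)

lemma \<iota>_closed: "r \<in> carrier R \<Longrightarrow> \<iota> r \<in> carrier S"
  using ring_hom_closed[OF \<iota>_hom] .

lemma \<iota>_mult: "r \<in> carrier R \<Longrightarrow> s \<in> carrier R \<Longrightarrow> \<iota> (r \<otimes> s) = \<iota> r \<otimes>\<^bsub>S\<^esub> \<iota> s"
  using ring_hom_mult[OF \<iota>_hom] .

lemma \<iota>_one: "\<iota> \<one> = \<one>\<^bsub>S\<^esub>"
  using ring_hom_one[OF \<iota>_hom] .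

lemma \<iota>_smult: "r \<in> carrier R \<Longrightarrow> x \<in> carrier S \<Longrightarrow> \<iota> r \<otimes>\<^bsub>S\<^esub> x = r \<odot>\<^bsub>S\<^esub> x"
  by (simp add: structure_map_def S.smult_assoc2)

lemma \<iota>_inj: "r \<in> carrier R \<Longrightarrow> s \<in> carrier R \<Longrightarrow> \<iota> r = \<iota> s \<Longrightarrow> r = s"
  using invariants by (auto simp: invariants_eq_base_def inj_on_def)

lemma smult_right:
  assumes "r \<in> carrier R" "x \<in> carrier S" "y \<in> carrier S"
  shows "x \<otimes>\<^bsub>S\<^esub> (r \<odot>\<^bsub>S\<^esub> y) = r \<odot>\<^bsub>S\<^esub> (x \<otimes>\<^bsub>S\<^esub> y)"
  using bilinear_mapD(5)[OF S.mult_bilinear] assms by simp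

lemma one_neq_zero_S: "\<one>\<^bsub>S\<^esub> \<noteq> \<zero>\<^bsub>S\<^esub>"
  using \<iota>_inj[OF S.R.one_closed S.R.zero_closed] nontrivial_R S.one_closed
  by (auto simp: structure_map_def)

lemma \<phi>_hom:
  assumes "g \<in> carrier G"
  shows "\<phi> g \<in> ring_hom S S" "\<phi> g \<in> mod_hom R S S"
  using action assms by (auto simp: algebra_action_def algebra_iso_def ring_iso_def)

lemmas \<phi>_closed = ring_hom_closed[OF \<phi>_hom(1)]
  and \<phi>_mult = ring_hom_mult[OF \<phi>_hom(1)]
  and \<phi>_one = ring_hom_one[OF \<phi>_hom(1)]
  and \<phi>_add = ring_hom_add[OF \<phi>_hom(1)]
  and \<phi>_smult = mod_homD(3)[OF \<phi>_hom(2)]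
  and \<phi>_finsum = mod_hom_finsum[OF S.module S.module \<phi>_hom(2)]

lemma \<phi>_comp: "g \<in> carrier G \<Longrightarrow> h \<in> carrier G \<Longrightarrow> x \<in> carrier S \<Longrightarrow> \<phi> (g \<otimes>\<^bsub>G\<^esub> h) x = \<phi> g (\<phi> h x)"
  by (rule act.composition_rule)

lemma \<phi>_id: "x \<in> carrier S \<Longrightarrow> \<phi> \<one>\<^bsub>G\<^esub> x = x"
  using act.id_eq_one by (metis restrict_apply')

lemma \<phi>_pow:
  fixes k :: nat
  assumes "g \<in> carrier G" "x \<in> carrier S"
  shows "\<phi> g (x [^]\<^bsub>S\<^esub> k) = \<phi> g x [^]\<^bsub>S\<^esub> k"
  by (induction k) (use assms in \<open>simp_all add: \<phi>_mult \<phi>_one\<close>)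

lemma base_iff: "\<iota> ` carrier R = {s \<in> carrier S. \<forall>g\<in>carrier G. \<phi> g s = s}"
  using invariants by (simp add: invariants_eq_base_def)

text \<open>Translating the summation variable by \<open>h\<close> multiplies the sum by
  \<open>\<psi> h\<close>. Hence \<open>1 - \<psi> h\<close> annihilates the sum, and a unit can be
  cancelled in any ring.\<close>

lemma sum_character:
  assumes \<psi>: "\<And>g. g \<in> carrier G \<Longrightarrow> \<psi> g \<in> carrier R"
    and mult: "\<And>g h. g \<in> carrier G \<Longrightarrow> h \<in> carrier G \<Longrightarrow> \<psi> (g \<otimes>\<^bsub>G\<^esub> h) = \<psi> g \<otimes> \<psi> h"
    and h: "h \<in> carrier G" "\<one> \<ominus> \<psi> h \<in> Units R"
  shows "(\<Oplus>g\<in>carrier G. \<psi> g) = \<zero>"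
proof -
  let ?s = "\<Oplus>g\<in>carrier G. \<psi> g"
  have s: "?s \<in> carrier R"
    using \<psi> by (intro S.R.finsum_closed) auto
  have "?s = (\<Oplus>g\<in>(\<lambda>g. h \<otimes>\<^bsub>G\<^esub> g) ` carrier G. \<psi> g)"
    using G.surj_const_mult[OF h(1)] by simp
  also have "\<dots> = (\<Oplus>g\<in>carrier G. \<psi> (h \<otimes>\<^bsub>G\<^esub> g))"
    using \<psi> h G.inj_on_cmult[OF h(1)] by (intro S.R.finsum_reindex) auto
  also have "\<dots> = (\<Oplus>g\<in>carrier G. \<psi> h \<otimes> \<psi> g)"
    using \<psi> h by (intro S.R.finsum_cong') (auto simp: mult)
  also have "\<dots> = \<psi> h \<otimes> ?s"
    using \<psi> h finite_G by (intro S.R.finsum_rdistr[symmetric]) auto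
  finally have "(\<one> \<ominus> \<psi> h) \<otimes> ?s = \<zero>"
    using s \<psi>[OF h(1)] by (simp add: a_minus_def S.R.l_distr S.R.l_minus S.R.r_neg)
  then show ?thesis
    using S.R.Units_l_cancel[OF h(2) s S.R.zero_closed] S.R.Units_closed[OF h(2)] by simp
qed

end

locale kummer_character = kummer_setting p R \<mu> S G \<phi>
  for p :: nat and R :: "('a, 'c) ring_scheme" (structure) and \<mu> :: "'a set"
    and S :: "('a, 's, 'd) module_scheme" and G :: "('g, 'e) monoid_scheme" and \<phi> :: "'g \<Rightarrow> 's \<Rightarrow> 's" +
  fixes \<chi> :: "'g \<Rightarrow> 'a"
  assumes nontrivial: "nontrivial_character G R \<mu> \<chi>"
begin

lemma \<chi>_mem: "g \<in> carrier G \<Longrightarrow> \<chi> g \<in> \<mu>"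
  and \<chi>_mult: "g \<in> carrier G \<Longrightarrow> h \<in> carrier G \<Longrightarrow> \<chi> (g \<otimes>\<^bsub>G\<^esub> h) = \<chi> g \<otimes> \<chi> h"
  using nontrivial by (auto simp: nontrivial_character_def hom_def units_of_def)

lemma \<chi>_unit: "g \<in> carrier G \<Longrightarrow> \<chi> g \<in> Units R"
  using \<chi>_mem \<mu>_units by blast

lemma \<chi>_closed: "g \<in> carrier G \<Longrightarrow> \<chi> g \<in> carrier R"
  using \<chi>_unit by blast

lemma \<chi>_one: "\<chi> \<one>\<^bsub>G\<^esub> = \<one>"
proof -
  have "\<chi> \<one>\<^bsub>G\<^esub> \<otimes> \<chi> \<one>\<^bsub>G\<^esub> = \<chi> \<one>\<^bsub>G\<^esub> \<otimes> \<one>"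
    using \<chi>_mult[of "\<one>\<^bsub>G\<^esub>" "\<one>\<^bsub>G\<^esub>"] \<chi>_closed by simp
  then show ?thesis
    using S.R.Units_l_cancel[of "\<chi> \<one>\<^bsub>G\<^esub>" "\<chi> \<one>\<^bsub>G\<^esub>" \<one>] \<chi>_unit \<chi>_closed by blast
qed

lemma \<chi>_inv: "g \<in> carrier G \<Longrightarrow> \<chi> (inv\<^bsub>G\<^esub> g) \<otimes> \<chi> g = \<one>"
  using \<chi>_mult[of "inv\<^bsub>G\<^esub> g" g] by (simp add: \<chi>_one)

lemma \<chi>_pow_p: "g \<in> carrier G \<Longrightarrow> \<chi> g [^] p = \<one>"
  using \<mu>_powers(1)[OF \<chi>_mem] by (cases "\<chi> g = \<one>") auto

text \<open>Since the order of \<open>G\<close> is prime, \<open>g\<close> generates it;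
  \<open>\<chi> g = 1\<close> would make \<open>\<chi>\<close> trivial.\<close>

lemma \<chi>_neq_one:
  assumes g: "g \<in> carrier G" "g \<noteq> \<one>\<^bsub>G\<^esub>"
  shows "\<chi> g \<noteq> \<one>"
proof
  assume "\<chi> g = \<one>"
  then have pow: "\<chi> (g [^]\<^bsub>G\<^esub> k) = \<one>" for k :: nat
    by (induction k) (use g in \<open>simp_all add: \<chi>_one \<chi>_mult\<close>)
  have "G.ord g dvd p"
    using G.ord_dvd_group_order[OF g(1)] order_G by simp
  then have "G.ord g = p"
    using prime_p G.ord_eq_1[OF g(1)] g(2) by (metis prime_nat_iff)
  moreover have "{0..p - 1} = {..<p}"
    using p_gt_1 by auto
  ultimately have "inj_on (\<lambda>k. g [^]\<^bsub>G\<^esub> k) {..<p}"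
    using G.ord_inj[OF g(1)] by simp
  then have "card ((\<lambda>k. g [^]\<^bsub>G\<^esub> k) ` {..<p}) = card (carrier G)"
    using order_G by (simp add: card_image order_def)
  then have "(\<lambda>k. g [^]\<^bsub>G\<^esub> k) ` {..<p} = carrier G"
    using g by (intro card_subset_eq finite_G) auto
  then have "\<chi> h = \<one>" if "h \<in> carrier G" for h
    using that pow by (metis imageE)
  then show False
    using nontrivial by (auto simp: nontrivial_character_def)
qed

lemma \<chi>_pow_cong:
  fixes k j :: nat
  assumes "g \<in> carrier G"
  shows "\<chi> g [^] (k + p * j) = \<chi> g [^] k"
  using assms \<chi>_closed[OF assms] \<chi>_pow_p[OF assms]
  by (simp add: S.R.nat_pow_mult[symmetric] S.R.nat_pow_pow[symmetric])

text \<open>The weight is a natural number rather than a residue modulo \<open>p\<close>, so that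
  weights of products simply add; \<open>M_cong\<close> supplies the periodicity.\<close>

definition M where "M k = char_space S G \<phi> (\<lambda>g. \<chi> g [^] (k::nat))"

lemma mem_M: "x \<in> M k \<longleftrightarrow> x \<in> carrier S \<and> (\<forall>g\<in>carrier G. \<phi> g x = (\<chi> g [^] k) \<odot>\<^bsub>S\<^esub> x)"
  by (simp add: M_def char_space_def)

lemma M_closed: "x \<in> M k \<Longrightarrow> x \<in> carrier S"
  by (simp add: mem_M)

lemma M_1: "M 1 = char_space S G \<phi> \<chi>"
  by (auto simp: mem_M char_space_def \<chi>_closed)

lemma M_0: "M 0 = \<iota> ` carrier R"
  by (auto simp: mem_M base_iff)

lemma M_cong: "M (k + p * j) = M k"
  by (auto simp: mem_M \<chi>_pow_cong)

lemma M_p: "M p = M 0" and M_add_p: "M (k + p) = M k"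
  using M_cong[of 0 1] M_cong[of k 1] by simp_all

lemma M_mult:
  assumes "x \<in> M j" "y \<in> M k"
  shows "x \<otimes>\<^bsub>S\<^esub> y \<in> M (j + k)"
proof -
  have "\<phi> g (x \<otimes>\<^bsub>S\<^esub> y) = (\<chi> g [^] (j + k)) \<odot>\<^bsub>S\<^esub> (x \<otimes>\<^bsub>S\<^esub> y)" if "g \<in> carrier G" for g
  proof -
    have "\<phi> g (x \<otimes>\<^bsub>S\<^esub> y) = ((\<chi> g [^] j) \<odot>\<^bsub>S\<^esub> x) \<otimes>\<^bsub>S\<^esub> ((\<chi> g [^] k) \<odot>\<^bsub>S\<^esub> y)"
      using assms that by (simp add: mem_M \<phi>_mult)
    also have "\<dots> = (\<chi> g [^] j \<otimes> \<chi> g [^] k) \<odot>\<^bsub>S\<^esub> (x \<otimes>\<^bsub>S\<^esub> y)"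
      using assms that
      by (simp add: mem_M S.smult_assoc1[symmetric] S.smult_assoc2 smult_right \<chi>_closed S.R.m_comm)
    finally show ?thesis
      using that by (simp add: S.R.nat_pow_mult \<chi>_closed)
  qed
  then show ?thesis
    using assms by (simp add: mem_M)
qed

lemma M_one: "\<one>\<^bsub>S\<^esub> \<in> M 0"
  by (simp add: mem_M \<phi>_one)

lemma M_pow: "x \<in> M j \<Longrightarrow> x [^]\<^bsub>S\<^esub> (k::nat) \<in> M (j * k)"
proof (induction k)
  case 0
  then show ?case using M_one by simp
next
  case (Suc k)
  then show ?case using M_mult[of "x [^]\<^bsub>S\<^esub> k" "j * k" x j] by (simp add: add.commute)
qed

lemma M_submodule: "submodule (M k) R S"
proof (rule S.submoduleI)
  fix a x assume "a \<in> carrier R" "x \<in> M k"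
  then show "a \<odot>\<^bsub>S\<^esub> x \<in> M k"
    by (auto simp: mem_M \<phi>_smult \<chi>_closed S.smult_assoc1[symmetric] S.R.m_comm)
qed (auto simp: mem_M \<phi>_add \<chi>_closed S.smult_r_distr S.smult_r_minus
    mod_hom_zero[OF S.module S.module \<phi>_hom(2)] mod_hom_uminus[OF S.module S.module \<phi>_hom(2)])

lemmas M_smult = submodule.smult_closed[OF M_submodule]

lemma M_module: "module R (S\<lparr>carrier := M k\<rparr>)"
  by (rule submodule.submodule_is_module[OF M_submodule S.module])

text \<open>The inverse has eigenvalue \<open>\<chi>(g)^(-j)\<close>, which is
  \<open>\<chi>(g)^l\<close> for the complementary weight \<open>l\<close>. This keeps all exponents
  natural.\<close>

lemma M_inv:
  assumes x: "x \<in> M j" "x \<in> Units S" and jl: "j + l = p"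
  shows "inv\<^bsub>S\<^esub> x \<in> M l"
proof -
  let ?y = "inv\<^bsub>S\<^esub> x"
  have y: "?y \<in> carrier S" and xS: "x \<in> carrier S"
    using x by auto
  have "\<phi> g ?y = (\<chi> g [^] l) \<odot>\<^bsub>S\<^esub> ?y" if g: "g \<in> carrier G" for g
  proof -
    have gy: "\<phi> g ?y \<in> carrier S"
      using g y by (simp add: \<phi>_closed)
    have "(\<chi> g [^] l) \<odot>\<^bsub>S\<^esub> ?y = (\<chi> g [^] l) \<odot>\<^bsub>S\<^esub> (?y \<otimes>\<^bsub>S\<^esub> \<phi> g (x \<otimes>\<^bsub>S\<^esub> ?y))"
      using x y g by (simp add: \<phi>_one)
    also have "\<phi> g (x \<otimes>\<^bsub>S\<^esub> ?y) = (\<chi> g [^] j) \<odot>\<^bsub>S\<^esub> (x \<otimes>\<^bsub>S\<^esub> \<phi> g ?y)"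
      unfolding \<phi>_mult[OF g xS y] using x g gy by (simp add: mem_M S.smult_assoc2 \<chi>_closed)
    also have "(\<chi> g [^] l) \<odot>\<^bsub>S\<^esub> (?y \<otimes>\<^bsub>S\<^esub> ((\<chi> g [^] j) \<odot>\<^bsub>S\<^esub> (x \<otimes>\<^bsub>S\<^esub> \<phi> g ?y))) =
        (\<chi> g [^] l \<otimes> \<chi> g [^] j) \<odot>\<^bsub>S\<^esub> (?y \<otimes>\<^bsub>S\<^esub> x \<otimes>\<^bsub>S\<^esub> \<phi> g ?y)"
      using x y g gy xS by (simp add: smult_right S.smult_assoc1 \<chi>_closed S.m_assoc del: S.Units_l_inv)
    also have "\<dots> = \<phi> g ?y"
      using x gy g jl by (simp add: S.R.nat_pow_mult \<chi>_closed add.commute[of l] \<chi>_pow_p)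
    finally show ?thesis ..
  qed
  then show ?thesis
    using y by (simp add: mem_M)
qed

text \<open>This is \<open>p\<close> times the projector onto \<open>M k\<close>, and for
  \<open>k = 0\<close> the trace. The factor \<open>p\<close> is divided out only where a
  decomposition or a partition of 1 is needed, and negative powers of \<open>\<chi> g\<close> are
  written as powers at the inverse of \<open>g\<close>.\<close>

definition P
  where "P k s = (\<Oplus>\<^bsub>S\<^esub>g\<in>carrier G. (\<chi> (inv\<^bsub>G\<^esub> g) [^] (k::nat)) \<odot>\<^bsub>S\<^esub> \<phi> g s)"

lemma P_term_closed: "g \<in> carrier G \<Longrightarrow> s \<in> carrier S \<Longrightarrow> (\<chi> (inv\<^bsub>G\<^esub> g) [^] k) \<odot>\<^bsub>S\<^esub> \<phi> g s \<in> carrier S"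
  for k :: nat
  by (simp add: \<chi>_closed \<phi>_closed)

lemma P_closed: "s \<in> carrier S \<Longrightarrow> P k s \<in> carrier S"
  unfolding P_def by (intro S.finsum_closed funcsetI P_term_closed)

text \<open>Applying \<open>\<phi> h\<close> and summing over \<open>h g\<close> instead of
  \<open>g\<close> pulls out the factor \<open>\<chi>(h)^k\<close>.\<close>

lemma P_mem:
  assumes s: "s \<in> carrier S"
  shows "P k s \<in> M k"
proof -
  have "\<phi> h (P k s) = (\<chi> h [^] k) \<odot>\<^bsub>S\<^esub> P k s" if h: "h \<in> carrier G" for h
  proof -
    have "\<phi> h (P k s) = (\<Oplus>\<^bsub>S\<^esub>g\<in>carrier G. \<phi> h ((\<chi> (inv\<^bsub>G\<^esub> g) [^] k) \<odot>\<^bsub>S\<^esub> \<phi> g s))"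
      unfolding P_def using s h by (intro \<phi>_finsum funcsetI P_term_closed)
    also have "\<dots> = (\<Oplus>\<^bsub>S\<^esub>g\<in>carrier G. (\<chi> h [^] k) \<odot>\<^bsub>S\<^esub>
        ((\<chi> (inv\<^bsub>G\<^esub> (h \<otimes>\<^bsub>G\<^esub> g)) [^] k) \<odot>\<^bsub>S\<^esub> \<phi> (h \<otimes>\<^bsub>G\<^esub> g) s))"
    proof (intro S.finsum_cong' refl funcsetI)
      fix g assume g: "g \<in> carrier G"
      have "inv\<^bsub>G\<^esub> g = inv\<^bsub>G\<^esub> (h \<otimes>\<^bsub>G\<^esub> g) \<otimes>\<^bsub>G\<^esub> h"
        using g h by (simp add: G.inv_mult_group G.m_assoc)
      then have "\<chi> (inv\<^bsub>G\<^esub> g) = \<chi> h \<otimes> \<chi> (inv\<^bsub>G\<^esub> (h \<otimes>\<^bsub>G\<^esub> g))"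
        using g h by (simp add: \<chi>_mult S.R.m_comm \<chi>_closed)
      then show "\<phi> h ((\<chi> (inv\<^bsub>G\<^esub> g) [^] k) \<odot>\<^bsub>S\<^esub> \<phi> g s) = (\<chi> h [^] k) \<odot>\<^bsub>S\<^esub>
          ((\<chi> (inv\<^bsub>G\<^esub> (h \<otimes>\<^bsub>G\<^esub> g)) [^] k) \<odot>\<^bsub>S\<^esub> \<phi> (h \<otimes>\<^bsub>G\<^esub> g) s)"
        using g h s
        by (simp add: \<phi>_smult \<phi>_comp \<phi>_closed \<chi>_closed S.R.nat_pow_distrib S.smult_assoc1)
    qed (use h s P_term_closed in \<open>simp add: \<chi>_closed\<close>)
    also have "\<dots> = (\<chi> h [^] k) \<odot>\<^bsub>S\<^esub> (\<Oplus>\<^bsub>S\<^esub>g\<in>carrier G.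
        (\<chi> (inv\<^bsub>G\<^esub> (h \<otimes>\<^bsub>G\<^esub> g)) [^] k) \<odot>\<^bsub>S\<^esub> \<phi> (h \<otimes>\<^bsub>G\<^esub> g) s)"
      using h s P_term_closed finite_G
      by (intro S.finsum_smult_ldistr[symmetric]) (auto simp: \<chi>_closed)
    also have "(\<Oplus>\<^bsub>S\<^esub>g\<in>carrier G. (\<chi> (inv\<^bsub>G\<^esub> (h \<otimes>\<^bsub>G\<^esub> g)) [^] k) \<odot>\<^bsub>S\<^esub> \<phi> (h \<otimes>\<^bsub>G\<^esub> g) s) =
        (\<Oplus>\<^bsub>S\<^esub>g\<in>(\<lambda>g. h \<otimes>\<^bsub>G\<^esub> g) ` carrier G. (\<chi> (inv\<^bsub>G\<^esub> g) [^] k) \<odot>\<^bsub>S\<^esub> \<phi> g s)"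
      using h s P_term_closed G.inj_on_cmult[OF h] by (intro S.finsum_reindex[symmetric]) auto
    also have "\<dots> = P k s"
      unfolding P_def using G.surj_const_mult[OF h] by simp
    finally show ?thesis .
  qed
  then show ?thesis
    using s by (simp add: mem_M P_closed)
qed

text \<open>An eigenvector passes through the averaging sum and raises the weight by its own. Weight
  0 gives linearity over \<open>R\<close>, which is how \<open>P_mod_hom\<close> uses it.\<close>

lemma P_mult:
  assumes a: "a \<in> M k" and x: "x \<in> carrier S"
  shows "P (j + k) (a \<otimes>\<^bsub>S\<^esub> x) = a \<otimes>\<^bsub>S\<^esub> P j x"
proof -
  have aS: "a \<in> carrier S"
    using a by (rule M_closed)
  have "P (j + k) (a \<otimes>\<^bsub>S\<^esub> x) = (\<Oplus>\<^bsub>S\<^esub>g\<in>carrier G. a \<otimes>\<^bsub>S\<^esub> ((\<chi> (inv\<^bsub>G\<^esub> g) [^] j) \<odot>\<^bsub>S\<^esub> \<phi> g x))"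
    unfolding P_def
  proof (intro S.finsum_cong' refl funcsetI)
    fix g assume g: "g \<in> carrier G"
    have "\<chi> (inv\<^bsub>G\<^esub> g) [^] k \<otimes> \<chi> g [^] k = \<one>"
      using g \<chi>_inv[OF g] by (simp add: S.R.nat_pow_distrib[symmetric] \<chi>_closed)
    then have "\<chi> (inv\<^bsub>G\<^esub> g) [^] (j + k) \<otimes> \<chi> g [^] k = \<chi> (inv\<^bsub>G\<^esub> g) [^] j"
      using g by (simp add: S.R.nat_pow_mult[symmetric] \<chi>_closed S.R.m_assoc)
    then show "(\<chi> (inv\<^bsub>G\<^esub> g) [^] (j + k)) \<odot>\<^bsub>S\<^esub> \<phi> g (a \<otimes>\<^bsub>S\<^esub> x) =
        a \<otimes>\<^bsub>S\<^esub> ((\<chi> (inv\<^bsub>G\<^esub> g) [^] j) \<odot>\<^bsub>S\<^esub> \<phi> g x)"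
      using g a aS x
      by (simp add: \<phi>_mult mem_M \<phi>_closed \<chi>_closed smult_right S.smult_assoc2 S.smult_assoc1[symmetric])
  qed (use aS x P_term_closed in simp)
  also have "\<dots> = a \<otimes>\<^bsub>S\<^esub> P j x"
    unfolding P_def using aS x P_term_closed finite_G by (intro S.finsum_rdistr[symmetric]) auto
  finally show ?thesis .
qed

lemma P_cong: "s \<in> carrier S \<Longrightarrow> P (k + p * j) s = P k s"
  unfolding P_def by (intro S.finsum_cong' refl funcsetI P_term_closed) (simp_all add: \<chi>_pow_cong)

lemma P_mod_hom: "P k \<in> mod_hom R S S"
proof -
  have "P k (x \<oplus>\<^bsub>S\<^esub> y) = P k x \<oplus>\<^bsub>S\<^esub> P k y" if "x \<in> carrier S" "y \<in> carrier S" for x y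
  proof -
    have "P k (x \<oplus>\<^bsub>S\<^esub> y) = (\<Oplus>\<^bsub>S\<^esub>g\<in>carrier G. ((\<chi> (inv\<^bsub>G\<^esub> g) [^] k) \<odot>\<^bsub>S\<^esub> \<phi> g x) \<oplus>\<^bsub>S\<^esub>
        ((\<chi> (inv\<^bsub>G\<^esub> g) [^] k) \<odot>\<^bsub>S\<^esub> \<phi> g y))"
      unfolding P_def using that P_term_closed
      by (intro S.finsum_cong' refl funcsetI) (simp_all add: \<phi>_add \<phi>_closed S.smult_r_distr \<chi>_closed)
    then show ?thesis
      unfolding P_def using that P_term_closed by (simp add: S.finsum_addf Pi_iff)
  qed
  moreover have "P k (r \<odot>\<^bsub>S\<^esub> x) = r \<odot>\<^bsub>S\<^esub> P k x" if "r \<in> carrier R" "x \<in> carrier S" for r x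
  proof -
    have "P (k + 0) (\<iota> r \<otimes>\<^bsub>S\<^esub> x) = \<iota> r \<otimes>\<^bsub>S\<^esub> P k x"
      using that by (intro P_mult) (auto simp: M_0)
    then show ?thesis
      using that by (simp add: \<iota>_smult P_closed)
  qed
  ultimately show ?thesis
    by (auto simp: mod_hom_def P_closed)
qed

text \<open>After the two sums are exchanged, the coefficient of \<open>\<phi> g s\<close> is the
  sum of the first \<open>p\<close> powers of \<open>\<chi>(g)^(-1)\<close>: it is \<open>p\<close>
  for the neutral element and zero otherwise.\<close>

lemma sum_P:
  assumes s: "s \<in> carrier S"
  shows "(\<Oplus>\<^bsub>S\<^esub>k\<in>{..<p}. P k s) = pR \<odot>\<^bsub>S\<^esub> s"
proof -
  have "(\<Oplus>\<^bsub>S\<^esub>k\<in>{..<p}. P k s) =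
      (\<Oplus>\<^bsub>S\<^esub>g\<in>carrier G. \<Oplus>\<^bsub>S\<^esub>k\<in>{..<p}. (\<chi> (inv\<^bsub>G\<^esub> g) [^] k) \<odot>\<^bsub>S\<^esub> \<phi> g s)"
    unfolding P_def using s P_term_closed finite_G by (intro S.finsum_swap) auto
  also have "\<dots> = (\<Oplus>\<^bsub>S\<^esub>g\<in>carrier G. if \<one>\<^bsub>G\<^esub> = g then pR \<odot>\<^bsub>S\<^esub> \<phi> g s else \<zero>\<^bsub>S\<^esub>)"
  proof (intro S.finsum_cong' refl funcsetI)
    fix g assume g: "g \<in> carrier G"
    have "(\<Oplus>\<^bsub>S\<^esub>k\<in>{..<p}. (\<chi> (inv\<^bsub>G\<^esub> g) [^] k) \<odot>\<^bsub>S\<^esub> \<phi> g s) =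
        (\<Oplus>k\<in>{..<p}. \<chi> (inv\<^bsub>G\<^esub> g) [^] k) \<odot>\<^bsub>S\<^esub> \<phi> g s"
      using g s by (intro S.finsum_smult_rdistr[symmetric]) (auto simp: \<phi>_closed \<chi>_closed)
    also have "(\<Oplus>k\<in>{..<p}. \<chi> (inv\<^bsub>G\<^esub> g) [^] k) = (if \<one>\<^bsub>G\<^esub> = g then pR else \<zero>)"
    proof (cases "g = \<one>\<^bsub>G\<^esub>")
      case True
      then show ?thesis
        using S.R.add.finprod_const[of \<one> "{..<p}"] by (simp add: \<chi>_one)
    next
      case False
      then have "\<chi> (inv\<^bsub>G\<^esub> g) \<noteq> \<one>"
        using g by (intro \<chi>_neq_one) (auto simp: G.inv_eq_1_iff)
      then show ?thesis
        using sum_powers_\<mu>[OF \<chi>_mem] g False by auto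
    qed
    finally show "(\<Oplus>\<^bsub>S\<^esub>k\<in>{..<p}. (\<chi> (inv\<^bsub>G\<^esub> g) [^] k) \<odot>\<^bsub>S\<^esub> \<phi> g s) =
        (if \<one>\<^bsub>G\<^esub> = g then pR \<odot>\<^bsub>S\<^esub> \<phi> g s else \<zero>\<^bsub>S\<^esub>)"
      using g s by (simp add: \<phi>_closed)
  qed (use s in \<open>simp add: \<phi>_closed\<close>)
  also have "\<dots> = pR \<odot>\<^bsub>S\<^esub> \<phi> \<one>\<^bsub>G\<^esub> s"
    using s finite_G by (intro S.add.finprod_singleton) (auto simp: \<phi>_closed)
  finally show ?thesis
    using s by (simp add: \<phi>_id)
qed

text \<open>Orthogonality of \<open>\<chi>^j\<close> and \<open>\<chi>^k\<close>: for different
  weights the coefficients form a nontrivial character into \<open>\<mu>\<close>, and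
  \<open>sum_character\<close> makes their sum vanish.\<close>

lemma P_on_M:
  assumes x: "x \<in> M k" and jk: "j < p" "k < p"
  shows "P j x = (if j = k then pR \<odot>\<^bsub>S\<^esub> x else \<zero>\<^bsub>S\<^esub>)"
proof -
  have xS: "x \<in> carrier S"
    using x by (rule M_closed)
  let ?\<psi> = "\<lambda>g. \<chi> (inv\<^bsub>G\<^esub> g) [^] j \<otimes> \<chi> g [^] k"
  have \<psi>: "?\<psi> g \<in> carrier R" if "g \<in> carrier G" for g
    using that by (simp add: \<chi>_closed)
  have "P j x = (\<Oplus>\<^bsub>S\<^esub>g\<in>carrier G. ?\<psi> g \<odot>\<^bsub>S\<^esub> x)"
    unfolding P_def using x \<psi>
    by (intro S.finsum_cong' refl funcsetI) (simp_all add: mem_M S.smult_assoc1 \<chi>_closed)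
  also have "\<dots> = (\<Oplus>g\<in>carrier G. ?\<psi> g) \<odot>\<^bsub>S\<^esub> x"
    using xS \<psi> by (intro S.finsum_smult_rdistr[symmetric]) auto
  also have "(\<Oplus>g\<in>carrier G. ?\<psi> g) = (if j = k then pR else \<zero>)"
  proof (cases "j = k")
    case True
    have "?\<psi> g = \<one>" if "g \<in> carrier G" for g
      using that True \<chi>_inv[OF that] by (simp add: S.R.nat_pow_distrib[symmetric] \<chi>_closed)
    then have "(\<Oplus>g\<in>carrier G. ?\<psi> g) = (\<Oplus>g\<in>carrier G. \<one>)"
      by (intro S.R.finsum_cong' refl funcsetI) simp_all
    then show ?thesis
      using S.R.add.finprod_const[of \<one> "carrier G"] True order_G by (simp add: order_def)
  next
    case False
    obtain h where h: "h \<in> carrier G" "\<chi> h \<noteq> \<one>"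
      using nontrivial by (auto simp: nontrivial_character_def)
    have mem: "?\<psi> h \<in> \<mu>"
      using subgroup.m_closed[OF \<mu>_subgroup power_mem_\<mu> power_mem_\<mu>] \<chi>_mem h
      by (simp add: units_of_mult)
    \<comment> \<open>Otherwise two different exponents below \<open>p\<close> would give the same
      power of \<open>\<chi> h\<close>, which generates \<open>\<mu>\<close>.\<close>
    have "?\<psi> h \<noteq> \<one>"
    proof
      assume *: "?\<psi> h = \<one>"
      have hj: "\<chi> h [^] j \<in> carrier R" "\<chi> h [^] k \<in> carrier R" "\<chi> (inv\<^bsub>G\<^esub> h) [^] j \<in> carrier R"
        using h by (auto simp: \<chi>_closed)
      have "\<chi> h [^] j \<otimes> \<chi> (inv\<^bsub>G\<^esub> h) [^] j = \<one>"
        using h \<chi>_inv[of h] by (simp add: S.R.nat_pow_distrib[symmetric] \<chi>_closed S.R.m_comm)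
      then have "\<chi> h [^] k = \<chi> h [^] j \<otimes> ?\<psi> h"
        using hj by (simp add: S.R.m_assoc[symmetric])
      then have "\<chi> h [^] k = \<chi> h [^] j"
        using * hj by simp
      then show False
        using \<mu>_powers(2)[OF \<chi>_mem[OF h(1)] h(2)] jk False by (auto simp: inj_on_def)
    qed
    then have "\<one> \<ominus> ?\<psi> h \<in> Units R"
      using Units_one_minus mem by blast
    moreover have "?\<psi> (g \<otimes>\<^bsub>G\<^esub> g') = ?\<psi> g \<otimes> ?\<psi> g'" if "g \<in> carrier G" "g' \<in> carrier G" for g g'
    proof -
      have "\<chi> (inv\<^bsub>G\<^esub> (g \<otimes>\<^bsub>G\<^esub> g')) = \<chi> (inv\<^bsub>G\<^esub> g) \<otimes> \<chi> (inv\<^bsub>G\<^esub> g')"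
        using that by (simp add: G.inv_mult_group \<chi>_mult S.R.m_comm \<chi>_closed)
      then show ?thesis
        using that by (simp add: \<chi>_mult S.R.nat_pow_distrib \<chi>_closed S.R.m_ac)
    qed
    ultimately show ?thesis
      using False sum_character[of ?\<psi> h] \<psi> h(1) by simp
  qed
  finally show ?thesis
    using xS by simp
qed

section \<open>Primitive elements\<close>

definition p_inv where "p_inv = inv pR"

lemma p_inv: "p_inv \<in> carrier R" "p_inv \<otimes> pR = \<one>" "pR \<in> carrier R"
  using pR_unit by (auto simp: p_inv_def)

lemma p_inv_smult: "x \<in> carrier S \<Longrightarrow> p_inv \<odot>\<^bsub>S\<^esub> (pR \<odot>\<^bsub>S\<^esub> x) = x"
  using p_inv by (simp add: S.smult_assoc1[symmetric])

lemma pR_smult_cancel: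
  "\<lbrakk>x \<in> carrier S; y \<in> carrier S; pR \<odot>\<^bsub>S\<^esub> x = pR \<odot>\<^bsub>S\<^esub> y\<rbrakk> \<Longrightarrow> x = y"
  using p_inv_smult by metis

lemma power_mem_M: "\<alpha> \<in> M 1 \<Longrightarrow> \<alpha> [^]\<^bsub>S\<^esub> (k::nat) \<in> M k"
  using M_pow[of \<alpha> 1 k] by simp

text \<open>The powers of \<open>\<alpha>\<close> below \<open>p\<close> have distinct weights, so
  \<open>P j\<close> extracts the \<open>j\<close>-th term of an expansion in them.\<close>

lemma P_power_sum:
  assumes \<alpha>: "\<alpha> \<in> M 1" and c: "c \<in> {..<p} \<rightarrow> carrier R" and j: "j < p"
  shows "P j (\<Oplus>\<^bsub>S\<^esub>i\<in>{..<p}. c i \<odot>\<^bsub>S\<^esub> \<alpha> [^]\<^bsub>S\<^esub> i) = pR \<odot>\<^bsub>S\<^esub> (c j \<odot>\<^bsub>S\<^esub> \<alpha> [^]\<^bsub>S\<^esub> j)"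
proof -
  have pow: "\<alpha> [^]\<^bsub>S\<^esub> (i::nat) \<in> carrier S" for i
    using M_closed[OF \<alpha>] by simp
  have tm: "c i \<odot>\<^bsub>S\<^esub> \<alpha> [^]\<^bsub>S\<^esub> i \<in> M i" "c i \<odot>\<^bsub>S\<^esub> \<alpha> [^]\<^bsub>S\<^esub> i \<in> carrier S" if "i < p" for i
  proof -
    have "c i \<in> carrier R"
      using c that by auto
    then show "c i \<odot>\<^bsub>S\<^esub> \<alpha> [^]\<^bsub>S\<^esub> i \<in> M i" "c i \<odot>\<^bsub>S\<^esub> \<alpha> [^]\<^bsub>S\<^esub> i \<in> carrier S"
      using M_smult[OF _ power_mem_M[OF \<alpha>]] pow by auto
  qed
  have "P j (\<Oplus>\<^bsub>S\<^esub>i\<in>{..<p}. c i \<odot>\<^bsub>S\<^esub> \<alpha> [^]\<^bsub>S\<^esub> i) = (\<Oplus>\<^bsub>S\<^esub>i\<in>{..<p}. P j (c i \<odot>\<^bsub>S\<^esub> \<alpha> [^]\<^bsub>S\<^esub> i))"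
    using tm by (intro mod_hom_finsum[OF S.module S.module P_mod_hom]) auto
  also have "\<dots> = (\<Oplus>\<^bsub>S\<^esub>i\<in>{..<p}. if j = i then pR \<odot>\<^bsub>S\<^esub> (c i \<odot>\<^bsub>S\<^esub> \<alpha> [^]\<^bsub>S\<^esub> i) else \<zero>\<^bsub>S\<^esub>)"
    using tm p_inv(3) j by (intro S.finsum_cong' refl funcsetI) (simp_all add: P_on_M[OF tm(1)])
  also have "\<dots> = pR \<odot>\<^bsub>S\<^esub> (c j \<odot>\<^bsub>S\<^esub> \<alpha> [^]\<^bsub>S\<^esub> j)"
    using tm p_inv(3) j by (intro S.add.finprod_singleton) auto
  finally show ?thesis .
qed

text \<open>The inverse of \<open>\<alpha>\<close> has weight \<open>p - 1\<close>, so
  \<open>x\<close> times its \<open>k\<close>-th power has weight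
  \<open>k + (p - 1) k = p k\<close>, that is 0, and lies in \<open>R\<close>.\<close>

lemma M_eq_smult_power:
  assumes \<alpha>: "\<alpha> \<in> M 1" "\<alpha> \<in> Units S" and x: "x \<in> M k"
  shows "\<exists>r\<in>carrier R. x = r \<odot>\<^bsub>S\<^esub> \<alpha> [^]\<^bsub>S\<^esub> k"
proof -
  have \<alpha>S: "\<alpha> \<in> carrier S" and xS: "x \<in> carrier S"
    using \<alpha> x M_closed by auto
  let ?\<beta> = "inv\<^bsub>S\<^esub> \<alpha>"
  have "?\<beta> \<in> M (p - 1)"
    using \<alpha> p_gt_1 by (intro M_inv[of _ 1]) auto
  then have "x \<otimes>\<^bsub>S\<^esub> ?\<beta> [^]\<^bsub>S\<^esub> k \<in> M (k + (p - 1) * k)"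
    using M_mult[OF x M_pow] by blast
  also have "k + (p - 1) * k = 0 + p * k"
    using p_gt_1 by (simp add: algebra_simps)
  finally have "x \<otimes>\<^bsub>S\<^esub> ?\<beta> [^]\<^bsub>S\<^esub> k \<in> \<iota> ` carrier R"
    by (simp only: M_cong M_0)
  then obtain r where r: "r \<in> carrier R" "x \<otimes>\<^bsub>S\<^esub> ?\<beta> [^]\<^bsub>S\<^esub> k = \<iota> r"
    by auto
  have "?\<beta> [^]\<^bsub>S\<^esub> k \<otimes>\<^bsub>S\<^esub> \<alpha> [^]\<^bsub>S\<^esub> k = \<one>\<^bsub>S\<^esub>"
    using \<alpha> \<alpha>S by (simp add: S.nat_pow_distrib[symmetric])
  then have "x = x \<otimes>\<^bsub>S\<^esub> ?\<beta> [^]\<^bsub>S\<^esub> k \<otimes>\<^bsub>S\<^esub> \<alpha> [^]\<^bsub>S\<^esub> k"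
    using \<alpha> \<alpha>S xS by (simp add: S.m_assoc)
  also have "\<dots> = r \<odot>\<^bsub>S\<^esub> \<alpha> [^]\<^bsub>S\<^esub> k"
    using r \<alpha>S by (simp add: \<iota>_smult)
  finally show ?thesis
    using r(1) by blast
qed

lemma smult_unit_cancel:
  assumes "a \<in> Units S" "r \<in> carrier R" "s \<in> carrier R" "r \<odot>\<^bsub>S\<^esub> a = s \<odot>\<^bsub>S\<^esub> a"
  shows "r = s"
proof -
  have "\<iota> r \<otimes>\<^bsub>S\<^esub> a = \<iota> s \<otimes>\<^bsub>S\<^esub> a"
    using assms by (simp add: \<iota>_smult S.Units_closed)
  then have "a \<otimes>\<^bsub>S\<^esub> \<iota> r = a \<otimes>\<^bsub>S\<^esub> \<iota> s"
    using assms by (simp add: S.m_comm \<iota>_closed S.Units_closed)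
  then have "\<iota> r = \<iota> s"
    using assms S.Units_l_cancel \<iota>_closed by blast
  then show ?thesis
    using \<iota>_inj assms by blast
qed

lemma Units_pow: "a \<in> Units S \<Longrightarrow> a [^]\<^bsub>S\<^esub> (k::nat) \<in> Units S"
  by (induction k) auto

text \<open>The coordinates of \<open>x\<close> come from its projections \<open>P k x\<close>.
  Conversely any expansion is recovered by applying \<open>P j\<close>, and the unit powers of
  \<open>\<alpha>\<close> cancel, which gives uniqueness.\<close>

lemma primitive_of_unit:
  assumes \<alpha>: "\<alpha> \<in> M 1" "\<alpha> \<in> Units S"
  shows "primitive_elt p R S G \<phi> \<chi> \<alpha>"
proof -
  have \<alpha>S: "\<alpha> \<in> carrier S"
    using \<alpha> M_closed by auto
  then have pow: "\<alpha> [^]\<^bsub>S\<^esub> (i::nat) \<in> carrier S" for i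
    by simp
  have "\<exists>!c. c \<in> {..<p} \<rightarrow>\<^sub>E carrier R \<and> x = (\<Oplus>\<^bsub>S\<^esub>i\<in>{..<p}. c i \<odot>\<^bsub>S\<^esub> \<alpha> [^]\<^bsub>S\<^esub> i)"
    if x: "x \<in> carrier S" for x
  proof (rule ex_ex1I)
    have "\<forall>k. \<exists>r. r \<in> carrier R \<and> P k x = r \<odot>\<^bsub>S\<^esub> \<alpha> [^]\<^bsub>S\<^esub> k"
      using M_eq_smult_power[OF \<alpha> P_mem[OF x]] by blast
    then obtain r where r: "\<And>k. r k \<in> carrier R" "\<And>k. P k x = r k \<odot>\<^bsub>S\<^esub> \<alpha> [^]\<^bsub>S\<^esub> k"
      by metis
    \<comment> \<open>\<open>p_inv\<close> removes the factor \<open>p\<close> in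
      \<open>sum_P\<close>; the restricted function is extensional, as \<open>is_basis\<close>
      demands.\<close>
    let ?c = "\<lambda>k\<in>{..<p}. p_inv \<otimes> r k"
    have "x = p_inv \<odot>\<^bsub>S\<^esub> (\<Oplus>\<^bsub>S\<^esub>k\<in>{..<p}. P k x)"
      using x by (simp add: sum_P p_inv_smult)
    also have "\<dots> = (\<Oplus>\<^bsub>S\<^esub>k\<in>{..<p}. p_inv \<odot>\<^bsub>S\<^esub> P k x)"
      using x p_inv by (intro S.finsum_smult_ldistr) (auto simp: P_closed)
    also have "\<dots> = (\<Oplus>\<^bsub>S\<^esub>k\<in>{..<p}. ?c k \<odot>\<^bsub>S\<^esub> \<alpha> [^]\<^bsub>S\<^esub> k)"
      using r pow p_inv by (intro S.finsum_cong' refl funcsetI) (simp_all add: S.smult_assoc1)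
    finally have "?c \<in> {..<p} \<rightarrow>\<^sub>E carrier R \<and> x = (\<Oplus>\<^bsub>S\<^esub>k\<in>{..<p}. ?c k \<odot>\<^bsub>S\<^esub> \<alpha> [^]\<^bsub>S\<^esub> k)"
      using r(1) p_inv(1) by auto
    then show "\<exists>c. c \<in> {..<p} \<rightarrow>\<^sub>E carrier R \<and> x = (\<Oplus>\<^bsub>S\<^esub>i\<in>{..<p}. c i \<odot>\<^bsub>S\<^esub> \<alpha> [^]\<^bsub>S\<^esub> i)"
      by blast
  next
    fix c d
    assume c: "c \<in> {..<p} \<rightarrow>\<^sub>E carrier R \<and> x = (\<Oplus>\<^bsub>S\<^esub>i\<in>{..<p}. c i \<odot>\<^bsub>S\<^esub> \<alpha> [^]\<^bsub>S\<^esub> i)"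
      and d: "d \<in> {..<p} \<rightarrow>\<^sub>E carrier R \<and> x = (\<Oplus>\<^bsub>S\<^esub>i\<in>{..<p}. d i \<odot>\<^bsub>S\<^esub> \<alpha> [^]\<^bsub>S\<^esub> i)"
    have "c j = d j" if j: "j < p" for j
    proof -
      have cd: "c \<in> {..<p} \<rightarrow> carrier R" "d \<in> {..<p} \<rightarrow> carrier R" "c j \<in> carrier R" "d j \<in> carrier R"
        using c d j by auto
      have "pR \<odot>\<^bsub>S\<^esub> (c j \<odot>\<^bsub>S\<^esub> \<alpha> [^]\<^bsub>S\<^esub> j) = pR \<odot>\<^bsub>S\<^esub> (d j \<odot>\<^bsub>S\<^esub> \<alpha> [^]\<^bsub>S\<^esub> j)"
        using P_power_sum[OF \<alpha>(1) cd(1) j] P_power_sum[OF \<alpha>(1) cd(2) j]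
          c[THEN conjunct2] d[THEN conjunct2] by argo
      then have "c j \<odot>\<^bsub>S\<^esub> \<alpha> [^]\<^bsub>S\<^esub> j = d j \<odot>\<^bsub>S\<^esub> \<alpha> [^]\<^bsub>S\<^esub> j"
        by (rule pR_smult_cancel[rotated 2]) (use pow cd in auto)
      then show ?thesis
        using smult_unit_cancel[OF Units_pow[OF \<alpha>(2)]] cd by blast
    qed
    then show "c = d"
      using c d by (intro PiE_ext[of c "{..<p}" "\<lambda>_. carrier R" d]) auto
  qed
  then show ?thesis
    using \<alpha>(1) pow by (simp add: primitive_elt_def is_basis_def M_1[unfolded One_nat_def])
qed

text \<open>If \<open>\<alpha>\<close> is primitive, then \<open>\<alpha>\<^sup>p = u \<in> R\<close>, and \<open>S/\<alpha>S = R/uR\<close> carries the derivation of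
  \<open>S = R[\<alpha>]\<close> that sends \<open>\<alpha>\<close> to 1. A separable algebra has no nonzero derivations, so \<open>S = \<alpha>S\<close>.
  The proof evaluates the separability idempotent explicitly instead of using derivations.\<close>

lemma unit_of_primitive:
  assumes prim: "primitive_elt p R S G \<phi> \<chi> \<alpha>"
  shows "\<alpha> \<in> Units S"
proof -
  have \<alpha>: "\<alpha> \<in> M 1" and basis: "is_basis R S {..<p} (\<lambda>i. \<alpha> [^]\<^bsub>S\<^esub> i)"
    using prim by (auto simp: primitive_elt_def M_1[unfolded One_nat_def])
  have \<alpha>S: "\<alpha> \<in> carrier S"
    using \<alpha> M_closed by auto
  then have pow: "\<alpha> [^]\<^bsub>S\<^esub> (i::nat) \<in> carrier S" for i
    by simp
  \<comment> \<open>Here \<open>\<alpha>\<close> is not yet invertible, so the coefficient is taken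
    from the basis expansion instead of dividing by \<open>\<alpha>^j\<close>.\<close>
  have eigen: "\<exists>r\<in>carrier R. x = r \<odot>\<^bsub>S\<^esub> \<alpha> [^]\<^bsub>S\<^esub> j" if x: "x \<in> M j" and j: "j < p" for x j
  proof -
    obtain c where c: "c \<in> {..<p} \<rightarrow>\<^sub>E carrier R" "x = (\<Oplus>\<^bsub>S\<^esub>i\<in>{..<p}. c i \<odot>\<^bsub>S\<^esub> \<alpha> [^]\<^bsub>S\<^esub> i)"
      using basis M_closed[OF x] unfolding is_basis_def by blast
    have cj: "c j \<in> carrier R" "c \<in> {..<p} \<rightarrow> carrier R"
      using c j by auto
    have "pR \<odot>\<^bsub>S\<^esub> x = pR \<odot>\<^bsub>S\<^esub> (c j \<odot>\<^bsub>S\<^esub> \<alpha> [^]\<^bsub>S\<^esub> j)"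
      using P_power_sum[OF \<alpha> cj(2) j] P_on_M[OF x j j] c(2) by simp
    then have "x = c j \<odot>\<^bsub>S\<^esub> \<alpha> [^]\<^bsub>S\<^esub> j"
      by (rule pR_smult_cancel[rotated 2]) (use M_closed[OF x] pow cj in auto)
    then show ?thesis
      using cj by blast
  qed
  \<comment> \<open>Replaces division by \<open>\<alpha>\<close>: coordinates are compared at index
    1, which lies below \<open>p\<close>.\<close>
  have cancel: "r = s" if rs: "r \<in> carrier R" "s \<in> carrier R" "r \<odot>\<^bsub>S\<^esub> \<alpha> = s \<odot>\<^bsub>S\<^esub> \<alpha>" for r s
  proof -
    let ?c = "\<lambda>r. \<lambda>i\<in>{..<p}. if 1 = i then r else \<zero>"
    have rep: "t \<odot>\<^bsub>S\<^esub> \<alpha> = (\<Oplus>\<^bsub>S\<^esub>i\<in>{..<p}. ?c t i \<odot>\<^bsub>S\<^esub> \<alpha> [^]\<^bsub>S\<^esub> i)" if t: "t \<in> carrier R" for t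
    proof -
      have "(\<Oplus>\<^bsub>S\<^esub>i\<in>{..<p}. ?c t i \<odot>\<^bsub>S\<^esub> \<alpha> [^]\<^bsub>S\<^esub> i) =
          (\<Oplus>\<^bsub>S\<^esub>i\<in>{..<p}. if 1 = i then t \<odot>\<^bsub>S\<^esub> \<alpha> [^]\<^bsub>S\<^esub> i else \<zero>\<^bsub>S\<^esub>)"
        using t pow by (intro S.finsum_cong' refl funcsetI) auto
      also have "\<dots> = t \<odot>\<^bsub>S\<^esub> \<alpha> [^]\<^bsub>S\<^esub> (1::nat)"
        using t pow p_gt_1 by (intro S.add.finprod_singleton) auto
      finally show ?thesis
        using \<alpha>S by simp
    qed
    have "r \<odot>\<^bsub>S\<^esub> \<alpha> = (\<Oplus>\<^bsub>S\<^esub>i\<in>{..<p}. ?c r i \<odot>\<^bsub>S\<^esub> \<alpha> [^]\<^bsub>S\<^esub> i)"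
      "r \<odot>\<^bsub>S\<^esub> \<alpha> = (\<Oplus>\<^bsub>S\<^esub>i\<in>{..<p}. ?c s i \<odot>\<^bsub>S\<^esub> \<alpha> [^]\<^bsub>S\<^esub> i)"
      using rep[OF rs(1)] rep[OF rs(2), folded rs(3)] .
    moreover have "?c r \<in> {..<p} \<rightarrow>\<^sub>E carrier R" "?c s \<in> {..<p} \<rightarrow>\<^sub>E carrier R" "r \<odot>\<^bsub>S\<^esub> \<alpha> \<in> carrier S"
      using rs \<alpha>S by auto
    ultimately have "?c r = ?c s"
      by (intro is_basis_unique[OF basis, of "r \<odot>\<^bsub>S\<^esub> \<alpha>" "?c r" "?c s"] conjI)
    then have "?c r 1 = ?c s 1"
      by metis
    then show ?thesis
      using p_gt_1 by simp
  qed
  \<comment> \<open>Modulo \<open>\<alpha>\<close> only the weight-0 part of \<open>x\<close>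
    survives, up to the factor \<open>p\<close>.\<close>
  have split: "\<exists>t\<in>carrier S. pR \<odot>\<^bsub>S\<^esub> x = P 0 x \<oplus>\<^bsub>S\<^esub> \<alpha> \<otimes>\<^bsub>S\<^esub> t" if x: "x \<in> carrier S" for x
  proof -
    have "\<forall>k\<in>{1..<p}. \<exists>r. r \<in> carrier R \<and> P k x = r \<odot>\<^bsub>S\<^esub> \<alpha> [^]\<^bsub>S\<^esub> k"
      using eigen[OF P_mem[OF x]] by (metis atLeastLessThan_iff)
    then obtain r where r: "\<And>k. k \<in> {1..<p} \<Longrightarrow> r k \<in> carrier R"
      "\<And>k. k \<in> {1..<p} \<Longrightarrow> P k x = r k \<odot>\<^bsub>S\<^esub> \<alpha> [^]\<^bsub>S\<^esub> k"
      by metis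
    have eq: "P k x = \<alpha> \<otimes>\<^bsub>S\<^esub> (r k \<odot>\<^bsub>S\<^esub> \<alpha> [^]\<^bsub>S\<^esub> (k - 1))" if k: "k \<in> {1..<p}" for k
    proof -
      obtain m where "k = Suc m"
        using k by (cases k) auto
      then show ?thesis
        using r[OF k] \<alpha>S pow by (simp add: smult_right S.m_comm)
    qed
    have closed: "r k \<odot>\<^bsub>S\<^esub> \<alpha> [^]\<^bsub>S\<^esub> (k - 1) \<in> carrier S" if k: "k \<in> {1..<p}" for k
      using r(1)[OF k] pow by simp
    have "{..<p} = insert 0 {1..<p}"
      using p_gt_1 by auto
    then have "pR \<odot>\<^bsub>S\<^esub> x = (\<Oplus>\<^bsub>S\<^esub>k\<in>insert 0 {1..<p}. P k x)"
      using sum_P[OF x] by simp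
    also have "\<dots> = P 0 x \<oplus>\<^bsub>S\<^esub> (\<Oplus>\<^bsub>S\<^esub>k\<in>{1..<p}. P k x)"
      using x by (intro S.finsum_insert) (auto simp: P_closed)
    also have "(\<Oplus>\<^bsub>S\<^esub>k\<in>{1..<p}. P k x) = (\<Oplus>\<^bsub>S\<^esub>k\<in>{1..<p}. \<alpha> \<otimes>\<^bsub>S\<^esub> (r k \<odot>\<^bsub>S\<^esub> \<alpha> [^]\<^bsub>S\<^esub> (k - 1)))"
      using closed \<alpha>S by (intro S.finsum_cong' refl funcsetI eq) auto
    also have "\<dots> = \<alpha> \<otimes>\<^bsub>S\<^esub> (\<Oplus>\<^bsub>S\<^esub>k\<in>{1..<p}. r k \<odot>\<^bsub>S\<^esub> \<alpha> [^]\<^bsub>S\<^esub> (k - 1))"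
      using closed \<alpha>S by (intro S.finsum_rdistr[symmetric]) auto
    finally show ?thesis
      using closed by (intro bexI[of _ "\<Oplus>\<^bsub>S\<^esub>k\<in>{1..<p}. r k \<odot>\<^bsub>S\<^esub> \<alpha> [^]\<^bsub>S\<^esub> (k - 1)"] S.finsum_closed funcsetI)
  qed
  have p_ne: "p - 1 < p" "Suc (p - 1) = p"
    using p_gt_1 by auto
  \<comment> \<open>Weight 0 is weight \<open>p\<close>, so this part of \<open>\<alpha> x\<close>
    is \<open>\<alpha>\<close> times the part of \<open>x\<close> of weight \<open>p - 1\<close>,
    and therefore a multiple of \<open>\<alpha>^p\<close>.\<close>
  have shift: "\<exists>r\<in>carrier R. P 0 (\<alpha> \<otimes>\<^bsub>S\<^esub> x) = \<alpha> [^]\<^bsub>S\<^esub> p \<otimes>\<^bsub>S\<^esub> \<iota> r" if x: "x \<in> carrier S" for x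
  proof -
    obtain r where r: "r \<in> carrier R" "P (p - 1) x = r \<odot>\<^bsub>S\<^esub> \<alpha> [^]\<^bsub>S\<^esub> (p - 1)"
      using eigen[OF P_mem[OF x] p_ne(1)] by blast
    have "P 0 (\<alpha> \<otimes>\<^bsub>S\<^esub> x) = P (0 + p * 1) (\<alpha> \<otimes>\<^bsub>S\<^esub> x)"
      by (rule P_cong[symmetric]) (use x \<alpha>S in simp)
    also have "0 + p * 1 = p - 1 + 1"
      using p_ne by simp
    also have "P (p - 1 + 1) (\<alpha> \<otimes>\<^bsub>S\<^esub> x) = \<alpha> \<otimes>\<^bsub>S\<^esub> P (p - 1) x"
      by (rule P_mult[OF \<alpha> x])
    also have "\<dots> = r \<odot>\<^bsub>S\<^esub> \<alpha> [^]\<^bsub>S\<^esub> Suc (p - 1)"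
      using r \<alpha>S pow by (simp add: smult_right S.m_comm)
    also have "\<dots> = \<alpha> [^]\<^bsub>S\<^esub> p \<otimes>\<^bsub>S\<^esub> \<iota> r"
      unfolding p_ne using r(1) pow \<iota>_smult[OF r(1) pow] \<iota>_closed[OF r(1)] by (simp add: S.m_comm)
    finally show ?thesis
      using r(1) by blast
  qed
  obtain Z :: "('s \<times> 's) set" and x y
    where Z: "finite Z" "x \<in> Z \<rightarrow> carrier S" "y \<in> Z \<rightarrow> carrier S"
    "(\<Oplus>\<^bsub>S\<^esub>z\<in>Z. x z \<otimes>\<^bsub>S\<^esub> y z) = \<one>\<^bsub>S\<^esub>"
    and comm: "\<And>\<beta> s. \<lbrakk>bilinear_map R S S S \<beta>; s \<in> carrier S\<rbrakk> \<Longrightarrow>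
      (\<Oplus>\<^bsub>S\<^esub>z\<in>Z. \<beta> (s \<otimes>\<^bsub>S\<^esub> x z) (y z)) = (\<Oplus>\<^bsub>S\<^esub>z\<in>Z. \<beta> (x z) (s \<otimes>\<^bsub>S\<^esub> y z))"
  proof (rule separable_algebra_elements[OF separable], goal_cases)
    case (1 Z x y)
    show ?case
      by (rule 1(1)[OF 1(2-5)]) (rule 1(6))
  qed
  have xy: "x z \<in> carrier S" "y z \<in> carrier S" if "z \<in> Z" for z
    using Z that by auto
  have bil: "bilinear_map R S S S (\<lambda>a b. P 0 a \<otimes>\<^bsub>S\<^esub> b)"
    using mod_homD[OF P_mod_hom]
    by (auto simp: bilinear_map_def mod_hom_def P_closed S.l_distr S.r_distr S.smult_assoc2 smult_right)
  \<comment> \<open>By \<open>split\<close>, \<open>w\<close> is congruent to \<open>p\<close>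
    modulo \<open>\<alpha>\<close>. Commuting \<open>\<alpha>\<close> past the idempotent and using
    \<open>shift\<close> gives \<open>\<alpha> w = \<alpha>^p v\<close>; comparing the parts of
    weight 1 shows that \<open>P 0 w\<close> is divisible by \<open>\<alpha>\<close>. Hence so is
    \<open>w\<close>, and then so is the unit \<open>p\<close>.\<close>
  define w where "w = (\<Oplus>\<^bsub>S\<^esub>z\<in>Z. P 0 (x z) \<otimes>\<^bsub>S\<^esub> y z)"
  have wS: "w \<in> carrier S"
    unfolding w_def using xy by (intro S.finsum_closed) (auto simp: P_closed)
  have "\<forall>z\<in>Z. \<exists>r. r \<in> carrier R \<and> P 0 (\<alpha> \<otimes>\<^bsub>S\<^esub> x z) = \<alpha> [^]\<^bsub>S\<^esub> p \<otimes>\<^bsub>S\<^esub> \<iota> r"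
    using shift[OF xy(1)] by blast
  from bchoice[OF this] obtain r where r: "\<And>z. z \<in> Z \<Longrightarrow> r z \<in> carrier R"
    "\<And>z. z \<in> Z \<Longrightarrow> P 0 (\<alpha> \<otimes>\<^bsub>S\<^esub> x z) = \<alpha> [^]\<^bsub>S\<^esub> p \<otimes>\<^bsub>S\<^esub> \<iota> (r z)"
    by blast
  define v where "v = (\<Oplus>\<^bsub>S\<^esub>z\<in>Z. \<iota> (r z) \<otimes>\<^bsub>S\<^esub> y z)"
  have vS: "v \<in> carrier S"
    unfolding v_def using xy r(1) by (intro S.finsum_closed) (auto simp: \<iota>_closed)
  have \<alpha>w: "\<alpha> \<otimes>\<^bsub>S\<^esub> w = \<alpha> [^]\<^bsub>S\<^esub> p \<otimes>\<^bsub>S\<^esub> v"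
  proof -
    have "\<alpha> \<otimes>\<^bsub>S\<^esub> w = (\<Oplus>\<^bsub>S\<^esub>z\<in>Z. \<alpha> \<otimes>\<^bsub>S\<^esub> (P 0 (x z) \<otimes>\<^bsub>S\<^esub> y z))"
      unfolding w_def using xy \<alpha>S Z(1) by (intro S.finsum_rdistr) (auto simp: P_closed)
    also have "\<dots> = (\<Oplus>\<^bsub>S\<^esub>z\<in>Z. P 0 (x z) \<otimes>\<^bsub>S\<^esub> (\<alpha> \<otimes>\<^bsub>S\<^esub> y z))"
      using xy \<alpha>S by (intro S.finsum_cong' refl funcsetI) (auto simp: P_closed S.m_lcomm)
    also have "\<dots> = (\<Oplus>\<^bsub>S\<^esub>z\<in>Z. P 0 (\<alpha> \<otimes>\<^bsub>S\<^esub> x z) \<otimes>\<^bsub>S\<^esub> y z)"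
      by (rule comm[OF bil \<alpha>S, symmetric])
    also have "\<dots> = (\<Oplus>\<^bsub>S\<^esub>z\<in>Z. \<alpha> [^]\<^bsub>S\<^esub> p \<otimes>\<^bsub>S\<^esub> (\<iota> (r z) \<otimes>\<^bsub>S\<^esub> y z))"
      using xy pow r by (intro S.finsum_cong' refl funcsetI) (auto simp: S.m_assoc \<iota>_closed)
    also have "\<dots> = \<alpha> [^]\<^bsub>S\<^esub> p \<otimes>\<^bsub>S\<^esub> v"
      unfolding v_def using xy pow r(1) Z(1)
      by (intro S.finsum_rdistr[symmetric]) (auto simp: \<iota>_closed)
    finally show ?thesis .
  qed
  obtain r0 where r0: "r0 \<in> carrier R" "P 0 w = \<iota> r0"
    using P_mem[OF wS, of 0] by (auto simp: M_0)
  obtain r1 where r1: "r1 \<in> carrier R" "P 1 v = r1 \<odot>\<^bsub>S\<^esub> \<alpha>"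
    using eigen[OF P_mem[OF vS] p_gt_1] \<alpha>S by auto
  obtain u where u: "u \<in> carrier R" "\<alpha> [^]\<^bsub>S\<^esub> p = \<iota> u"
    using power_mem_M[OF \<alpha>, of p] by (auto simp: M_p M_0)
  have "r0 \<odot>\<^bsub>S\<^esub> \<alpha> = \<alpha> \<otimes>\<^bsub>S\<^esub> P 0 w"
    using r0 \<alpha>S \<iota>_smult[OF r0(1) \<alpha>S] by (simp add: S.m_comm \<iota>_closed)
  also have "\<dots> = P (0 + 1) (\<alpha> \<otimes>\<^bsub>S\<^esub> w)"
    by (rule P_mult[OF \<alpha> wS, symmetric])
  \<comment> \<open>The index \<open>1 + p\<close> names the same projection as 1 and fits
    \<open>P_mult\<close> for the factor \<open>\<alpha>^p\<close> of weight
    \<open>p\<close>.\<close>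
  also have "\<dots> = P (1 + p * 1) (\<alpha> [^]\<^bsub>S\<^esub> p \<otimes>\<^bsub>S\<^esub> v)"
    unfolding \<alpha>w using pow vS by (subst P_cong) auto
  also have "\<dots> = \<alpha> [^]\<^bsub>S\<^esub> p \<otimes>\<^bsub>S\<^esub> P 1 v"
    using P_mult[OF power_mem_M[OF \<alpha>, of p] vS, of 1] by simp
  also have "\<dots> = (u \<otimes> r1) \<odot>\<^bsub>S\<^esub> \<alpha>"
    using u r1 \<alpha>S by (simp add: \<iota>_smult S.smult_assoc1)
  finally have "r0 = u \<otimes> r1"
    using r0 r1 u by (intro cancel) auto
  then have "P 0 w = \<alpha> [^]\<^bsub>S\<^esub> Suc (p - 1) \<otimes>\<^bsub>S\<^esub> \<iota> r1"
    unfolding p_ne using r0 r1 u by (simp add: \<iota>_mult)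
  then have P0w: "P 0 w = \<alpha> \<otimes>\<^bsub>S\<^esub> (\<alpha> [^]\<^bsub>S\<^esub> (p - 1) \<otimes>\<^bsub>S\<^esub> \<iota> r1)"
    using \<alpha>S pow r1 by (simp add: S.m_comm S.m_assoc \<iota>_closed S.m_lcomm)
  obtain t0 where t0: "t0 \<in> carrier S" "pR \<odot>\<^bsub>S\<^esub> w = P 0 w \<oplus>\<^bsub>S\<^esub> \<alpha> \<otimes>\<^bsub>S\<^esub> t0"
    using split[OF wS] by blast
  define w' where "w' = p_inv \<odot>\<^bsub>S\<^esub> (\<alpha> [^]\<^bsub>S\<^esub> (p - 1) \<otimes>\<^bsub>S\<^esub> \<iota> r1 \<oplus>\<^bsub>S\<^esub> t0)"
  have w'S: "w' \<in> carrier S"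
    unfolding w'_def using pow r1 t0 p_inv by (simp add: \<iota>_closed)
  have w': "w = \<alpha> \<otimes>\<^bsub>S\<^esub> w'"
  proof -
    have "pR \<odot>\<^bsub>S\<^esub> w = \<alpha> \<otimes>\<^bsub>S\<^esub> (\<alpha> [^]\<^bsub>S\<^esub> (p - 1) \<otimes>\<^bsub>S\<^esub> \<iota> r1 \<oplus>\<^bsub>S\<^esub> t0)"
      unfolding t0(2) P0w using t0(1) \<alpha>S pow r1 by (simp add: S.r_distr \<iota>_closed)
    then have "p_inv \<odot>\<^bsub>S\<^esub> (pR \<odot>\<^bsub>S\<^esub> w) = \<alpha> \<otimes>\<^bsub>S\<^esub> w'"
      unfolding w'_def using t0(1) \<alpha>S pow r1 p_inv(1) by (simp add: smult_right \<iota>_closed)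
    then show ?thesis
      using wS by (simp add: p_inv_smult)
  qed
  have "\<forall>z\<in>Z. \<exists>t. t \<in> carrier S \<and> pR \<odot>\<^bsub>S\<^esub> x z = P 0 (x z) \<oplus>\<^bsub>S\<^esub> \<alpha> \<otimes>\<^bsub>S\<^esub> t"
    using split[OF xy(1)] by blast
  from bchoice[OF this] obtain t where t: "\<And>z. z \<in> Z \<Longrightarrow> t z \<in> carrier S"
    "\<And>z. z \<in> Z \<Longrightarrow> pR \<odot>\<^bsub>S\<^esub> x z = P 0 (x z) \<oplus>\<^bsub>S\<^esub> \<alpha> \<otimes>\<^bsub>S\<^esub> t z"
    by blast
  define q where "q = (\<Oplus>\<^bsub>S\<^esub>z\<in>Z. t z \<otimes>\<^bsub>S\<^esub> y z)"
  have qS: "q \<in> carrier S"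
    unfolding q_def using t(1) xy by (intro S.finsum_closed) auto
  have "pR \<odot>\<^bsub>S\<^esub> \<one>\<^bsub>S\<^esub> = (\<Oplus>\<^bsub>S\<^esub>z\<in>Z. pR \<odot>\<^bsub>S\<^esub> (x z \<otimes>\<^bsub>S\<^esub> y z))"
    unfolding Z(4)[symmetric] using xy p_inv Z(1) by (intro S.finsum_smult_ldistr) auto
  also have "\<dots> = (\<Oplus>\<^bsub>S\<^esub>z\<in>Z. P 0 (x z) \<otimes>\<^bsub>S\<^esub> y z \<oplus>\<^bsub>S\<^esub> \<alpha> \<otimes>\<^bsub>S\<^esub> (t z \<otimes>\<^bsub>S\<^esub> y z))"
    using xy t \<alpha>S p_inv(3)
    by (intro S.finsum_cong' refl funcsetI)
      (simp_all add: S.smult_assoc2[symmetric] S.l_distr S.m_assoc P_closed)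
  also have "\<dots> = w \<oplus>\<^bsub>S\<^esub> (\<Oplus>\<^bsub>S\<^esub>z\<in>Z. \<alpha> \<otimes>\<^bsub>S\<^esub> (t z \<otimes>\<^bsub>S\<^esub> y z))"
    unfolding w_def using xy t \<alpha>S by (intro S.finsum_addf) (auto simp: P_closed)
  also have "(\<Oplus>\<^bsub>S\<^esub>z\<in>Z. \<alpha> \<otimes>\<^bsub>S\<^esub> (t z \<otimes>\<^bsub>S\<^esub> y z)) = \<alpha> \<otimes>\<^bsub>S\<^esub> q"
    unfolding q_def using xy t(1) \<alpha>S Z(1) by (intro S.finsum_rdistr[symmetric]) auto
  also have "w \<oplus>\<^bsub>S\<^esub> \<alpha> \<otimes>\<^bsub>S\<^esub> q = \<alpha> \<otimes>\<^bsub>S\<^esub> (w' \<oplus>\<^bsub>S\<^esub> q)"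
    using w' w'S qS \<alpha>S by (simp add: S.r_distr)
  finally have "p_inv \<odot>\<^bsub>S\<^esub> (pR \<odot>\<^bsub>S\<^esub> \<one>\<^bsub>S\<^esub>) = \<alpha> \<otimes>\<^bsub>S\<^esub> (p_inv \<odot>\<^bsub>S\<^esub> (w' \<oplus>\<^bsub>S\<^esub> q))"
    using p_inv(1) \<alpha>S w'S qS by (simp add: smult_right)
  then have "\<alpha> \<otimes>\<^bsub>S\<^esub> (p_inv \<odot>\<^bsub>S\<^esub> (w' \<oplus>\<^bsub>S\<^esub> q)) \<in> Units S"
    using p_inv_smult[OF S.one_closed] S.Units_one_closed by simp
  then show ?thesis
    by (rule S.Units_of_mult_Units) (use \<alpha>S p_inv(1) w'S qS in auto)
qed

lemma primitive_iff: "primitive_elt p R S G \<phi> \<chi> \<alpha> \<longleftrightarrow> \<alpha> \<in> char_space S G \<phi> \<chi> \<and> \<alpha> \<in> Units S"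
  using primitive_of_unit[of \<alpha>] unit_of_primitive[of \<alpha>]
  by (auto simp: primitive_elt_def M_1[unfolded One_nat_def])

section \<open>Galois extensions and the Picard group\<close>

text \<open>The single element \<open>\<alpha>\<close> separates all \<open>g\<close> and
  \<open>h\<close> at every \<open>e\<close>: the difference
  \<open>(\<chi> g - \<chi> h) \<alpha>\<close> is a unit for distinct \<open>g\<close> and
  \<open>h\<close>, so it kills no nonzero \<open>e\<close>. Faithfulness is the case
  \<open>e = 1\<close>.\<close>

lemma galois_of_unit:
  assumes \<alpha>: "\<alpha> \<in> M 1" "\<alpha> \<in> Units S"
  shows "galois_extension R S G \<phi>"
proof -
  have \<alpha>S: "\<alpha> \<in> carrier S"
    using \<alpha> by auto
  have sep: "\<exists>s\<in>carrier S. \<phi> g s \<otimes>\<^bsub>S\<^esub> e \<noteq> \<phi> h s \<otimes>\<^bsub>S\<^esub> e"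
    if gh: "g \<in> carrier G" "h \<in> carrier G" "g \<noteq> h" and e: "e \<in> carrier S" "e \<noteq> \<zero>\<^bsub>S\<^esub>" for g h e
  proof (rule ccontr)
    assume "\<not> ?thesis"
    then have "\<phi> g \<alpha> \<otimes>\<^bsub>S\<^esub> e = \<phi> h \<alpha> \<otimes>\<^bsub>S\<^esub> e"
      using \<alpha>S by blast
    then have "\<alpha> \<otimes>\<^bsub>S\<^esub> (\<chi> g \<odot>\<^bsub>S\<^esub> e) = \<alpha> \<otimes>\<^bsub>S\<^esub> (\<chi> h \<odot>\<^bsub>S\<^esub> e)"
      using \<alpha>(1) gh e \<alpha>S by (simp add: mem_M \<chi>_closed S.smult_assoc2 smult_right)
    then have eq: "\<chi> g \<odot>\<^bsub>S\<^esub> e = \<chi> h \<odot>\<^bsub>S\<^esub> e"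
      using \<alpha>(2) gh e \<chi>_closed S.Units_l_cancel by auto
    let ?z = "\<chi> (inv\<^bsub>G\<^esub> h) \<otimes> \<chi> g"
    have z: "?z = \<chi> (inv\<^bsub>G\<^esub> h \<otimes>\<^bsub>G\<^esub> g)"
      using gh by (simp add: \<chi>_mult)
    have "inv\<^bsub>G\<^esub> h \<otimes>\<^bsub>G\<^esub> g \<noteq> \<one>\<^bsub>G\<^esub>"
    proof
      assume *: "inv\<^bsub>G\<^esub> h \<otimes>\<^bsub>G\<^esub> g = \<one>\<^bsub>G\<^esub>"
      have "g = h \<otimes>\<^bsub>G\<^esub> (inv\<^bsub>G\<^esub> h \<otimes>\<^bsub>G\<^esub> g)"
        using gh by (simp add: G.m_assoc[symmetric])
      then show False
        using gh unfolding * by simp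
    qed
    then have unit: "\<one> \<ominus> ?z \<in> Units R"
      unfolding z using gh by (intro Units_one_minus \<chi>_mem \<chi>_neq_one) auto
    have "?z \<odot>\<^bsub>S\<^esub> e = \<chi> (inv\<^bsub>G\<^esub> h) \<odot>\<^bsub>S\<^esub> (\<chi> h \<odot>\<^bsub>S\<^esub> e)"
      using gh e by (simp add: S.smult_assoc1 \<chi>_closed eq)
    also have "\<dots> = e"
      using gh e by (simp add: S.smult_assoc1[symmetric] \<chi>_closed \<chi>_inv)
    finally have "(\<one> \<ominus> ?z) \<odot>\<^bsub>S\<^esub> e = \<zero>\<^bsub>S\<^esub>"
      using gh e by (simp add: a_minus_def S.smult_l_distr S.smult_l_minus \<chi>_closed S.r_neg)
    then have "(inv (\<one> \<ominus> ?z) \<otimes> (\<one> \<ominus> ?z)) \<odot>\<^bsub>S\<^esub> e = \<zero>\<^bsub>S\<^esub>"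
      using unit e S.R.Units_closed[OF unit] by (subst S.smult_assoc1) auto
    then show False
      using unit e by simp
  qed
  have "inj_on \<phi> (carrier G)"
  proof (rule inj_onI, rule ccontr)
    fix g h assume "g \<in> carrier G" "h \<in> carrier G" "\<phi> g = \<phi> h" "g \<noteq> h"
    then show False
      using sep[of g h "\<one>\<^bsub>S\<^esub>"] one_neq_zero_S by auto
  qed
  then have "faithful_action G (carrier S) \<phi>"
    using act.group_action_axioms by (simp add: faithful_action_def faithful_action_axioms_def)
  then show ?thesis
    using finite_G action invariants separable sep by (simp add: galois_extension_def)
qed

lemma galois_elements:
  assumes gal: "galois_extension R S G \<phi>"
  obtains Z :: "('s \<times> 's) set" and x y
  where "finite Z" "\<And>z. z \<in> Z \<Longrightarrow> x z \<in> carrier S" "\<And>z. z \<in> Z \<Longrightarrow> y z \<in> carrier S"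
    "\<And>g. g \<in> carrier G \<Longrightarrow>
      (\<Oplus>\<^bsub>S\<^esub>z\<in>Z. x z \<otimes>\<^bsub>S\<^esub> \<phi> g (y z)) = (if \<one>\<^bsub>G\<^esub> = g then \<one>\<^bsub>S\<^esub> else \<zero>\<^bsub>S\<^esub>)"
proof (rule separable_algebra_elements[OF separable])
  fix Z :: "('s \<times> 's) set" and x y
  assume Z: "finite Z" "x \<in> Z \<rightarrow> carrier S" "y \<in> Z \<rightarrow> carrier S"
    "(\<Oplus>\<^bsub>S\<^esub>z\<in>Z. x z \<otimes>\<^bsub>S\<^esub> y z) = \<one>\<^bsub>S\<^esub>"
    and comm: "\<And>\<beta> s. \<lbrakk>bilinear_map R S S S \<beta>; s \<in> carrier S\<rbrakk> \<Longrightarrow>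
      (\<Oplus>\<^bsub>S\<^esub>z\<in>Z. \<beta> (s \<otimes>\<^bsub>S\<^esub> x z) (y z)) = (\<Oplus>\<^bsub>S\<^esub>z\<in>Z. \<beta> (x z) (s \<otimes>\<^bsub>S\<^esub> y z))"
  have xy: "x z \<in> carrier S" "y z \<in> carrier S" if "z \<in> Z" for z
    using Z that by auto
  have "(\<Oplus>\<^bsub>S\<^esub>z\<in>Z. x z \<otimes>\<^bsub>S\<^esub> \<phi> g (y z)) = (if \<one>\<^bsub>G\<^esub> = g then \<one>\<^bsub>S\<^esub> else \<zero>\<^bsub>S\<^esub>)"
    if g: "g \<in> carrier G" for g
  proof (cases "g = \<one>\<^bsub>G\<^esub>")
    case True
    have "(\<Oplus>\<^bsub>S\<^esub>z\<in>Z. x z \<otimes>\<^bsub>S\<^esub> \<phi> g (y z)) = (\<Oplus>\<^bsub>S\<^esub>z\<in>Z. x z \<otimes>\<^bsub>S\<^esub> y z)"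
      using True xy by (intro S.finsum_cong' refl funcsetI) (simp_all add: \<phi>_id)
    then show ?thesis
      using True Z(4) by simp
  next
    case False
    \<comment> \<open>Under this map a factor \<open>s\<close> moved from the first to the second
      entry of the separability idempotent becomes \<open>\<phi> g s\<close>.\<close>
    have bil: "bilinear_map R S S S (\<lambda>a b. a \<otimes>\<^bsub>S\<^esub> \<phi> g b)"
      using g by (auto simp: bilinear_map_def mod_hom_def \<phi>_closed \<phi>_add \<phi>_smult S.l_distr S.r_distr
          S.smult_assoc2 smult_right)
    define e where "e = (\<Oplus>\<^bsub>S\<^esub>z\<in>Z. x z \<otimes>\<^bsub>S\<^esub> \<phi> g (y z))"
    have eS: "e \<in> carrier S"
      unfolding e_def using xy g by (intro S.finsum_closed funcsetI) (auto simp: \<phi>_closed)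
    have se: "s \<otimes>\<^bsub>S\<^esub> e = \<phi> g s \<otimes>\<^bsub>S\<^esub> e" if s: "s \<in> carrier S" for s
    proof -
      have "s \<otimes>\<^bsub>S\<^esub> e = (\<Oplus>\<^bsub>S\<^esub>z\<in>Z. s \<otimes>\<^bsub>S\<^esub> (x z \<otimes>\<^bsub>S\<^esub> \<phi> g (y z)))"
        unfolding e_def using xy g s Z(1)
        by (intro S.finsum_rdistr funcsetI) (auto simp: \<phi>_closed)
      also have "\<dots> = (\<Oplus>\<^bsub>S\<^esub>z\<in>Z. (s \<otimes>\<^bsub>S\<^esub> x z) \<otimes>\<^bsub>S\<^esub> \<phi> g (y z))"
        using xy g s by (intro S.finsum_cong' refl funcsetI) (simp_all add: \<phi>_closed S.m_assoc)
      also have "\<dots> = (\<Oplus>\<^bsub>S\<^esub>z\<in>Z. x z \<otimes>\<^bsub>S\<^esub> \<phi> g (s \<otimes>\<^bsub>S\<^esub> y z))"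
        by (rule comm[OF bil s])
      also have "\<dots> = (\<Oplus>\<^bsub>S\<^esub>z\<in>Z. \<phi> g s \<otimes>\<^bsub>S\<^esub> (x z \<otimes>\<^bsub>S\<^esub> \<phi> g (y z)))"
        using xy g s
        by (intro S.finsum_cong' refl funcsetI) (simp_all add: \<phi>_closed \<phi>_mult S.m_lcomm)
      also have "\<dots> = \<phi> g s \<otimes>\<^bsub>S\<^esub> e"
        unfolding e_def using xy g s Z(1)
        by (intro S.finsum_rdistr[symmetric] funcsetI) (auto simp: \<phi>_closed)
      finally show ?thesis .
    qed
    \<comment> \<open>Multiplied by \<open>e\<close>, each \<open>\<phi> g (y z)\<close> may be
      replaced by \<open>y z\<close>, and the products \<open>x z y z\<close> sum to 1.\<close>
    have "e \<otimes>\<^bsub>S\<^esub> e = (\<Oplus>\<^bsub>S\<^esub>z\<in>Z. (x z \<otimes>\<^bsub>S\<^esub> \<phi> g (y z)) \<otimes>\<^bsub>S\<^esub> e)"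
      by (subst (1) e_def, rule S.finsum_ldistr) (use xy g eS Z(1) in \<open>auto simp: \<phi>_closed\<close>)
    also have "\<dots> = (\<Oplus>\<^bsub>S\<^esub>z\<in>Z. (x z \<otimes>\<^bsub>S\<^esub> y z) \<otimes>\<^bsub>S\<^esub> e)"
      using xy g eS
      by (intro S.finsum_cong' refl funcsetI) (simp_all add: \<phi>_closed S.m_assoc se[symmetric])
    also have "\<dots> = (\<Oplus>\<^bsub>S\<^esub>z\<in>Z. x z \<otimes>\<^bsub>S\<^esub> y z) \<otimes>\<^bsub>S\<^esub> e"
      using xy eS Z(1) by (intro S.finsum_ldistr[symmetric] funcsetI) auto
    finally have idem: "e \<otimes>\<^bsub>S\<^esub> e = e"
      using Z(4) eS by simp
    have "e = \<zero>\<^bsub>S\<^esub>"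
    proof (rule ccontr)
      assume "e \<noteq> \<zero>\<^bsub>S\<^esub>"
      have "\<forall>g\<in>carrier G. \<forall>h\<in>carrier G. g \<noteq> h \<longrightarrow>
          (\<forall>e\<in>carrier S. e \<otimes>\<^bsub>S\<^esub> e = e \<and> e \<noteq> \<zero>\<^bsub>S\<^esub> \<longrightarrow>
            (\<exists>s\<in>carrier S. \<phi> g s \<otimes>\<^bsub>S\<^esub> e \<noteq> \<phi> h s \<otimes>\<^bsub>S\<^esub> e))"
        using gal by (simp add: galois_extension_def)
      from this[rule_format, OF G.one_closed g False[symmetric] eS conjI[OF idem \<open>e \<noteq> \<zero>\<^bsub>S\<^esub>\<close>]]
      obtain s where "s \<in> carrier S" "\<phi> \<one>\<^bsub>G\<^esub> s \<otimes>\<^bsub>S\<^esub> e \<noteq> \<phi> g s \<otimes>\<^bsub>S\<^esub> e"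
        by blast
      then show False
        using se by (simp add: \<phi>_id)
    qed
    then show ?thesis
      using False by (simp add: e_def)
  qed
  from that[OF Z(1) xy this] show thesis .
qed

text \<open>Expanding \<open>P k\<close> and exchanging the sums leaves only the neutral element of
  \<open>G\<close>. For \<open>k = 0\<close> the functionals \<open>P 0 (y z s)\<close> take values
  in \<open>R\<close>, so this is a finite dual basis of \<open>S\<close> over
  \<open>R\<close>.\<close>

lemma galois_dual_basis:
  assumes gal: "galois_extension R S G \<phi>"
  obtains Z :: "('s \<times> 's) set" and x y
  where "finite Z" "\<And>z. z \<in> Z \<Longrightarrow> x z \<in> carrier S" "\<And>z. z \<in> Z \<Longrightarrow> y z \<in> carrier S"
    "\<And>k s. s \<in> carrier S \<Longrightarrow> (\<Oplus>\<^bsub>S\<^esub>z\<in>Z. x z \<otimes>\<^bsub>S\<^esub> P k (y z \<otimes>\<^bsub>S\<^esub> s)) = s"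
proof (rule galois_elements[OF gal])
  fix Z :: "('s \<times> 's) set" and x y
  assume Z: "finite Z" and xy: "\<And>z. z \<in> Z \<Longrightarrow> x z \<in> carrier S" "\<And>z. z \<in> Z \<Longrightarrow> y z \<in> carrier S"
    and dual: "\<And>g. g \<in> carrier G \<Longrightarrow>
      (\<Oplus>\<^bsub>S\<^esub>z\<in>Z. x z \<otimes>\<^bsub>S\<^esub> \<phi> g (y z)) = (if \<one>\<^bsub>G\<^esub> = g then \<one>\<^bsub>S\<^esub> else \<zero>\<^bsub>S\<^esub>)"
  have "(\<Oplus>\<^bsub>S\<^esub>z\<in>Z. x z \<otimes>\<^bsub>S\<^esub> P k (y z \<otimes>\<^bsub>S\<^esub> s)) = s" if s: "s \<in> carrier S" for k s
  proof -
    let ?c = "\<lambda>g. (\<chi> (inv\<^bsub>G\<^esub> g) [^] k) \<odot>\<^bsub>S\<^esub> \<phi> g s"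
    have c: "?c g \<in> carrier S" if "g \<in> carrier G" for g
      using P_term_closed[OF that s] .
    have "(\<Oplus>\<^bsub>S\<^esub>z\<in>Z. x z \<otimes>\<^bsub>S\<^esub> P k (y z \<otimes>\<^bsub>S\<^esub> s)) =
        (\<Oplus>\<^bsub>S\<^esub>z\<in>Z. \<Oplus>\<^bsub>S\<^esub>g\<in>carrier G. (x z \<otimes>\<^bsub>S\<^esub> \<phi> g (y z)) \<otimes>\<^bsub>S\<^esub> ?c g)"
    proof (intro S.finsum_cong' refl funcsetI)
      fix z assume z: "z \<in> Z"
      have "x z \<otimes>\<^bsub>S\<^esub> P k (y z \<otimes>\<^bsub>S\<^esub> s) =
          (\<Oplus>\<^bsub>S\<^esub>g\<in>carrier G. x z \<otimes>\<^bsub>S\<^esub> ((\<chi> (inv\<^bsub>G\<^esub> g) [^] k) \<odot>\<^bsub>S\<^esub> \<phi> g (y z \<otimes>\<^bsub>S\<^esub> s)))"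
        unfolding P_def using z xy s finite_G
        by (intro S.finsum_rdistr funcsetI P_term_closed) auto
      also have "\<dots> = (\<Oplus>\<^bsub>S\<^esub>g\<in>carrier G. (x z \<otimes>\<^bsub>S\<^esub> \<phi> g (y z)) \<otimes>\<^bsub>S\<^esub> ?c g)"
        using z xy s c
        by (intro S.finsum_cong' refl funcsetI)
          (simp_all add: \<phi>_mult \<phi>_closed smult_right \<chi>_closed S.m_assoc)
      finally show "x z \<otimes>\<^bsub>S\<^esub> P k (y z \<otimes>\<^bsub>S\<^esub> s) =
          (\<Oplus>\<^bsub>S\<^esub>g\<in>carrier G. (x z \<otimes>\<^bsub>S\<^esub> \<phi> g (y z)) \<otimes>\<^bsub>S\<^esub> ?c g)" .
    qed (use xy c in \<open>auto intro!: S.finsum_closed simp: \<phi>_closed\<close>)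
    also have "\<dots> = (\<Oplus>\<^bsub>S\<^esub>g\<in>carrier G. \<Oplus>\<^bsub>S\<^esub>z\<in>Z. (x z \<otimes>\<^bsub>S\<^esub> \<phi> g (y z)) \<otimes>\<^bsub>S\<^esub> ?c g)"
      using Z finite_G xy c by (intro S.finsum_swap) (simp_all add: \<phi>_closed)
    also have "\<dots> = (\<Oplus>\<^bsub>S\<^esub>g\<in>carrier G. if \<one>\<^bsub>G\<^esub> = g then ?c g else \<zero>\<^bsub>S\<^esub>)"
    proof (intro S.finsum_cong' refl funcsetI)
      fix g assume g: "g \<in> carrier G"
      have "(\<Oplus>\<^bsub>S\<^esub>z\<in>Z. (x z \<otimes>\<^bsub>S\<^esub> \<phi> g (y z)) \<otimes>\<^bsub>S\<^esub> ?c g) =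
          (\<Oplus>\<^bsub>S\<^esub>z\<in>Z. x z \<otimes>\<^bsub>S\<^esub> \<phi> g (y z)) \<otimes>\<^bsub>S\<^esub> ?c g"
        using Z xy c[OF g] g by (intro S.finsum_ldistr[symmetric] funcsetI) (simp_all add: \<phi>_closed)
      then show "(\<Oplus>\<^bsub>S\<^esub>z\<in>Z. (x z \<otimes>\<^bsub>S\<^esub> \<phi> g (y z)) \<otimes>\<^bsub>S\<^esub> ?c g) =
          (if \<one>\<^bsub>G\<^esub> = g then ?c g else \<zero>\<^bsub>S\<^esub>)"
        using dual[OF g] c[OF g] by auto
    qed (use c in simp)
    also have "\<dots> = ?c \<one>\<^bsub>G\<^esub>"
      using finite_G c by (intro S.add.finprod_singleton funcsetI) simp_all
    also have "\<dots> = s"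
      using s by (simp add: \<phi>_id \<chi>_one)
    finally show ?thesis .
  qed
  from that[OF Z xy this] show thesis .
qed

text \<open>The dual basis identity for \<open>s = 1\<close> is projected to weight
  \<open>j + l = p\<close>. This turns \<open>x z\<close> into \<open>P j (x z)\<close> and
  multiplies the right side by \<open>p\<close>, which \<open>p_inv\<close> removes.\<close>

lemma galois_partition_of_unity:
  assumes gal: "galois_extension R S G \<phi>" and jl: "j + l = p"
  obtains Z :: "('s \<times> 's) set" and a b
  where "finite Z" "\<And>z. z \<in> Z \<Longrightarrow> a z \<in> M j" "\<And>z. z \<in> Z \<Longrightarrow> b z \<in> M l"
    "(\<Oplus>\<^bsub>S\<^esub>z\<in>Z. a z \<otimes>\<^bsub>S\<^esub> b z) = \<one>\<^bsub>S\<^esub>"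
proof (rule galois_dual_basis[OF gal])
  fix Z :: "('s \<times> 's) set" and x y
  assume Z: "finite Z" and xy: "\<And>z. z \<in> Z \<Longrightarrow> x z \<in> carrier S" "\<And>z. z \<in> Z \<Longrightarrow> y z \<in> carrier S"
    and dual: "\<And>k s. s \<in> carrier S \<Longrightarrow> (\<Oplus>\<^bsub>S\<^esub>z\<in>Z. x z \<otimes>\<^bsub>S\<^esub> P k (y z \<otimes>\<^bsub>S\<^esub> s)) = s"
  have b: "P l (y z) \<in> M l" "P l (y z) \<in> carrier S" if "z \<in> Z" for z
    using P_mem P_closed xy that by auto
  have "(\<Oplus>\<^bsub>S\<^esub>z\<in>Z. P j (x z) \<otimes>\<^bsub>S\<^esub> P l (y z)) = (\<Oplus>\<^bsub>S\<^esub>z\<in>Z. P (j + l) (x z \<otimes>\<^bsub>S\<^esub> P l (y z)))"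
    using xy b P_mult[OF b(1) xy(1), of _ _ j]
    by (intro S.finsum_cong' refl funcsetI) (simp_all add: P_closed S.m_comm)
  also have "\<dots> = P (j + l) (\<Oplus>\<^bsub>S\<^esub>z\<in>Z. x z \<otimes>\<^bsub>S\<^esub> P l (y z))"
    using xy b by (intro mod_hom_finsum[OF S.module S.module P_mod_hom, symmetric] funcsetI) auto
  also have "(\<Oplus>\<^bsub>S\<^esub>z\<in>Z. x z \<otimes>\<^bsub>S\<^esub> P l (y z)) = \<one>\<^bsub>S\<^esub>"
    using dual[of "\<one>\<^bsub>S\<^esub>" l] S.finsum_cong'[OF refl, of "\<lambda>z. x z \<otimes>\<^bsub>S\<^esub> P l (y z)" Z
        "\<lambda>z. x z \<otimes>\<^bsub>S\<^esub> P l (y z \<otimes>\<^bsub>S\<^esub> \<one>\<^bsub>S\<^esub>)"] xy b by auto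
  also have "P (j + l) \<one>\<^bsub>S\<^esub> = pR \<odot>\<^bsub>S\<^esub> \<one>\<^bsub>S\<^esub>"
    using P_cong[of "\<one>\<^bsub>S\<^esub>" 0 1] P_on_M[OF M_one, of 0] p_gt_1 jl by simp
  finally have sum: "(\<Oplus>\<^bsub>S\<^esub>z\<in>Z. P j (x z) \<otimes>\<^bsub>S\<^esub> P l (y z)) = pR \<odot>\<^bsub>S\<^esub> \<one>\<^bsub>S\<^esub>" .
  have "(\<Oplus>\<^bsub>S\<^esub>z\<in>Z. (p_inv \<odot>\<^bsub>S\<^esub> P j (x z)) \<otimes>\<^bsub>S\<^esub> P l (y z)) =
      (\<Oplus>\<^bsub>S\<^esub>z\<in>Z. p_inv \<odot>\<^bsub>S\<^esub> (P j (x z) \<otimes>\<^bsub>S\<^esub> P l (y z)))"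
    using xy b p_inv by (intro S.finsum_cong' refl funcsetI) (simp_all add: P_closed S.smult_assoc2)
  also have "\<dots> = p_inv \<odot>\<^bsub>S\<^esub> (\<Oplus>\<^bsub>S\<^esub>z\<in>Z. P j (x z) \<otimes>\<^bsub>S\<^esub> P l (y z))"
    using Z xy b p_inv by (intro S.finsum_smult_ldistr[symmetric] funcsetI) (simp_all add: P_closed)
  also have "\<dots> = \<one>\<^bsub>S\<^esub>"
    unfolding sum by (simp add: p_inv_smult)
  finally have one: "(\<Oplus>\<^bsub>S\<^esub>z\<in>Z. (p_inv \<odot>\<^bsub>S\<^esub> P j (x z)) \<otimes>\<^bsub>S\<^esub> P l (y z)) = \<one>\<^bsub>S\<^esub>" .
  have a: "p_inv \<odot>\<^bsub>S\<^esub> P j (x z) \<in> M j" if "z \<in> Z" for z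
    using M_smult[OF p_inv(1) P_mem[OF xy(1)[OF that]]] .
  from that[OF Z a b(1) one] show thesis .
qed

text \<open>The finitely many coordinates \<open>P 0 (y z s)\<close> lie in \<open>R\<close> and
  determine \<open>s\<close>. Numbering them embeds \<open>S\<close> in the element type of
  \<open>Pic\<close>.\<close>

lemma galois_embedding:
  assumes gal: "galois_extension R S G \<phi>"
  obtains f :: "'s \<Rightarrow> nat \<Rightarrow> 'a" where "inj_on f (carrier S)"
proof (rule galois_dual_basis[OF gal])
  fix Z :: "('s \<times> 's) set" and x y
  assume Z: "finite Z" and xy: "\<And>z. z \<in> Z \<Longrightarrow> x z \<in> carrier S" "\<And>z. z \<in> Z \<Longrightarrow> y z \<in> carrier S"
    and dual: "\<And>k s. s \<in> carrier S \<Longrightarrow> (\<Oplus>\<^bsub>S\<^esub>z\<in>Z. x z \<otimes>\<^bsub>S\<^esub> P k (y z \<otimes>\<^bsub>S\<^esub> s)) = s"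
  obtain e :: "'s \<times> 's \<Rightarrow> nat" where e: "inj_on e Z"
    using finite_imp_inj_to_nat_seg[OF Z] by blast
  \<comment> \<open>At indices outside the image of \<open>e\<close> the value is arbitrary;
    injectivity consults only the indices \<open>e z\<close>.\<close>
  define f where "f = (\<lambda>s i. inv_into (carrier R) \<iota> (P 0 (y (inv_into Z e i) \<otimes>\<^bsub>S\<^esub> s)))"
  have f: "\<iota> (f s (e z)) = P 0 (y z \<otimes>\<^bsub>S\<^esub> s)" if "z \<in> Z" "s \<in> carrier S" for z s
    using P_mem[of "y z \<otimes>\<^bsub>S\<^esub> s" 0] that xy(2) e by (simp add: f_def M_0 f_inv_into_f)
  have "inj_on f (carrier S)"
  proof (rule inj_onI)
    fix s t assume st: "s \<in> carrier S" "t \<in> carrier S" "f s = f t"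
    have eq: "P 0 (y z \<otimes>\<^bsub>S\<^esub> s) = P 0 (y z \<otimes>\<^bsub>S\<^esub> t)" if "z \<in> Z" for z
      using f[OF that st(1)] f[OF that st(2)] st(3) by simp
    have "s = (\<Oplus>\<^bsub>S\<^esub>z\<in>Z. x z \<otimes>\<^bsub>S\<^esub> P 0 (y z \<otimes>\<^bsub>S\<^esub> s))"
      using dual[OF st(1)] by simp
    also have "\<dots> = (\<Oplus>\<^bsub>S\<^esub>z\<in>Z. x z \<otimes>\<^bsub>S\<^esub> P 0 (y z \<otimes>\<^bsub>S\<^esub> t))"
      using eq xy st(2) by (intro S.finsum_cong' refl funcsetI) (simp_all add: P_closed)
    also have "\<dots> = t"
      by (rule dual[OF st(2)])
    finally show "s = t" .
  qed
  then show thesis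
    by (rule that)
qed

abbreviation Q where "Q k \<equiv> S\<lparr>carrier := M k\<rparr>"

lemma regular_iso_M_0: "\<iota> \<in> mod_iso R (regular_module R) (Q 0)"
proof -
  have "\<iota> \<in> mod_hom R (regular_module R) (Q 0)"
    by (auto simp: mod_hom_def regular_module_def M_0 ring_hom_add[OF \<iota>_hom] \<iota>_mult \<iota>_smult \<iota>_closed)
  moreover have "bij_betw \<iota> (carrier (regular_module R)) (carrier (Q 0))"
    using \<iota>_inj by (auto simp: bij_betw_def regular_module_def M_0 inj_on_def)
  ultimately show ?thesis
    by (simp add: mod_iso_def)
qed

text \<open>Multiplication is inverted by sending \<open>q\<close> to the sum of
  \<open>b z q\<close> tensor \<open>a z\<close>, where the products \<open>a z b z\<close> sum to
  1. The factors are arbitrary modules isomorphic to eigenspaces because the product in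
  \<open>Pic\<close> runs over all representatives of two classes.\<close>

lemma tensor_M_iso:
  fixes V :: "('a, 'v, 'x) module_scheme" and W :: "('a, 'w, 'y) module_scheme"
  assumes gal: "galois_extension R S G \<phi>" and jl: "j + l = p"
    and V: "module R V" "f \<in> mod_iso R V (Q k)"
    and W: "module R W" "h \<in> mod_iso R W (Q j)"
  shows "mod_iso R (tensor R V W) (Q (k + j)) \<noteq> {}"
proof (rule galois_partition_of_unity[OF gal jl])
  fix Z :: "('s \<times> 's) set" and a b
  assume Z: "finite Z" and a: "\<And>z. z \<in> Z \<Longrightarrow> a z \<in> M j" and b: "\<And>z. z \<in> Z \<Longrightarrow> b z \<in> M l"
    and one: "(\<Oplus>\<^bsub>S\<^esub>z\<in>Z. a z \<otimes>\<^bsub>S\<^esub> b z) = \<one>\<^bsub>S\<^esub>"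
  interpret VW: module_pair R V W
    using V(1) W(1) by (simp add: module_pair_def)
  let ?f' = "inv_into (carrier V) f" and ?h' = "inv_into (carrier W) h"
  note fD = mod_homD[of f R V "Q k"] and hD = mod_homD[of h R W "Q j"]
  have f: "f \<in> mod_hom R V (Q k)" "bij_betw f (carrier V) (M k)"
    and h: "h \<in> mod_hom R W (Q j)" "bij_betw h (carrier W) (M j)"
    using V(2) W(2) by (auto simp: mod_iso_def)
  have f': "?f' \<in> mod_hom R (Q k) V" and h': "?h' \<in> mod_hom R (Q j) W"
    using mod_iso_inv_into[OF V] mod_iso_inv_into[OF W] by (auto simp: mod_iso_def)
  have fM: "f v \<in> M k" "?f' (f v) = v" if "v \<in> carrier V" for v
    using that f bij_betwE[OF f(2)] by (auto simp: bij_betw_def)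
  have f'M: "?f' x \<in> carrier V" "f (?f' x) = x" if "x \<in> M k" for x
    using that mod_homD(1)[OF f', of x] bij_betw_inv_into_right[OF f(2)] by auto
  have hM: "h w \<in> M j" if "w \<in> carrier W" for w
    using that bij_betwE[OF h(2)] by auto
  have h'M: "?h' x \<in> carrier W" "h (?h' x) = x" if "x \<in> M j" for x
    using that mod_homD(1)[OF h', of x] bij_betw_inv_into_right[OF h(2)] by auto
  have a_S: "a z \<in> carrier S" and b_S: "b z \<in> carrier S" if "z \<in> Z" for z
    using M_closed[OF a[OF that]] M_closed[OF b[OF that]] .
  have sum: "(\<Oplus>\<^bsub>S\<^esub>z\<in>Z. b z \<otimes>\<^bsub>S\<^esub> q \<otimes>\<^bsub>S\<^esub> a z) = q" if q: "q \<in> carrier S" for q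
  proof -
    have "(\<Oplus>\<^bsub>S\<^esub>z\<in>Z. b z \<otimes>\<^bsub>S\<^esub> q \<otimes>\<^bsub>S\<^esub> a z) = (\<Oplus>\<^bsub>S\<^esub>z\<in>Z. a z \<otimes>\<^bsub>S\<^esub> b z \<otimes>\<^bsub>S\<^esub> q)"
      using a_S b_S q by (intro S.finsum_cong' refl funcsetI) (simp_all add: S.m_ac)
    also have "\<dots> = (\<Oplus>\<^bsub>S\<^esub>z\<in>Z. a z \<otimes>\<^bsub>S\<^esub> b z) \<otimes>\<^bsub>S\<^esub> q"
      using a_S b_S q Z by (intro S.finsum_ldistr[symmetric] funcsetI) auto
    finally show ?thesis
      using one q by simp
  qed
  define \<beta> where "\<beta> = (\<lambda>v w. f v \<otimes>\<^bsub>S\<^esub> h w)"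
  define c where "c = (\<lambda>z q. ?f' (b z \<otimes>\<^bsub>S\<^esub> q))"
  \<comment> \<open>\<open>b z\<close> and \<open>h w\<close> have complementary weights
    \<open>l\<close> and \<open>j\<close>, so their product is a scalar from \<open>R\<close>; this
    is the scalar that \<open>tensor_iso\<close> moves across the tensor sign.\<close>
  define r where "r = (\<lambda>z w. inv_into (carrier R) \<iota> (b z \<otimes>\<^bsub>S\<^esub> h w))"
  have r: "r z w \<in> carrier R" "\<iota> (r z w) = b z \<otimes>\<^bsub>S\<^esub> h w" if "z \<in> Z" "w \<in> carrier W" for z w
  proof -
    have "b z \<otimes>\<^bsub>S\<^esub> h w \<in> M (l + j)"
      using b hM that by (intro M_mult)
    then have "b z \<otimes>\<^bsub>S\<^esub> h w \<in> \<iota> ` carrier R"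
      using jl by (simp add: add.commute M_p M_0)
    then show "r z w \<in> carrier R" "\<iota> (r z w) = b z \<otimes>\<^bsub>S\<^esub> h w"
      unfolding r_def by (rule inv_into_into, rule f_inv_into_f)
  qed
  have bq: "b z \<otimes>\<^bsub>S\<^esub> q \<in> M k" if "z \<in> Z" "q \<in> M (k + j)" for z q
  proof -
    have "b z \<otimes>\<^bsub>S\<^esub> q \<in> M (l + (k + j))"
      using b that by (intro M_mult)
    also have "l + (k + j) = k + p"
      using jl by simp
    finally show ?thesis
      by (simp add: M_add_p)
  qed
  have \<beta>M: "\<beta> v w \<in> M (k + j)" if "v \<in> carrier V" "w \<in> carrier W" for v w
    unfolding \<beta>_def using that fM hM by (intro M_mult)
  have "bilinear_map R V W (Q (k + j)) \<beta>"
    using \<beta>M fM(1)[THEN M_closed] hM[THEN M_closed] fD[OF f(1)] hD[OF h(1)]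
    by (auto simp: bilinear_map_def mod_hom_def \<beta>_def S.l_distr S.r_distr S.smult_assoc2 smult_right)
  moreover have "c z \<in> mod_hom R (Q (k + j)) V" if z: "z \<in> Z" for z
  proof -
    have "(\<lambda>q. b z \<otimes>\<^bsub>S\<^esub> q) \<in> mod_hom R (Q (k + j)) (Q k)"
      using bq[OF z] b_S[OF z] M_closed
      by (auto simp: mod_hom_def S.r_distr smult_right)
    from mod_hom_comp[OF this f'] show ?thesis
      by (simp add: c_def)
  qed
  moreover have "c z (\<beta> v w) = r z w \<odot>\<^bsub>V\<^esub> v" if z: "z \<in> Z" and vw: "v \<in> carrier V" "w \<in> carrier W" for z v w
  proof -
    have "b z \<otimes>\<^bsub>S\<^esub> \<beta> v w = \<iota> (r z w) \<otimes>\<^bsub>S\<^esub> f v"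
      unfolding r(2)[OF z vw(2)] \<beta>_def
      using b_S[OF z] fM(1)[OF vw(1), THEN M_closed] hM[OF vw(2), THEN M_closed]
      by (simp add: S.m_ac)
    also have "\<dots> = f (r z w \<odot>\<^bsub>V\<^esub> v)"
      using r(1)[OF z vw(2)] vw fM(1)[OF vw(1), THEN M_closed] fD(3)[OF f(1)]
      by (simp add: \<iota>_smult)
    finally show ?thesis
      using fM(2) r(1)[OF z vw(2)] vw by (simp add: c_def)
  qed
  moreover have "(\<Oplus>\<^bsub>W\<^esub>z\<in>Z. r z w \<odot>\<^bsub>W\<^esub> ?h' (a z)) = w" if w: "w \<in> carrier W" for w
  proof -
    have closed: "r z w \<odot>\<^bsub>W\<^esub> ?h' (a z) \<in> carrier W" if "z \<in> Z" for z
      using r(1)[OF that w] h'M(1)[OF a[OF that]] by simp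
    have eq: "h (r z w \<odot>\<^bsub>W\<^esub> ?h' (a z)) = b z \<otimes>\<^bsub>S\<^esub> h w \<otimes>\<^bsub>S\<^esub> a z" if "z \<in> Z" for z
      using hD(3)[OF h(1) r(1)[OF that w] h'M(1)[OF a[OF that]]] h'M(2)[OF a[OF that]]
        \<iota>_smult[OF r(1)[OF that w] a_S[OF that]] r(2)[OF that w] by simp
    have "h (\<Oplus>\<^bsub>W\<^esub>z\<in>Z. r z w \<odot>\<^bsub>W\<^esub> ?h' (a z)) = (\<Oplus>\<^bsub>Q j\<^esub>z\<in>Z. h (r z w \<odot>\<^bsub>W\<^esub> ?h' (a z)))"
      by (intro mod_hom_finsum[OF W(1) M_module h(1)] funcsetI closed)
    also have "\<dots> = (\<Oplus>\<^bsub>S\<^esub>z\<in>Z. h (r z w \<odot>\<^bsub>W\<^esub> ?h' (a z)))"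
      by (intro S.finsum_submodule[OF M_submodule] funcsetI hM closed)
    also have "\<dots> = (\<Oplus>\<^bsub>S\<^esub>z\<in>Z. b z \<otimes>\<^bsub>S\<^esub> h w \<otimes>\<^bsub>S\<^esub> a z)"
      using a_S b_S hM[OF w, THEN M_closed] by (intro S.finsum_cong' refl funcsetI eq) auto
    also have "\<dots> = h w"
      by (rule sum[OF M_closed[OF hM[OF w]]])
    finally have "h (\<Oplus>\<^bsub>W\<^esub>z\<in>Z. r z w \<odot>\<^bsub>W\<^esub> ?h' (a z)) = h w" .
    then show ?thesis
      by (rule inj_onD[OF bij_betw_imp_inj_on[OF h(2)]])
        (use w closed in \<open>auto intro!: VW.N.M.finsum_closed\<close>)
  qed
  moreover have "(\<Oplus>\<^bsub>Q (k + j)\<^esub>z\<in>Z. \<beta> (c z q) (?h' (a z))) = q" if q: "q \<in> M (k + j)" for q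
  proof -
    have eq: "\<beta> (c z q) (?h' (a z)) = b z \<otimes>\<^bsub>S\<^esub> q \<otimes>\<^bsub>S\<^esub> a z" if "z \<in> Z" for z
      using f'M(2)[OF bq[OF that q]] h'M(2)[OF a[OF that]] by (simp add: \<beta>_def c_def)
    have "(\<Oplus>\<^bsub>Q (k + j)\<^esub>z\<in>Z. \<beta> (c z q) (?h' (a z))) = (\<Oplus>\<^bsub>S\<^esub>z\<in>Z. \<beta> (c z q) (?h' (a z)))"
      unfolding c_def
      by (intro S.finsum_submodule[OF M_submodule] funcsetI \<beta>M f'M(1)[OF bq[OF _ q]] h'M(1)[OF a])
    also have "\<dots> = (\<Oplus>\<^bsub>S\<^esub>z\<in>Z. b z \<otimes>\<^bsub>S\<^esub> q \<otimes>\<^bsub>S\<^esub> a z)"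
      using a_S b_S M_closed[OF q] by (intro S.finsum_cong' refl funcsetI eq) auto
    also have "\<dots> = q"
      by (rule sum[OF M_closed[OF q]])
    finally show ?thesis .
  qed
  ultimately show ?thesis
    using h'M(1)[OF a] r(1)
    by (intro VW.tensor_iso[OF M_module[of "k + j"], of \<beta> Z "\<lambda>z. ?h' (a z)" c r]) auto
qed

text \<open>The powers of the class of \<open>M 1\<close> are computed by induction as the classes
  of \<open>M n\<close>. At \<open>n = p\<close> the class is that of \<open>M 0\<close>, a copy of
  \<open>R\<close>, and the torsion hypothesis applies.\<close>

lemma M_regular:
  assumes gal: "galois_extension R S G \<phi>"
    and pic: "torsion_subgroup (Pic R) p = {\<one>\<^bsub>Pic R\<^esub>}"
  shows "mod_iso R (regular_module R) (Q 1) \<noteq> {}"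
proof -
  obtain \<epsilon> :: "'s \<Rightarrow> nat \<Rightarrow> 'a" where \<epsilon>: "inj_on \<epsilon> (carrier S)"
    by (rule galois_embedding[OF gal])
  define L where "L = (\<lambda>k. transport_module \<epsilon> (Q k))"
  have L: "module R (L k)" "\<epsilon> \<in> mod_iso R (Q k) (L k)" for k
    using transport_module[OF M_module, of \<epsilon> k] inj_on_subset[OF \<epsilon>, of "M k"] M_closed
    by (auto simp: L_def)
  define \<delta> where "\<delta> = (\<lambda>k. inv_into (M k) \<epsilon>)"
  have \<delta>: "\<delta> k \<in> mod_iso R (L k) (Q k)" for k
    using mod_iso_inv_into[OF M_module L(2)] by (simp add: \<delta>_def)
  have L_class: "L k \<in> iso_class R (Q k)" for k
    using L(1) \<delta> by (auto simp: iso_class_def)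
  have regular: "module R (regular_module R)"
    by (rule S.R.regular_module)
  have one: "\<one>\<^bsub>Pic R\<^esub> = iso_class R (Q 0)"
    using iso_class_cong[OF regular M_module, of 0] regular_iso_M_0 by (auto simp: Pic_def)
  define X where "X = iso_class R (L 1)"
  have X: "X = iso_class R (Q 1)"
    unfolding X_def using iso_class_cong[OF L(1) M_module] \<delta> by blast
  \<comment> \<open>The tensor inverse is the copy of \<open>M (p - 1)\<close>, which
    \<open>\<epsilon>\<close> has also moved to the type required by
    \<open>invertible_module\<close>.\<close>
  have "invertible_module R (L 1)"
  proof -
    have "mod_iso R (tensor R (L 1) (L (p - 1))) (Q (1 + (p - 1))) \<noteq> {}"
      using p_gt_1 by (intro tensor_M_iso[OF gal _ L(1) \<delta> L(1) \<delta>, of _ 1]) simp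
    also have "1 + (p - 1) = p"
      using p_gt_1 by simp
    finally obtain t where t: "t \<in> mod_iso R (tensor R (L 1) (L (p - 1))) (Q 0)"
      by (auto simp: M_p)
    have "inv_into (carrier (regular_module R)) \<iota> \<in> mod_iso R (Q 0) (regular_module R)"
      by (rule mod_iso_inv_into[OF regular regular_iso_M_0])
    from mod_iso_comp[OF t this] show ?thesis
      using L(1) by (auto simp: invertible_module_def)
  qed
  then have X_Pic: "X \<in> carrier (Pic R)"
    by (auto simp: Pic_def X_def)
  have pow: "X [^]\<^bsub>Pic R\<^esub> n = iso_class R (Q n)" for n :: nat
  proof (induction n)
    case 0
    then show ?case
      using one by (simp add: nat_pow_def)
  next
    case (Suc n)
    have "iso_class R (tensor R V W) = iso_class R (Q (Suc n))"
      if VW: "V \<in> iso_class R (Q n)" "W \<in> iso_class R (Q 1)" for V W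
    proof -
      obtain f h where fh: "f \<in> mod_iso R V (Q n)" "h \<in> mod_iso R W (Q 1)"
        and mods: "module R V" "module R W"
        using VW by (auto simp: iso_class_def)
      interpret VW: module_pair R V W
        using mods by (simp add: module_pair_def)
      have "mod_iso R (tensor R V W) (Q (n + 1)) \<noteq> {}"
        using p_gt_1 by (intro tensor_M_iso[OF gal _ mods(1) fh(1) mods(2) fh(2), of "p - 1"]) simp
      then show ?thesis
        using iso_class_cong[OF VW.tensor_module M_module, of "n + 1"] by simp
    qed
    \<comment> \<open>The product of classes is a union over representatives: all terms agree, and
      \<open>L n\<close> and \<open>L 1\<close> show that there is at least one term.\<close>
    then have "(\<Union>V\<in>iso_class R (Q n). \<Union>W\<in>iso_class R (Q 1). iso_class R (tensor R V W)) =
        iso_class R (Q (Suc n))"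
      using L_class[of n] L_class[of 1] by blast
    moreover have "X [^]\<^bsub>Pic R\<^esub> Suc n = X [^]\<^bsub>Pic R\<^esub> n \<otimes>\<^bsub>Pic R\<^esub> X"
      by (simp add: nat_pow_def)
    ultimately show ?case
      unfolding Suc.IH by (simp add: Pic_def X)
  qed
  have "X [^]\<^bsub>Pic R\<^esub> p = \<one>\<^bsub>Pic R\<^esub>"
    unfolding pow M_p one ..
  then have "X = \<one>\<^bsub>Pic R\<^esub>"
    using pic X_Pic by (auto simp: torsion_subgroup_def)
  then have "L 1 \<in> iso_class R (regular_module R)"
    using L_class[of 1] X by (simp add: Pic_def)
  then obtain t where t: "t \<in> mod_iso R (L 1) (regular_module R)"
    by (auto simp: iso_class_def)
  have "inv_into (carrier (L 1)) t \<in> mod_iso R (regular_module R) (L 1)"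
    by (rule mod_iso_inv_into[OF L(1) t])
  from mod_iso_comp[OF this \<delta>] show ?thesis
    by blast
qed

text \<open>In the partition of 1 of weights 1 and \<open>p - 1\<close>, every factor of weight 1 is
  a multiple of \<open>\<alpha>\<close>; hence \<open>\<alpha>\<close> divides 1.\<close>

lemma unit_of_generator:
  assumes gal: "galois_extension R S G \<phi>"
    and \<alpha>: "\<alpha> \<in> M 1" and gen: "M 1 = (\<lambda>r. r \<odot>\<^bsub>S\<^esub> \<alpha>) ` carrier R"
  shows "\<alpha> \<in> Units S"
proof (rule galois_partition_of_unity[OF gal, of 1 "p - 1"])
  show "1 + (p - 1) = p"
    using p_gt_1 by simp
  fix Z :: "('s \<times> 's) set" and a b
  assume Z: "finite Z" and a: "\<And>z. z \<in> Z \<Longrightarrow> a z \<in> M 1" and b: "\<And>z. z \<in> Z \<Longrightarrow> b z \<in> M (p - 1)"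
    and one: "(\<Oplus>\<^bsub>S\<^esub>z\<in>Z. a z \<otimes>\<^bsub>S\<^esub> b z) = \<one>\<^bsub>S\<^esub>"
  have \<alpha>S: "\<alpha> \<in> carrier S"
    by (rule M_closed[OF \<alpha>])
  have bS: "b z \<in> carrier S" if "z \<in> Z" for z
    by (rule M_closed[OF b[OF that]])
  have "\<forall>z\<in>Z. \<exists>r. r \<in> carrier R \<and> a z = r \<odot>\<^bsub>S\<^esub> \<alpha>"
    using a unfolding gen by blast
  from bchoice[OF this] obtain r
    where r: "\<And>z. z \<in> Z \<Longrightarrow> r z \<in> carrier R" "\<And>z. z \<in> Z \<Longrightarrow> a z = r z \<odot>\<^bsub>S\<^esub> \<alpha>"
    by blast
  have "(\<Oplus>\<^bsub>S\<^esub>z\<in>Z. a z \<otimes>\<^bsub>S\<^esub> b z) = (\<Oplus>\<^bsub>S\<^esub>z\<in>Z. \<alpha> \<otimes>\<^bsub>S\<^esub> (r z \<odot>\<^bsub>S\<^esub> b z))"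
    using r \<alpha>S bS by (intro S.finsum_cong' refl funcsetI) (simp_all add: S.smult_assoc2 smult_right)
  also have "\<dots> = \<alpha> \<otimes>\<^bsub>S\<^esub> (\<Oplus>\<^bsub>S\<^esub>z\<in>Z. r z \<odot>\<^bsub>S\<^esub> b z)"
    using r(1) \<alpha>S bS Z by (intro S.finsum_rdistr[symmetric] funcsetI) auto
  finally have "\<alpha> \<otimes>\<^bsub>S\<^esub> (\<Oplus>\<^bsub>S\<^esub>z\<in>Z. r z \<odot>\<^bsub>S\<^esub> b z) \<in> Units S"
    using one S.Units_one_closed by simp
  then show ?thesis
    by (rule S.Units_of_mult_Units) (use r(1) \<alpha>S bS in \<open>auto intro!: S.finsum_closed\<close>)
qed

text \<open>The element found is the image of 1 under an isomorphism from \<open>R\<close> to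
  \<open>M 1\<close>; as a generator it is a unit.\<close>

lemma galois_eigenspace_free:
  assumes gal: "galois_extension R S G \<phi>"
    and pic: "torsion_subgroup (Pic R) p = {\<one>\<^bsub>Pic R\<^esub>}"
  obtains \<alpha> where "\<alpha> \<in> M 1" "\<alpha> \<in> Units S"
proof -
  obtain t where "t \<in> mod_iso R (regular_module R) (Q 1)"
    using M_regular[OF assms] by blast
  then have t: "t \<in> mod_hom R (regular_module R) (Q 1)" "bij_betw t (carrier R) (M 1)"
    by (auto simp: mod_iso_def regular_module_def)
  have "t r = r \<odot>\<^bsub>S\<^esub> t \<one>" if "r \<in> carrier R" for r
    using mod_homD(3)[OF t(1), of r \<one>] that by (simp add: regular_module_def)
  then have "t ` carrier R = (\<lambda>r. r \<odot>\<^bsub>S\<^esub> t \<one>) ` carrier R"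
    by (rule image_cong[OF refl])
  then have "M 1 = (\<lambda>r. r \<odot>\<^bsub>S\<^esub> t \<one>) ` carrier R"
    unfolding bij_betw_imp_surj_on[OF t(2)] .
  moreover have "t \<one> \<in> M 1"
    using bij_betwE[OF t(2)] by simp
  ultimately show ?thesis
    using unit_of_generator[OF gal] that by blast
qed

section \<open>Kummer extensions\<close>

lemma base_unit:
  assumes x: "x \<in> M 0" "x \<in> Units S"
  shows "x \<in> \<iota> ` Units R"
proof -
  \<comment> \<open>The weight of \<open>x\<close> is read as \<open>p\<close> instead of 0, so that
    the complementary weight of the inverse is 0.\<close>
  have "inv\<^bsub>S\<^esub> x \<in> M 0"
    using x M_inv[of x p 0] M_p by simp
  then obtain r s where rs: "r \<in> carrier R" "x = \<iota> r" "s \<in> carrier R" "inv\<^bsub>S\<^esub> x = \<iota> s"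
    using x(1) by (auto simp: M_0)
  have "\<iota> (r \<otimes> s) = x \<otimes>\<^bsub>S\<^esub> inv\<^bsub>S\<^esub> x"
    using rs \<iota>_mult[OF rs(1,3)] by simp
  also have "\<dots> = \<iota> \<one>"
    using x(2) by (simp add: \<iota>_one)
  finally have "r \<otimes> s = \<one>"
    using rs by (intro \<iota>_inj) auto
  then have "r \<in> Units R"
    using rs by (intro S.R.Units_of_mult_Units[of r s]) auto
  then show ?thesis
    using rs(2) by blast
qed

text \<open>The weight of the quotient is 0, and a unit of \<open>S\<close> that is invariant is a
  unit of \<open>R\<close>. All assertions about quotients of primitive elements reduce to
  this.\<close>

lemma quotient_base_unit:
  assumes x: "x \<in> M k" "x \<in> Units S" and y: "y \<in> M k" "y \<in> Units S" and k: "k \<le> p"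
  shows "x \<otimes>\<^bsub>S\<^esub> inv\<^bsub>S\<^esub> y \<in> \<iota> ` Units R"
proof (rule base_unit)
  have "inv\<^bsub>S\<^esub> y \<in> M (p - k)"
    using y k by (intro M_inv[of y k]) auto
  then have "x \<otimes>\<^bsub>S\<^esub> inv\<^bsub>S\<^esub> y \<in> M (k + (p - k))"
    using x by (intro M_mult)
  then show "x \<otimes>\<^bsub>S\<^esub> inv\<^bsub>S\<^esub> y \<in> M 0"
    using k by (simp add: M_p)
  show "x \<otimes>\<^bsub>S\<^esub> inv\<^bsub>S\<^esub> y \<in> Units S"
    using x y by simp
qed

section \<open>Integer exponents and powers of the character\<close>

lemma \<iota>_Units:
  assumes "u \<in> Units R"
  shows "\<iota> u \<in> Units S"
proof (rule S.Units_of_mult_Units)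
  have "\<iota> u \<otimes>\<^bsub>S\<^esub> \<iota> (inv u) = \<one>\<^bsub>S\<^esub>"
    using assms by (simp add: \<iota>_mult[symmetric] \<iota>_one S.R.Units_closed)
  then show "\<iota> u \<otimes>\<^bsub>S\<^esub> \<iota> (inv u) \<in> Units S"
    by simp
qed (use assms in \<open>auto intro!: \<iota>_closed\<close>)

lemma M_mod: "M (k mod p) = M k"
  using M_cong[of "k mod p" "k div p"] by simp

lemma int_pow_Units: "x \<in> Units S \<Longrightarrow> x [^]\<^bsub>S\<^esub> (b::int) \<in> Units S"
  by (simp del: pow_nat add: int_pow_def2 Units_pow)

lemma int_pow_mem_M:
  assumes x: "x \<in> M 1" "x \<in> Units S"
  shows "x [^]\<^bsub>S\<^esub> b \<in> M (nat (b mod int p))"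
proof (cases "b \<ge> 0")
  case True
  then have "x [^]\<^bsub>S\<^esub> b \<in> M (nat b)"
    using power_mem_M[OF x(1), of "nat b"] by (simp del: pow_nat add: int_pow_def2)
  also have "M (nat b) = M (nat (b mod int p))"
    using True M_mod[of "nat b"] by (simp add: nat_mod_distrib)
  finally show ?thesis .
next
  case False
  define n where "n = nat (- b)"
  have b: "b = - int n"
    using False by (simp add: n_def)
  have "x [^]\<^bsub>S\<^esub> n \<in> M (n mod p)"
    unfolding M_mod by (rule power_mem_M[OF x(1)])
  then have "inv\<^bsub>S\<^esub> (x [^]\<^bsub>S\<^esub> n) \<in> M (p - n mod p)"
    using p_gt_1 Units_pow[OF x(2)] by (intro M_inv[of _ "n mod p"]) auto
  \<comment> \<open>If \<open>p\<close> divides \<open>n\<close>, then \<open>p - n mod p\<close> is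
    \<open>p\<close> itself, so one more reduction is needed.\<close>
  also have "M (p - n mod p) = M ((p - n mod p) mod p)"
    by (rule M_mod[symmetric])
  also have "(p - n mod p) mod p = nat (b mod int p)"
  proof -
    have "int ((p - n mod p) mod p) = (int p - int n mod int p) mod int p"
      using p_gt_1 by (simp add: of_nat_diff zmod_int)
    also have "\<dots> = b mod int p"
      unfolding b by (simp add: mod_minus_eq)
    finally show ?thesis
      by (metis nat_int)
  qed
  finally show ?thesis
    using False by (simp del: pow_nat add: int_pow_def2 n_def)
qed

text \<open>Integer powers are formed in \<open>units_of R\<close>. As
  \<open>\<chi>(g)^p = 1\<close>, they reduce to natural powers in \<open>R\<close>, the form in
  which the weights of \<open>M\<close> are stated.\<close>

lemma char_pow_eq:
  assumes g: "g \<in> carrier G"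
  shows "char_pow R \<chi> b g = \<chi> g [^] nat (b mod int p)"
proof -
  interpret U: group "units_of R"
    by (rule S.R.units_group)
  have x: "\<chi> g \<in> carrier (units_of R)"
    using \<chi>_unit[OF g] by (simp add: units_of_carrier)
  have "\<chi> g [^]\<^bsub>units_of R\<^esub> b = \<chi> g [^]\<^bsub>units_of R\<^esub> (int p * (b div int p) + b mod int p)"
    by simp
  also have "\<dots> = (\<chi> g [^]\<^bsub>units_of R\<^esub> int p) [^]\<^bsub>units_of R\<^esub> (b div int p) \<otimes>\<^bsub>units_of R\<^esub>
      \<chi> g [^]\<^bsub>units_of R\<^esub> (b mod int p)"
    using x by (simp only: U.int_pow_mult U.int_pow_pow)
  also have "\<chi> g [^]\<^bsub>units_of R\<^esub> int p = \<one>\<^bsub>units_of R\<^esub>"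
    using \<chi>_pow_p[OF g] \<chi>_unit[OF g] by (simp add: int_pow_int S.R.units_of_pow units_of_one)
  also have "\<chi> g [^]\<^bsub>units_of R\<^esub> (b mod int p) = \<chi> g [^] nat (b mod int p)"
  proof -
    have "b mod int p \<ge> 0"
      using p_gt_1 by simp
    then show ?thesis
      using \<chi>_unit[OF g] by (simp del: pow_nat add: int_pow_def2 S.R.units_of_pow)
  qed
  finally have "\<chi> g [^]\<^bsub>units_of R\<^esub> b = \<one> \<otimes> \<chi> g [^] nat (b mod int p)"
    unfolding U.int_pow_one by (simp only: units_of_mult units_of_one)
  then show ?thesis
    using \<chi>_closed[OF g] by (simp add: char_pow_def)
qed

text \<open>All powers of \<open>\<chi>\<close> share one family of eigenspaces, so primitive
  elements for different characters can be compared inside one interpretation of the locale.\<close>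

lemma char_space_char_pow: "char_space S G \<phi> (char_pow R \<chi> b) = M (nat (b mod int p))"
  by (auto simp: char_space_def mem_M char_pow_eq)

text \<open>Coprimality puts the residue of \<open>b\<close> strictly between 0 and
  \<open>p\<close>, where no power of an element of order \<open>p\<close> equals 1.\<close>

lemma char_pow_nontrivial:
  assumes b: "coprime b (int p)"
  shows "nontrivial_character G R \<mu> (char_pow R \<chi> b)"
proof -
  define k where "k = nat (b mod int p)"
  have "b mod int p \<noteq> 0"
    using b p_gt_1 by (auto simp: mod_eq_0_iff_dvd dest: coprime_common_divisor_int)
  moreover have "0 \<le> b mod int p" "b mod int p < int p"
    using p_gt_1 by simp_all
  ultimately have k: "0 < k" "k < p"
    unfolding k_def by linarith+
  have hom: "char_pow R \<chi> b \<in> hom G ((units_of R)\<lparr>carrier := \<mu>\<rparr>)"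
    using power_mem_\<mu> \<chi>_mem
    by (auto simp: hom_def char_pow_eq \<chi>_mult S.R.nat_pow_distrib \<chi>_closed units_of_mult)
  obtain h where h: "h \<in> carrier G" "\<chi> h \<noteq> \<one>"
    using nontrivial by (auto simp: nontrivial_character_def)
  have "\<chi> h [^] k \<noteq> \<chi> h [^] (0::nat)"
    using inj_onD[OF \<mu>_powers(2)[OF \<chi>_mem[OF h(1)] h(2)], of k 0] k by auto
  then have "char_pow R \<chi> b h \<noteq> \<one>"
    using h by (simp add: char_pow_eq k_def)
  then show ?thesis
    using hom h(1) by (auto simp: nontrivial_character_def)
qed

text \<open>Evaluation at \<open>\<alpha>\<close> maps \<open>R[T]\<close> onto \<open>S\<close>.
  Its kernel is generated by \<open>T^p - u\<close>: remainders have degree below \<open>p\<close>,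
  and their coefficients are coordinates with respect to the basis of powers of
  \<open>\<alpha>\<close>.\<close>

lemma kummer_iso:
  assumes \<alpha>: "\<alpha> \<in> M 1" "\<alpha> \<in> Units S" and u: "u \<in> carrier R" "\<iota> u = \<alpha> [^]\<^bsub>S\<^esub> p"
  shows "\<exists>f\<in>algebra_iso R S (kummer_extension p R u).
    \<forall>g\<in>carrier G. \<forall>s\<in>carrier S. f (\<phi> g s) = kummer_action p R u \<chi> g (f s)"
proof -
  let ?U = "UP R" and ?I = "kummer_ideal p R u"
  let ?h = "eval R S \<iota> \<alpha>"
  have \<alpha>S: "\<alpha> \<in> carrier S"
    using \<alpha> by auto
  then have pow: "\<alpha> [^]\<^bsub>S\<^esub> (i::nat) \<in> carrier S" for i
    by simp
  have hom_cring: "ring_hom_cring R S \<iota>"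
    by (rule ring_hom_cringI[OF S.R.is_cring S.is_cring \<iota>_hom])
  interpret U: UP_univ_prop R S \<iota> "UP R" \<alpha> ?h
    by (intro UP_univ_prop.intro UP_pre_univ_prop.intro UP_univ_prop_axioms.intro hom_cring
        UP_cring.intro S.R.is_cring \<alpha>S) simp_all
  have U_hom_ring: "ring_hom_ring ?U S ?h"
    by (intro ring_hom_ringI2 U.P.ring_axioms S.ring_axioms U.homh)
  have h_closed: "f \<in> carrier ?U \<Longrightarrow> ?h f \<in> carrier S" for f
    by simp
  define pol where "pol = monom ?U \<one> p \<ominus>\<^bsub>?U\<^esub> monom ?U u 0"
  have pol: "pol \<in> carrier ?U"
    unfolding pol_def using u by simp
  have h_pol: "?h pol = \<zero>\<^bsub>S\<^esub>"
    unfolding pol_def a_minus_def using u pow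
    by (simp add: U.Eval_monom \<iota>_one S.r_neg del: U.monom_a_inv)
  have I: "?I = Idl\<^bsub>?U\<^esub> {pol}"
    by (simp add: kummer_ideal_def pol_def)
  interpret I: ideal ?I ?U
    unfolding I using pol by (intro U.P.genideal_ideal) simp
  have coeff_pol: "coeff ?U pol p = \<one>" "deg R pol = p"
  proof -
    have c: "coeff ?U pol n = (if n = p then \<one> else \<zero>) \<ominus> (if n = 0 then u else \<zero>)" for n
      unfolding pol_def using u(1) by (auto simp: U.coeff_minus)
    then show p1: "coeff ?U pol p = \<one>"
      using p_gt_1 by (simp add: a_minus_def)
    show "deg R pol = p"
    proof (rule antisym)
      show "deg R pol \<le> p"
        by (rule U.deg_aboveI[OF _ pol]) (simp add: c a_minus_def)
      show "p \<le> deg R pol"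
        by (rule U.deg_belowI[OF _ pol]) (simp add: p1 nontrivial_R)
    qed
  qed
  have basis: "is_basis R S {..<p} (\<lambda>i. \<alpha> [^]\<^bsub>S\<^esub> i)"
    using primitive_of_unit[OF \<alpha>] by (simp add: primitive_elt_def)
  \<comment> \<open>The coefficients of \<open>r\<close> and the zero family both represent zero in
    the basis, so they agree.\<close>
  have low_degree: "r = \<zero>\<^bsub>?U\<^esub>" if r: "r \<in> carrier ?U" "deg R r < p" "?h r = \<zero>\<^bsub>S\<^esub>" for r
  proof -
    let ?c = "\<lambda>i\<in>{..<p}. coeff ?U r i" and ?z = "\<lambda>i\<in>{..<p}. \<zero>"
    have coeff: "coeff ?U r i \<in> carrier R" for i
      using r(1) by simp
    have "?h r = (\<Oplus>\<^bsub>S\<^esub>i\<in>{..deg R r}. \<iota> (coeff ?U r i) \<otimes>\<^bsub>S\<^esub> \<alpha> [^]\<^bsub>S\<^esub> i)"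
      using r(1) by (rule U.eval_on_carrier)
    also have "\<dots> = (\<Oplus>\<^bsub>S\<^esub>i\<in>{..<p}. ?c i \<odot>\<^bsub>S\<^esub> \<alpha> [^]\<^bsub>S\<^esub> i)"
      using r coeff pow
      by (intro S.add.finprod_mono_neutral_cong_left) (auto simp: \<iota>_smult U.deg_aboveD)
    finally have c: "?c \<in> {..<p} \<rightarrow>\<^sub>E carrier R \<and> \<zero>\<^bsub>S\<^esub> = (\<Oplus>\<^bsub>S\<^esub>i\<in>{..<p}. ?c i \<odot>\<^bsub>S\<^esub> \<alpha> [^]\<^bsub>S\<^esub> i)"
      using r(3) coeff by simp
    have z: "?z \<in> {..<p} \<rightarrow>\<^sub>E carrier R \<and> \<zero>\<^bsub>S\<^esub> = (\<Oplus>\<^bsub>S\<^esub>i\<in>{..<p}. ?z i \<odot>\<^bsub>S\<^esub> \<alpha> [^]\<^bsub>S\<^esub> i)"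
    proof -
      have "(\<Oplus>\<^bsub>S\<^esub>i\<in>{..<p}. ?z i \<odot>\<^bsub>S\<^esub> \<alpha> [^]\<^bsub>S\<^esub> i) = (\<Oplus>\<^bsub>S\<^esub>i\<in>{..<p}. \<zero>\<^bsub>S\<^esub>)"
        using pow by (intro S.finsum_cong' refl funcsetI) simp_all
      then show ?thesis
        by simp
    qed
    have eq: "?c = ?z"
      by (rule is_basis_unique[OF basis S.zero_closed c z])
    have "coeff ?U r i = \<zero>" for i
    proof (cases "i < p")
      case True
      then show ?thesis
        using fun_cong[OF eq, of i] by simp
    next
      case False
      then show ?thesis
        using r by (intro U.deg_aboveD) auto
    qed
    then show ?thesis
      using r(1) by (intro U.up_eqI) auto
  qed
  have mem_I: "f \<in> ?I \<longleftrightarrow> ?h f = \<zero>\<^bsub>S\<^esub>" if f: "f \<in> carrier ?U" for f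
  proof
    assume "f \<in> ?I"
    moreover have "?I \<subseteq> a_kernel ?U S ?h"
      unfolding I
    proof (rule U.P.genideal_minimal[OF ring_hom_ring.kernel_is_ideal[OF U_hom_ring]])
      show "{pol} \<subseteq> a_kernel ?U S ?h"
        unfolding a_kernel_def' using pol h_pol by blast
    qed
    ultimately have "f \<in> {f \<in> carrier ?U. ?h f = \<zero>\<^bsub>S\<^esub>}"
      unfolding a_kernel_def' by blast
    then show "?h f = \<zero>\<^bsub>S\<^esub>"
      by blast
  next
    assume hf: "?h f = \<zero>\<^bsub>S\<^esub>"
    have "pol \<noteq> \<zero>\<^bsub>?U\<^esub>"
      using coeff_pol(1) nontrivial_R by auto
    \<comment> \<open>The leading coefficient of \<open>pol\<close> is 1, so its power disappears
      and this is division with remainder by a monic polynomial.\<close>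
    from U.long_div_theorem[OF pol f this] obtain q r and k :: nat
      where qr: "q \<in> carrier ?U" "r \<in> carrier ?U"
        "coeff ?U pol (deg R pol) [^] k \<odot>\<^bsub>?U\<^esub> f = pol \<otimes>\<^bsub>?U\<^esub> q \<oplus>\<^bsub>?U\<^esub> r"
        "r = \<zero>\<^bsub>?U\<^esub> \<or> deg R r < deg R pol"
      by blast
    then have fqr: "f = pol \<otimes>\<^bsub>?U\<^esub> q \<oplus>\<^bsub>?U\<^esub> r"
      using f by (simp add: coeff_pol U.smult_one)
    have "?h r = \<zero>\<^bsub>S\<^esub>"
      using hf qr(1,2) pol h_pol by (simp add: fqr)
    then have "r = \<zero>\<^bsub>?U\<^esub>"
      using low_degree[OF qr(2)] qr(4) coeff_pol(2) by auto
    then have "f = pol \<otimes>\<^bsub>?U\<^esub> q"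
      using fqr pol qr by simp
    moreover have "pol \<in> ?I"
      unfolding I using pol by (rule U.P.genideal_self')
    ultimately show "f \<in> ?I"
      using I.I_r_closed qr(1) by simp
  qed
  \<comment> \<open>The coset belonging to \<open>s\<close> is the fibre of the evaluation over
    \<open>s\<close>. Defining the isomorphism on \<open>S\<close> by fibres avoids choosing
    polynomials.\<close>
  define \<psi> where "\<psi> = (\<lambda>s. {f \<in> carrier ?U. ?h f = s})"
  have coset: "?I +>\<^bsub>?U\<^esub> f = \<psi> (?h f)" if f: "f \<in> carrier ?U" for f
  proof -
    have "x \<in> ?I +>\<^bsub>?U\<^esub> f \<longleftrightarrow> x \<in> \<psi> (?h f)" for x
    proof (cases "x \<in> carrier ?U")
      case True
      then have "x \<in> ?I +>\<^bsub>?U\<^esub> f \<longleftrightarrow> ?h (x \<oplus>\<^bsub>?U\<^esub> \<ominus>\<^bsub>?U\<^esub> f) = \<zero>\<^bsub>S\<^esub>"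
        using f by (simp add: I.a_rcos_module mem_I del: U.hom_add)
      also have "\<dots> \<longleftrightarrow> ?h x \<ominus>\<^bsub>S\<^esub> ?h f = \<zero>\<^bsub>S\<^esub>"
        using True f by (simp add: a_minus_def)
      also have "\<dots> \<longleftrightarrow> ?h x = ?h f"
        using True f h_closed by (intro S.M.minus_eq_zero_iff) auto
      finally show ?thesis
        using True by (simp add: \<psi>_def)
    next
      case False
      then show ?thesis
        using I.a_elemrcos_carrier[OF f] by (auto simp: \<psi>_def)
    qed
    then show ?thesis
      by blast
  qed
  have surj: "\<exists>f\<in>carrier ?U. ?h f = s" if s: "s \<in> carrier S" for s
  proof -
    obtain c where c: "c \<in> {..<p} \<rightarrow>\<^sub>E carrier R" "s = (\<Oplus>\<^bsub>S\<^esub>i\<in>{..<p}. c i \<odot>\<^bsub>S\<^esub> \<alpha> [^]\<^bsub>S\<^esub> i)"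
      using basis s unfolding is_basis_def by blast
    then have ci: "c i \<in> carrier R" if "i < p" for i
      using that by auto
    let ?f = "\<Oplus>\<^bsub>?U\<^esub>i\<in>{..<p}. monom ?U (c i) i"
    have f: "(\<lambda>i. monom ?U (c i) i) \<in> {..<p} \<rightarrow> carrier ?U"
      using ci by auto
    have "?h ?f = (\<Oplus>\<^bsub>S\<^esub>i\<in>{..<p}. ?h (monom ?U (c i) i))"
      using U.hom_finsum[OF f] by (simp add: comp_def)
    also have "\<dots> = s"
      unfolding c(2) using ci pow
      by (intro S.finsum_cong' refl funcsetI) (simp_all add: U.Eval_monom \<iota>_smult)
    finally show ?thesis
      using U.P.finsum_closed[OF f] by blast
  qed
  have \<psi>_mem: "\<psi> (?h f) = \<psi> s \<longleftrightarrow> ?h f = s" if "f \<in> carrier ?U" for f s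
    using that by (auto simp: \<psi>_def)
  \<comment> \<open>Scalars and the group act on the quotient by unions over representatives; when
    all these representatives evaluate to \<open>t\<close>, the union is the fibre over
    \<open>t\<close>.\<close>
  have UN_coset: "(\<Union>f\<in>\<psi> s. ?I +>\<^bsub>?U\<^esub> k f) = \<psi> t"
    if s: "s \<in> carrier S" and k: "\<And>f. f \<in> \<psi> s \<Longrightarrow> k f \<in> carrier ?U \<and> ?h (k f) = t" for k s t
  proof -
    have "?I +>\<^bsub>?U\<^esub> k f = \<psi> t" if "f \<in> \<psi> s" for f
      using coset[of "k f"] k[OF that] by simp
    moreover obtain f where "f \<in> \<psi> s"
      using surj[OF s] by (auto simp: \<psi>_def)
    ultimately show ?thesis
      by blast
  qed
  let ?K = "kummer_extension p R u"
  have K_carrier: "carrier ?K = \<psi> ` carrier S"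
  proof -
    have "carrier ?K = (\<lambda>f. ?I +>\<^bsub>?U\<^esub> f) ` carrier ?U"
      by (auto simp: kummer_extension_def quot_module_def A_RCOSETS_def')
    also have "\<dots> = (\<lambda>f. \<psi> (?h f)) ` carrier ?U"
      by (rule image_cong) (simp_all add: coset)
    also have "\<dots> = \<psi> ` ?h ` carrier ?U"
      by (simp add: image_image)
    also have "?h ` carrier ?U = carrier S"
      using surj h_closed by (fastforce simp: image_iff)
    finally show ?thesis .
  qed
  have K_mult: "\<psi> s \<otimes>\<^bsub>?K\<^esub> \<psi> t = \<psi> (s \<otimes>\<^bsub>S\<^esub> t)" if st: "s \<in> carrier S" "t \<in> carrier S" for s t
  proof -
    have "?I +>\<^bsub>?U\<^esub> (f \<otimes>\<^bsub>?U\<^esub> g) = \<psi> (s \<otimes>\<^bsub>S\<^esub> t)" if "f \<in> \<psi> s" "g \<in> \<psi> t" for f g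
      using that by (subst coset) (auto simp: \<psi>_def)
    moreover obtain f g where "f \<in> \<psi> s" "g \<in> \<psi> t"
      using surj[OF st(1)] surj[OF st(2)] by (auto simp: \<psi>_def)
    ultimately have "(\<Union>f\<in>\<psi> s. \<Union>g\<in>\<psi> t. ?I +>\<^bsub>?U\<^esub> (f \<otimes>\<^bsub>?U\<^esub> g)) = \<psi> (s \<otimes>\<^bsub>S\<^esub> t)"
      by blast
    then show ?thesis
      by (simp add: kummer_extension_def quot_module_def rcoset_mult_def)
  qed
  have K_add: "\<psi> s \<oplus>\<^bsub>?K\<^esub> \<psi> t = \<psi> (s \<oplus>\<^bsub>S\<^esub> t)" if st: "s \<in> carrier S" "t \<in> carrier S" for s t
  proof -
    obtain f g where fg: "f \<in> carrier ?U" "?h f = s" "g \<in> carrier ?U" "?h g = t"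
      using surj st by metis
    then have "\<psi> s \<oplus>\<^bsub>?K\<^esub> \<psi> t = (?I +>\<^bsub>?U\<^esub> f) <+>\<^bsub>?U\<^esub> (?I +>\<^bsub>?U\<^esub> g)"
      by (simp add: kummer_extension_def quot_module_def coset)
    also have "\<dots> = ?I +>\<^bsub>?U\<^esub> (f \<oplus>\<^bsub>?U\<^esub> g)"
      by (rule I.a_rcos_sum[OF fg(1,3)])
    also have "\<dots> = \<psi> (s \<oplus>\<^bsub>S\<^esub> t)"
      using fg by (simp add: coset)
    finally show ?thesis .
  qed
  have K_smult: "r \<odot>\<^bsub>?K\<^esub> \<psi> s = \<psi> (r \<odot>\<^bsub>S\<^esub> s)" if rs: "r \<in> carrier R" "s \<in> carrier S" for r s
    unfolding kummer_extension_def quot_module_def using rs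
    by simp (rule UN_coset, auto simp: \<psi>_def U.Eval_smult \<iota>_smult)
  have K_one: "\<one>\<^bsub>?K\<^esub> = \<psi> \<one>\<^bsub>S\<^esub>"
    using coset[OF U.P.one_closed] by (simp add: kummer_extension_def quot_module_def)
  have "inj_on \<psi> (carrier S)"
    using surj by (intro inj_onI) (metis \<psi>_mem)
  then have "\<psi> \<in> algebra_iso R S ?K"
    using K_carrier K_mult K_add K_smult K_one
    by (auto simp: algebra_iso_def ring_iso_def ring_hom_def mod_hom_def bij_betw_def)
  moreover have "\<psi> (\<phi> g s) = kummer_action p R u \<chi> g (\<psi> s)"
    if g: "g \<in> carrier G" and s: "s \<in> carrier S" for g s
  proof -
    let ?\<sigma> = "eval R ?U (\<lambda>a. monom ?U a 0) (monom ?U (\<chi> g) 1)"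
    have mg: "monom ?U (\<chi> g) 1 \<in> carrier ?U"
      using \<chi>_closed[OF g] by simp
    have const: "ring_hom_cring R ?U (\<lambda>a. monom ?U a 0)"
      by (rule ring_hom_cringI[OF S.R.is_cring U.UP_cring U.const_ring_hom])
    have \<sigma>_hom: "?\<sigma> \<in> ring_hom ?U ?U"
      by (intro UP_pre_univ_prop.eval_ring_hom[OF _ mg] UP_pre_univ_prop.intro const
          UP_cring.intro S.R.is_cring)
    \<comment> \<open>Substituting \<open>\<chi>(g) T\<close> and evaluating at
      \<open>\<alpha>\<close> is evaluating at \<open>\<chi>(g) \<alpha>\<close>, which is
      \<open>\<phi> g \<alpha>\<close>; as \<open>\<phi> g\<close> fixes the coefficients, this is
      \<open>\<phi> g\<close> applied to the value of \<open>f\<close>.\<close>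
    have \<sigma>: "?h (?\<sigma> f) = \<phi> g (?h f)" if f: "f \<in> carrier ?U" for f
    proof -
      have coeff: "coeff ?U f i \<in> carrier R" for i
        using f by simp
      have closed: "monom ?U (coeff ?U f i) 0 \<otimes>\<^bsub>?U\<^esub> monom ?U (\<chi> g) 1 [^]\<^bsub>?U\<^esub> i \<in> carrier ?U" for i
        by (intro U.P.m_closed U.monom_closed U.P.nat_pow_closed coeff \<chi>_closed[OF g])
      have \<alpha>g: "?h (monom ?U (\<chi> g) 1) = \<phi> g \<alpha>"
        using \<alpha>(1) g \<chi>_closed[OF g] \<alpha>S by (simp add: U.Eval_monom mem_M \<iota>_smult del: One_nat_def)
      have "?\<sigma> f = (\<Oplus>\<^bsub>?U\<^esub>i\<in>{..deg R f}. monom ?U (coeff ?U f i) 0 \<otimes>\<^bsub>?U\<^esub> monom ?U (\<chi> g) 1 [^]\<^bsub>?U\<^esub> i)"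
        by (rule U.eval_on_carrier[OF f])
      then have "?h (?\<sigma> f) =
          (\<Oplus>\<^bsub>S\<^esub>i\<in>{..deg R f}. ?h (monom ?U (coeff ?U f i) 0 \<otimes>\<^bsub>?U\<^esub> monom ?U (\<chi> g) 1 [^]\<^bsub>?U\<^esub> i))"
        using U.hom_finsum[of "\<lambda>i. monom ?U (coeff ?U f i) 0 \<otimes>\<^bsub>?U\<^esub> monom ?U (\<chi> g) 1 [^]\<^bsub>?U\<^esub> i" "{..deg R f}"]
          closed by (simp add: comp_def)
      also have "\<dots> = (\<Oplus>\<^bsub>S\<^esub>i\<in>{..deg R f}. \<phi> g (\<iota> (coeff ?U f i) \<otimes>\<^bsub>S\<^esub> \<alpha> [^]\<^bsub>S\<^esub> i))"
      proof (intro S.finsum_cong' refl funcsetI)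
        fix i
        have "?h (monom ?U (coeff ?U f i) 0 \<otimes>\<^bsub>?U\<^esub> monom ?U (\<chi> g) 1 [^]\<^bsub>?U\<^esub> i) =
            ?h (monom ?U (coeff ?U f i) 0) \<otimes>\<^bsub>S\<^esub> ?h (monom ?U (\<chi> g) 1) [^]\<^bsub>S\<^esub> i"
          using coeff mg U.hom_mult U.hom_pow U.monom_closed U.P.nat_pow_closed by metis
        also have "\<dots> = \<iota> (coeff ?U f i) \<otimes>\<^bsub>S\<^esub> \<phi> g \<alpha> [^]\<^bsub>S\<^esub> i"
          unfolding \<alpha>g using coeff by (simp add: U.Eval_monom \<iota>_closed)
        also have "\<dots> = \<phi> g (\<iota> (coeff ?U f i)) \<otimes>\<^bsub>S\<^esub> \<phi> g (\<alpha> [^]\<^bsub>S\<^esub> i)"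
        proof -
          have "\<iota> (coeff ?U f i) \<in> {s \<in> carrier S. \<forall>g\<in>carrier G. \<phi> g s = s}"
            unfolding base_iff[symmetric] using coeff by blast
          then show ?thesis
            using g \<alpha>S by (simp add: \<phi>_pow)
        qed
        also have "\<dots> = \<phi> g (\<iota> (coeff ?U f i) \<otimes>\<^bsub>S\<^esub> \<alpha> [^]\<^bsub>S\<^esub> i)"
          using coeff g pow \<iota>_closed by (simp add: \<phi>_mult)
        finally show "?h (monom ?U (coeff ?U f i) 0 \<otimes>\<^bsub>?U\<^esub> monom ?U (\<chi> g) 1 [^]\<^bsub>?U\<^esub> i) =
            \<phi> g (\<iota> (coeff ?U f i) \<otimes>\<^bsub>S\<^esub> \<alpha> [^]\<^bsub>S\<^esub> i)" .
        show "\<phi> g (\<iota> (coeff ?U f i) \<otimes>\<^bsub>S\<^esub> \<alpha> [^]\<^bsub>S\<^esub> i) \<in> carrier S"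
          using coeff g pow \<iota>_closed by (simp add: \<phi>_closed)
      qed
      also have "\<dots> = \<phi> g (\<Oplus>\<^bsub>S\<^esub>i\<in>{..deg R f}. \<iota> (coeff ?U f i) \<otimes>\<^bsub>S\<^esub> \<alpha> [^]\<^bsub>S\<^esub> i)"
        using coeff g pow \<iota>_closed by (intro \<phi>_finsum[symmetric]) auto
      also have "(\<Oplus>\<^bsub>S\<^esub>i\<in>{..deg R f}. \<iota> (coeff ?U f i) \<otimes>\<^bsub>S\<^esub> \<alpha> [^]\<^bsub>S\<^esub> i) = ?h f"
        by (rule U.eval_on_carrier[OF f, symmetric])
      finally show ?thesis .
    qed
    have "kummer_action p R u \<chi> g (\<psi> s) = (\<Union>f\<in>\<psi> s. ?I +>\<^bsub>?U\<^esub> ?\<sigma> f)"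
      by (simp add: kummer_action_def)
    also have "\<dots> = \<psi> (\<phi> g s)"
      using \<sigma> ring_hom_closed[OF \<sigma>_hom] by (intro UN_coset[OF s]) (simp add: \<psi>_def)
    finally show ?thesis ..
  qed
  ultimately show ?thesis
    by blast
qed

lemma eigenspace_free:
  assumes \<alpha>: "\<alpha> \<in> M 1" "\<alpha> \<in> Units S"
  shows "free_of_rank R (S\<lparr>carrier := char_space S G \<phi> \<chi>\<rparr>) 1"
proof -
  let ?Q = "S\<lparr>carrier := M 1\<rparr>"
  interpret Q: module R ?Q
    by (rule M_module)
  have \<alpha>S: "\<alpha> \<in> carrier S"
    using \<alpha> by auto
  have sum: "(\<Oplus>\<^bsub>?Q\<^esub>i\<in>{..<1::nat}. c i \<odot>\<^bsub>?Q\<^esub> \<alpha>) = c 0 \<odot>\<^bsub>S\<^esub> \<alpha>" if "c 0 \<in> carrier R" for c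
  proof -
    have one: "{..<1::nat} = insert 0 {}"
      by auto
    show ?thesis
      unfolding one
      using M_smult[OF that \<alpha>(1)] Q.M.r_zero[of "c 0 \<odot>\<^bsub>S\<^esub> \<alpha>"]
      by (subst Q.M.finsum_insert) (simp_all del: One_nat_def)
  qed
  have "\<exists>!c. c \<in> {..<1::nat} \<rightarrow>\<^sub>E carrier R \<and> x = (\<Oplus>\<^bsub>?Q\<^esub>i\<in>{..<1}. c i \<odot>\<^bsub>?Q\<^esub> \<alpha>)"
    if x: "x \<in> M 1" for x
  proof -
    obtain r where r: "r \<in> carrier R" "x = r \<odot>\<^bsub>S\<^esub> \<alpha>"
      using M_eq_smult_power[OF \<alpha> x] \<alpha>S by auto
    show ?thesis
    proof (rule ex1I[of _ "\<lambda>i\<in>{..<1::nat}. r"])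
      show "(\<lambda>i\<in>{..<1}. r) \<in> {..<1::nat} \<rightarrow>\<^sub>E carrier R \<and>
          x = (\<Oplus>\<^bsub>?Q\<^esub>i\<in>{..<1}. (\<lambda>i\<in>{..<1::nat}. r) i \<odot>\<^bsub>?Q\<^esub> \<alpha>)"
        using r by (subst sum) auto
      fix c assume c: "c \<in> {..<1::nat} \<rightarrow>\<^sub>E carrier R \<and> x = (\<Oplus>\<^bsub>?Q\<^esub>i\<in>{..<1}. c i \<odot>\<^bsub>?Q\<^esub> \<alpha>)"
      then have c0: "c 0 \<in> carrier R"
        by auto
      have "c 0 \<odot>\<^bsub>S\<^esub> \<alpha> = r \<odot>\<^bsub>S\<^esub> \<alpha>"
        using c sum[of c, OF c0] r(2) by metis
      then have "c 0 = r"
        using smult_unit_cancel[OF \<alpha>(2)] c0 r(1) by blast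
      then show "c = (\<lambda>i\<in>{..<1::nat}. r)"
        using c r(1) by (intro PiE_ext[of c "{..<1}" "\<lambda>_. carrier R"]) auto
    qed
  qed
  then have "is_basis R ?Q {..<1::nat} (\<lambda>_. \<alpha>)"
    using \<alpha>(1) by (simp add: is_basis_def)
  then show ?thesis
    using M_module[of 1] unfolding free_of_rank_def M_1 by blast
qed

end

theorem theorem3p22:
  fixes p :: nat
    and R :: "'a ring" and \<mu> :: "'a set"
    and S :: "('a, 's) module"
    and G :: "'g monoid" and \<phi> :: "'g \<Rightarrow> 's \<Rightarrow> 's"
    and \<chi> :: "'g \<Rightarrow> 'a"
  assumes "prime p"
    and "p_kummerian p R \<mu>"
    and "torsion_subgroup (Pic R) p = {\<one>\<^bsub>Pic R\<^esub>}"
    and "separable_algebra R S"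
    and "group G" and "cyclic_group G" and "order G = p"
    and "algebra_action R S G \<phi>"
    and "invariants_eq_base R S G \<phi>"
    and "nontrivial_character G R \<mu> \<chi>"
  shows
    \<comment> \<open>(1) iff (2)\<close>
    "(galois_extension R S G \<phi> \<longleftrightarrow> (\<exists>\<alpha>. primitive_elt p R S G \<phi> \<chi> \<alpha>)) \<and>
     (galois_extension R S G \<phi> \<longrightarrow>
       \<comment> \<open>(3)\<close>
       (free_of_rank R (S\<lparr>carrier := char_space S G \<phi> \<chi>\<rparr>) 1 \<and>
        (\<forall>\<alpha>\<in>char_space S G \<phi> \<chi>.
           char_space S G \<phi> \<chi> = (\<lambda>r. r \<odot>\<^bsub>S\<^esub> \<alpha>) ` carrier R \<longrightarrow> primitive_elt p R S G \<phi> \<chi> \<alpha>)) \<and>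
       \<comment> \<open>(4)\<close>
       (\<forall>\<alpha>. primitive_elt p R S G \<phi> \<chi> \<alpha> \<longrightarrow>
          (\<exists>u\<in>Units R. structure_map S u = \<alpha> [^]\<^bsub>S\<^esub> p \<and>
             (\<exists>f\<in>algebra_iso R S (kummer_extension p R u).
                \<forall>g\<in>carrier G. \<forall>s\<in>carrier S. f (\<phi> g s) = kummer_action p R u \<chi> g (f s)))) \<and>
       \<comment> \<open>(5)\<close>
       (\<forall>\<alpha> \<beta>. primitive_elt p R S G \<phi> \<chi> \<alpha> \<and> primitive_elt p R S G \<phi> \<chi> \<beta> \<longrightarrow>
          \<beta> \<in> Units S \<and> \<alpha> \<otimes>\<^bsub>S\<^esub> inv\<^bsub>S\<^esub> \<beta> \<in> structure_map S ` Units R) \<and>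
       \<comment> \<open>(6)\<close>
       (\<forall>\<alpha>. \<forall>b::int. primitive_elt p R S G \<phi> \<chi> \<alpha> \<and> coprime b (int p) \<longrightarrow>
          \<alpha> \<in> Units S \<and>
          {\<beta>. primitive_elt p R S G \<phi> (char_pow R \<chi> b) \<beta>} =
          {structure_map S u \<otimes>\<^bsub>S\<^esub> \<alpha> [^]\<^bsub>S\<^esub> b | u. u \<in> Units R}) \<and>
       \<comment> \<open>(7)\<close>
       (\<forall>\<chi>\<^sub>1 \<chi>\<^sub>2 \<alpha>\<^sub>1 \<alpha>\<^sub>2. \<forall>b::int.
          nontrivial_character G R \<mu> \<chi>\<^sub>1 \<and> nontrivial_character G R \<mu> \<chi>\<^sub>2 \<and> coprime b (int p) \<and>
          (\<forall>g\<in>carrier G. \<chi>\<^sub>1 g = char_pow R \<chi>\<^sub>2 b g) \<and>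
          primitive_elt p R S G \<phi> \<chi>\<^sub>1 \<alpha>\<^sub>1 \<and> primitive_elt p R S G \<phi> \<chi>\<^sub>2 \<alpha>\<^sub>2 \<longrightarrow>
          \<alpha>\<^sub>2 \<in> Units S \<and> \<alpha>\<^sub>1 \<otimes>\<^bsub>S\<^esub> inv\<^bsub>S\<^esub> (\<alpha>\<^sub>2 [^]\<^bsub>S\<^esub> b) \<in> structure_map S ` Units R))"
proof -
  have setting: "kummer_setting p R \<mu> S G \<phi>"
    using assms by (simp add: kummer_setting_def)
  \<comment> \<open>Kept general in \<open>\<psi>\<close>: besides \<open>\<chi>\<close> it is used
    for \<open>\<chi>^b\<close> and for the two characters of the last assertion.\<close>
  have character: "kummer_character p R \<mu> S G \<phi> \<psi>" if "nontrivial_character G R \<mu> \<psi>" for \<psi>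
    using setting that by (simp add: kummer_character_def kummer_character_axioms_def)
  interpret K: kummer_character p R \<mu> S G \<phi> \<chi>
    by (rule character) fact
  have prim: "primitive_elt p R S G \<phi> \<chi> \<alpha> \<longleftrightarrow> \<alpha> \<in> K.M 1 \<and> \<alpha> \<in> Units S" for \<alpha>
    using K.primitive_iff by (simp only: K.M_1)
  have "galois_extension R S G \<phi> \<longleftrightarrow> (\<exists>\<alpha>. primitive_elt p R S G \<phi> \<chi> \<alpha>)"
    using K.galois_of_unit K.galois_eigenspace_free[OF _ assms(3)] unfolding prim by metis
  moreover have "free_of_rank R (S\<lparr>carrier := char_space S G \<phi> \<chi>\<rparr>) 1"
    if "galois_extension R S G \<phi>"
    using K.galois_eigenspace_free[OF that assms(3)] K.eigenspace_free by metis
  moreover have "\<forall>\<alpha>\<in>char_space S G \<phi> \<chi>.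
      char_space S G \<phi> \<chi> = (\<lambda>r. r \<odot>\<^bsub>S\<^esub> \<alpha>) ` carrier R \<longrightarrow> primitive_elt p R S G \<phi> \<chi> \<alpha>"
    if "galois_extension R S G \<phi>"
    using K.unit_of_generator[OF that] unfolding prim K.M_1 by blast
  moreover have "\<exists>u\<in>Units R. structure_map S u = \<alpha> [^]\<^bsub>S\<^esub> p \<and>
      (\<exists>f\<in>algebra_iso R S (kummer_extension p R u).
        \<forall>g\<in>carrier G. \<forall>s\<in>carrier S. f (\<phi> g s) = kummer_action p R u \<chi> g (f s))"
    if "primitive_elt p R S G \<phi> \<chi> \<alpha>" for \<alpha>
  proof -
    have \<alpha>: "\<alpha> \<in> K.M 1" "\<alpha> \<in> Units S"
      using that prim by auto
    have "\<alpha> [^]\<^bsub>S\<^esub> p \<in> K.M 0"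
      using K.power_mem_M[OF \<alpha>(1), of p] by (simp only: K.M_p)
    from K.base_unit[OF this K.Units_pow[OF \<alpha>(2)]]
    obtain u where u: "u \<in> Units R" "structure_map S u = \<alpha> [^]\<^bsub>S\<^esub> p"
      by (elim imageE) simp
    then show ?thesis
      using K.kummer_iso[OF \<alpha> K.S.R.Units_closed[OF u(1)] u(2)] by blast
  qed
  moreover have "\<beta> \<in> Units S \<and> \<alpha> \<otimes>\<^bsub>S\<^esub> inv\<^bsub>S\<^esub> \<beta> \<in> structure_map S ` Units R"
    if "primitive_elt p R S G \<phi> \<chi> \<alpha>" "primitive_elt p R S G \<phi> \<chi> \<beta>" for \<alpha> \<beta>
    using that K.quotient_base_unit[of \<alpha> 1 \<beta>] K.p_gt_1 unfolding prim by auto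
  moreover have "\<alpha> \<in> Units S \<and> {\<beta>. primitive_elt p R S G \<phi> (char_pow R \<chi> b) \<beta>} =
      {structure_map S u \<otimes>\<^bsub>S\<^esub> \<alpha> [^]\<^bsub>S\<^esub> b | u. u \<in> Units R}"
    if \<alpha>: "primitive_elt p R S G \<phi> \<chi> \<alpha>" and b: "coprime b (int p)" for \<alpha> b
  proof
    define k where "k = nat (b mod int p)"
    have k: "k \<le> p"
      using K.p_gt_1 by (simp add: k_def nat_le_iff less_imp_le)
    have \<alpha>M: "\<alpha> \<in> K.M 1" and unit: "\<alpha> \<in> Units S"
      using \<alpha> prim by auto
    show "\<alpha> \<in> Units S"
      by (rule unit)
    have pow: "\<alpha> [^]\<^bsub>S\<^esub> b \<in> K.M k" "\<alpha> [^]\<^bsub>S\<^esub> b \<in> Units S"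
      unfolding k_def using K.int_pow_mem_M[OF \<alpha>M unit] K.int_pow_Units[OF unit] by auto
    interpret B: kummer_character p R \<mu> S G \<phi> "char_pow R \<chi> b"
      by (rule character[OF K.char_pow_nontrivial[OF b]])
    \<comment> \<open>Primitivity for \<open>\<chi>^b\<close> is measured with the weight spaces of
      \<open>\<chi>\<close>: the primitive elements are the units of weight \<open>k\<close>, and
      \<open>\<alpha>^b\<close> is one of them.\<close>
    have primB: "primitive_elt p R S G \<phi> (char_pow R \<chi> b) \<beta> \<longleftrightarrow> \<beta> \<in> K.M k \<and> \<beta> \<in> Units S" for \<beta>
      unfolding B.primitive_iff K.char_space_char_pow k_def ..
    have "\<exists>u\<in>Units R. \<beta> = structure_map S u \<otimes>\<^bsub>S\<^esub> \<alpha> [^]\<^bsub>S\<^esub> b"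
      if \<beta>: "\<beta> \<in> K.M k" "\<beta> \<in> Units S" for \<beta>
    proof -
      obtain u where u: "u \<in> Units R" "\<beta> \<otimes>\<^bsub>S\<^esub> inv\<^bsub>S\<^esub> (\<alpha> [^]\<^bsub>S\<^esub> b) = structure_map S u"
        using K.quotient_base_unit[OF \<beta> pow k] by blast
      have "\<beta> = \<beta> \<otimes>\<^bsub>S\<^esub> inv\<^bsub>S\<^esub> (\<alpha> [^]\<^bsub>S\<^esub> b) \<otimes>\<^bsub>S\<^esub> \<alpha> [^]\<^bsub>S\<^esub> b"
        using \<beta> pow by (simp add: K.S.m_assoc K.S.Units_closed)
      then show ?thesis
        using u by auto
    qed
    moreover have "structure_map S u \<otimes>\<^bsub>S\<^esub> \<alpha> [^]\<^bsub>S\<^esub> b \<in> K.M k \<and>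
        structure_map S u \<otimes>\<^bsub>S\<^esub> \<alpha> [^]\<^bsub>S\<^esub> b \<in> Units S" if u: "u \<in> Units R" for u
    proof -
      have "structure_map S u \<in> K.M 0"
        unfolding K.M_0 using K.S.R.Units_closed[OF u] by blast
      then show ?thesis
        using K.M_mult[OF _ pow(1), of _ 0] K.\<iota>_Units[OF u] pow(2) by simp
    qed
    ultimately show "{\<beta>. primitive_elt p R S G \<phi> (char_pow R \<chi> b) \<beta>} =
        {structure_map S u \<otimes>\<^bsub>S\<^esub> \<alpha> [^]\<^bsub>S\<^esub> b | u. u \<in> Units R}"
      unfolding primB by blast
  qed
  moreover have "\<alpha>2 \<in> Units S \<and> \<alpha>1 \<otimes>\<^bsub>S\<^esub> inv\<^bsub>S\<^esub> (\<alpha>2 [^]\<^bsub>S\<^esub> b) \<in> structure_map S ` Units R"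
    if \<chi>: "nontrivial_character G R \<mu> \<chi>1" "nontrivial_character G R \<mu> \<chi>2"
      "\<forall>g\<in>carrier G. \<chi>1 g = char_pow R \<chi>2 b g"
      and \<alpha>: "primitive_elt p R S G \<phi> \<chi>1 \<alpha>1" "primitive_elt p R S G \<phi> \<chi>2 \<alpha>2"
    for \<chi>1 \<chi>2 \<alpha>1 \<alpha>2 and b :: int
  proof -
    interpret K1: kummer_character p R \<mu> S G \<phi> \<chi>1
      by (rule character) fact
    interpret K2: kummer_character p R \<mu> S G \<phi> \<chi>2
      by (rule character) fact
    \<comment> \<open>The two characters agree on the carrier of \<open>G\<close>, which is all that
      an eigenspace depends on. Thus \<open>\<alpha>1\<close> and the power of
      \<open>\<alpha>2\<close> are units of the same weight with respect to
      \<open>\<chi>2\<close>.\<close>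
    have "char_space S G \<phi> \<chi>1 = char_space S G \<phi> (char_pow R \<chi>2 b)"
      using \<chi>(3) by (auto simp: char_space_def)
    then have \<alpha>1: "\<alpha>1 \<in> K2.M (nat (b mod int p))" "\<alpha>1 \<in> Units S"
      using \<alpha>(1) by (simp_all add: K1.primitive_iff K2.char_space_char_pow)
    have \<alpha>2: "\<alpha>2 \<in> K2.M 1" "\<alpha>2 \<in> Units S"
      using \<alpha>(2) unfolding K2.primitive_iff K2.M_1 by auto
    have "nat (b mod int p) \<le> p"
      using K.p_gt_1 by (simp add: nat_le_iff less_imp_le)
    then show ?thesis
      using K2.quotient_base_unit[OF \<alpha>1 K2.int_pow_mem_M[OF \<alpha>2] K2.int_pow_Units[OF \<alpha>2(2)]] \<alpha>2(2)
      by blast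
  qed
  ultimately show ?thesis
    by blast
qed

end
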